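(* Let $n\ge 8$ be even and let $H$ be a proper strong Gelfand subgroup of $G_n=\mathrm{Sp}(n,2)$. Then (i) $H$ acts transitively (by conjugation) on the set $\mathcal T$ of symplectic transvections of $G_n$; and (ii) $H$ does not contain any symplectic transvections.
   Context: For even $n$, let $V=\mathbb F_2^n$ carry a non-degenerate symplectic (alternating) form $u\cdot v$, and let $G_n=\mathrm{Sp}(n,2)=\mathrm{Sp}(V)$ be its isometry group. For $0\ne v\in V$ the symplectic transvection $t_v$ is $w\mapsto w+(v\cdot w)v$, and $\mathcal T=\{t_v:0\ne v\in V\}$. For a finite group $G$ and a subgroup $H\le G$, $(G,H)$ is a strong Gelfand pair (and $H$ is a strong Gelfand subgroup of $G$) if $\langle\psi,\chi|_H\rangle\le1$ for every complex irreducible character $\chi$ of $G$ and every complex irreducible character $\psi$ of $H$. *)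

theory Defs
  imports
    "HOL-Library.Z2"
    "HOL-Algebra.Group_Action"
    "HOL-Analysis.Cartesian_Space"
    "Jordan_Normal_Form.VS_Connect"
begin

text \<open>
  Both HOL-Analysis and Jordan_Normal_Form are in scope. The space \<open>\<F>\<^sub>2\<^sup>n\<close> is the type
  \<open>bit^'n\<close> of HOL-Analysis with \<open>n = CARD('n)\<close>; the matrices \<open>'a mat\<close>, whose dimension is
  an ordinary number, carry the complex representations, whose degree is quantified over.
\<close>

definition GL :: "nat \<Rightarrow> complex mat monoid" where
  "GL d = units_of (ring_mat TYPE(complex) d ())"

definition representation :: "('a, 'b) monoid_scheme \<Rightarrow> nat \<Rightarrow> ('a \<Rightarrow> complex mat) \<Rightarrow> bool" where
  "representation G d \<rho> \<longleftrightarrow> \<rho> \<in> hom G (GL d)"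

definition invariant_subspace ::
  "('a, 'b) monoid_scheme \<Rightarrow> nat \<Rightarrow> ('a \<Rightarrow> complex mat) \<Rightarrow> complex Matrix.vec set \<Rightarrow> bool" where
  "invariant_subspace G d \<rho> W \<longleftrightarrow>
     VectorSpace.subspace class_ring W (module_vec TYPE(complex) d) \<and>
     (\<forall>g\<in>carrier G. \<forall>w\<in>W. \<rho> g *\<^sub>v w \<in> W)"

definition irreducible_representation ::
  "('a, 'b) monoid_scheme \<Rightarrow> nat \<Rightarrow> ('a \<Rightarrow> complex mat) \<Rightarrow> bool" where
  "irreducible_representation G d \<rho> \<longleftrightarrow>
     representation G d \<rho> \<and> d > 0 \<and>
     (\<forall>W. invariant_subspace G d \<rho> W \<longrightarrow> W = {0\<^sub>v d} \<or> W = carrier_vec d)"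

definition mat_trace :: "complex mat \<Rightarrow> complex" where
  "mat_trace A = (\<Sum>i<dim_row A. A $$ (i, i))"

definition irreducible_characters :: "('a, 'b) monoid_scheme \<Rightarrow> ('a \<Rightarrow> complex) set" where
  "irreducible_characters G =
     {\<theta>. \<exists>d \<rho>. irreducible_representation G d \<rho> \<and> \<theta> = (\<lambda>g\<in>carrier G. mat_trace (\<rho> g))}"

definition character_inner ::
  "('a, 'b) monoid_scheme \<Rightarrow> ('a \<Rightarrow> complex) \<Rightarrow> ('a \<Rightarrow> complex) \<Rightarrow> complex" where
  "character_inner G \<phi> \<psi> = (\<Sum>g\<in>carrier G. \<phi> g * cnj (\<psi> g)) / of_nat (Coset.order G)"

text \<open>
  Meant for a finite group \<open>G\<close>. The inequality is the order of \<open>HOL-Library.Complex_Order\<close>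
  (equal imaginary parts); the inner product of two characters is a natural number.
\<close>

definition strong_gelfand_subgroup :: "'a set \<Rightarrow> ('a, 'b) monoid_scheme \<Rightarrow> bool" where
  "strong_gelfand_subgroup H G \<longleftrightarrow>
     subgroup H G \<and>
     (\<forall>\<theta>\<in>irreducible_characters G. \<forall>\<psi>\<in>irreducible_characters (G\<lparr>carrier := H\<rparr>).
        character_inner (G\<lparr>carrier := H\<rparr>) \<psi> (restrict \<theta> H) \<le> 1)"

definition symplectic_form :: "(bit^'n \<Rightarrow> bit^'n \<Rightarrow> bit) \<Rightarrow> bool" where
  "symplectic_form B \<longleftrightarrow>
     (\<forall>u. Vector_Spaces.linear (*s) (*) (\<lambda>v. B u v)) \<and>
     (\<forall>v. Vector_Spaces.linear (*s) (*) (\<lambda>u. B u v)) \<and>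
     (\<forall>v. B v v = 0) \<and>
     (\<forall>v. (\<forall>w. B v w = 0) \<longrightarrow> v = 0)"

definition Sp :: "(bit^'n \<Rightarrow> bit^'n \<Rightarrow> bit) \<Rightarrow> (bit^'n \<Rightarrow> bit^'n) monoid" where
  "Sp B = \<lparr>carrier = {f. Vector_Spaces.linear (*s) (*s) f \<and> bij f \<and>
                         (\<forall>u v. B (f u) (f v) = B u v)},
           monoid.mult = (\<circ>), one = id\<rparr>"

definition transvection :: "(bit^'n \<Rightarrow> bit^'n \<Rightarrow> bit) \<Rightarrow> bit^'n \<Rightarrow> bit^'n \<Rightarrow> bit^'n" where
  "transvection B v = (\<lambda>w. w + B v w *s v)"

definition transvections :: "(bit^'n \<Rightarrow> bit^'n \<Rightarrow> bit) \<Rightarrow> (bit^'n \<Rightarrow> bit^'n) set" where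
  "transvections B = {transvection B v | v. v \<noteq> 0}"

definition conjugation :: "('a, 'b) monoid_scheme \<Rightarrow> 'a set \<Rightarrow> 'a \<Rightarrow> 'a \<Rightarrow> 'a" where
  "conjugation G X h = (\<lambda>x\<in>X. h \<otimes>\<^bsub>G\<^esub> x \<otimes>\<^bsub>G\<^esub> inv\<^bsub>G\<^esub> h)"

lemma group_Sp: "group (Sp B)"
proof (rule groupI)
  fix f assume f: "f \<in> carrier (Sp B)"
  then have lin: "Vector_Spaces.linear (*s) (*s) f" and bij: "bij f"
    and iso: "\<And>u v. B (f u) (f v) = B u v"
    by (auto simp: Sp_def)
  interpret f: Vector_Spaces.linear "(*s)" "(*s)" f by (rule lin)
  have inv: "f (inv_into UNIV f x) = x" for x
    using bij by (simp add: bij_is_surj surj_f_inv_f)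
  have inv': "inv_into UNIV f (f x) = x" for x
    using bij by (simp add: bij_is_inj inv_f_f)
  have "Vector_Spaces.linear (*s) (*s) (inv_into UNIV f)"
  proof (unfold_locales)
    show "inv_into UNIV f (x + y) = inv_into UNIV f x + inv_into UNIV f y" for x y
      by (metis f.add inv inv')
    show "inv_into UNIV f (r *s x) = r *s inv_into UNIV f x" for r x
      by (metis f.scale inv inv')
  qed
  moreover have "B (inv_into UNIV f u) (inv_into UNIV f v) = B u v" for u v
    by (metis inv iso)
  ultimately show "\<exists>g\<in>carrier (Sp B). g \<otimes>\<^bsub>Sp B\<^esub> f = \<one>\<^bsub>Sp B\<^esub>"
    using bij by (intro bexI[of _ "inv_into UNIV f"])
      (auto simp: Sp_def bij_imp_bij_inv inv' fun_eq_iff)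
next
  have "Vector_Spaces.linear (*s) (*s) (id :: bit^'n \<Rightarrow> bit^'n)"
    by unfold_locales auto
  then show "\<one>\<^bsub>Sp B\<^esub> \<in> carrier (Sp B)"
    by (simp add: Sp_def)
qed (auto simp: Sp_def o_assoc bij_comp Vector_Spaces.linear_compose)

instance bit :: finite
proof
  have "(UNIV :: bit set) = {0, 1}"
    by auto
  then show "finite (UNIV :: bit set)"
    by (metis finite.emptyI finite.insertI)
qed

lemma finite_Sp: "finite (carrier (Sp (B :: bit^'n \<Rightarrow> bit^'n \<Rightarrow> bit)))"
proof -
  have V: "finite (UNIV :: (bit^'n) set)"
    by simp
  have "finite (UNIV :: (bit^'n \<Rightarrow> bit^'n) set)"
    using finite_PiE[OF V, of "\<lambda>_. UNIV :: (bit^'n) set"] V by (simp add: PiE_UNIV_domain)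
  then show ?thesis
    by (rule rev_finite_subset) simp
qed

lemma transvections_subset:
  fixes B :: "bit^'n \<Rightarrow> bit^'n \<Rightarrow> bit"
  assumes "symplectic_form B"
  shows "transvections B \<subseteq> carrier (Sp B)"
proof (clarsimp simp: transvections_def)
  fix v :: "bit^'n" assume "v \<noteq> 0"
  interpret L: Vector_Spaces.linear "(*s)" "(*)" "\<lambda>w. B u w" for u
    using assms by (simp add: symplectic_form_def)
  interpret R: Vector_Spaces.linear "(*s)" "(*)" "\<lambda>w. B w u" for u
    using assms by (simp add: symplectic_form_def)
  have alt: "B w w = 0" for w
    using assms by (simp add: symplectic_form_def)
  have sym: "B u w = B w u" for u w
  proof -
    have "B (u + w) (u + w) = B u u + B w u + (B u w + B w w)"
      by (simp only: L.add R.add)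
    then have "B u w - B w u = 0"
      by (simp only: alt minus_bit_def add_0_left add_0_right add.commute)
    then show ?thesis
      by (simp only: eq_iff_diff_eq_0[symmetric])
  qed
  have bit2: "a + a = 0" for a :: bit
    by (metis diff_self minus_bit_def)
  have dbl: "x + (y + y) = x" for x y :: "bit^'n"
    by (simp only: Finite_Cartesian_Product.vec_eq_iff vector_add_component bit2 add_0_right simp_thms)
  have "transvection B v \<circ> transvection B v = id"
    by (simp only: transvection_def fun_eq_iff L.add L.scale alt o_apply id_apply
      mult_zero_right add_0_right add.assoc dbl simp_thms)
  then have "bij (transvection B v)"
    by (meson o_bij)
  moreover have "Vector_Spaces.linear (*s) (*s) (transvection B v)"
  proof unfold_locales
    show "transvection B v (x + y) = transvection B v x + transvection B v y" for x y
      by (simp only: transvection_def L.add vec.scale_left_distrib ac_simps)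
    show "transvection B v (r *s x) = r *s transvection B v x" for r x
      by (simp only: transvection_def L.scale vec.scale_right_distrib vec.scale_scale)
  qed
  moreover have "B (transvection B v u) (transvection B v w) = B u w" for u w
  proof -
    have "B (transvection B v u) (transvection B v w)
        = B u w + (B u v * B v w + B u v * B v w)"
      by (simp only: transvection_def L.add L.scale R.add R.scale alt sym[of v u]
        mult_zero_left mult_zero_right add_0_left add_0_right ac_simps)
    then show ?thesis
      by (simp only: bit2 add_0_right)
  qed
  ultimately show "transvection B v \<in> carrier (Sp B)"
    by (simp add: Sp_def)
qed

end

theory Submission
  imports Defs
begin

text \<open>
  For a strong Gelfand subgroup \<open>H\<close>, the complex functions on \<open>G\<close> that are invariant under conjugation by
  \<open>H\<close> commute under convolution: on an irreducible representation of \<open>G\<close> they act by elements of the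
  commutant of \<open>H\<close>, which acts by scalars on the multiplicity spaces of \<open>H\<close>. In particular, for all \<open>x\<close>
  and \<open>y\<close> the product \<open>x y\<close> equals \<open>y' x'\<close> for some \<open>H\<close>-conjugates \<open>x'\<close> of \<open>x\<close> and \<open>y'\<close> of \<open>y\<close>.

  The symplectic group is 2-transitive on the quadratic forms of either Arf invariant that polarize to
  the symplectic form. If \<open>H\<close> is intransitive on the nonzero vectors, then it is intransitive on one of
  these two classes, and commutativity makes \<open>H\<close> transitive on \<open>A \<times> B\<close> for every partition of that
  class into \<open>H\<close>-invariant sets \<open>A\<close> and \<open>B\<close>. Let \<open>N\<close> be the set of nonzero vectors whose transvections
  preserve \<open>A\<close>. Its complement is a single \<open>H\<close>-orbit of nonzero vectors, and \<open>N\<close> is closed under the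
  transvections along its members. Hence \<open>N\<close> consists of the nonzero vectors of a subspace, or of the
  vectors on which a quadratic form is 1, or it contains a hyperbolic plane whose translates by certain
  further vectors avoid \<open>N\<close>. In each case there are products \<open>x\<close> and \<open>y\<close> of two or three transvections
  such that \<open>y' x'\<close> would be a factorization of \<open>x y\<close> of a shape that the Wall form forbids. So \<open>H\<close> is transitive on the
  transvections. If it contained one, it would contain all of them, and they generate the group.
\<close>

section \<open>Isometries and transvections\<close>

text \<open>Transitivity on A x B rests on linear algebra over the 2-transitive class: on functions
  with sum zero, a relation E on the class, averaged into the group algebra, acts as its matrix up
  to a scalar and a constant function. So H-invariant relations almost commute as matrices, and
  comparing the diagonal of A with a relation between A and B forces the latter to be empty or full.
  Intransitivity passes from vectors to forms by Fourier inversion, since the forms are the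
  translates of one form by the functionals \<open>pr c\<close>.

  The Wall form enters because the product of transvections along independent vectors determines
  their span and a bilinear form on it. Another factorization of the same length is another basis
  for which this form is unitriangular, so each forbidden factorization is a propositional problem
  about at most 36 Boolean coordinates.

  The bound n >= 8 is used only as |V| >= 2^8. Over the field of two elements additive maps are
  linear, so V is an abelian group of exponent 2 and the form a predicate; addition of scalars
  becomes inequality of Booleans, which suits propositional provers.\<close>

locale symplectic =
  fixes pr :: "'v :: {ab_group_add, finite} \<Rightarrow> 'v \<Rightarrow> bool"
  assumes char2: "x + x = (0 :: 'v)"
    and pr_alt [simp]: "\<not> pr x x"
    and pr_add: "pr (x + y) z \<longleftrightarrow> pr x z \<noteq> pr y z"
    and pr_sym: "pr x y \<longleftrightarrow> pr y x"
    and nondegenerate: "x \<noteq> 0 \<Longrightarrow> \<exists>w. pr x w"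
begin

lemma pr_add2: "pr z (x + y) \<longleftrightarrow> pr z x \<noteq> pr z y"
  using pr_add pr_sym by metis

lemma pr_0 [simp]: "\<not> pr 0 x" "\<not> pr x 0"
  using pr_add[of 0 0 x] pr_sym by auto

lemma add_cancel2 [simp]: "x + (x + y) = (y :: 'v)"
  by (metis add.assoc add_0 char2)

lemma add_eq_0: "x + y = 0 \<longleftrightarrow> x = (y :: 'v)"
  by (metis add_cancel2 add_0_right char2)

lemma uminus_eq [simp]: "- x = (x :: 'v)"
  by (metis char2 minus_unique)

definition tv :: "'v \<Rightarrow> 'v \<Rightarrow> 'v" where
  "tv a w = (if pr a w then w + a else w)"

lemma tv_pr [simp]: "pr (tv a u) (tv a v) \<longleftrightarrow> pr u v"
  by (auto simp: tv_def pr_add pr_add2 pr_sym)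

lemma tv_add: "tv a (u + v) = tv a u + tv a v"
  by (auto simp: tv_def pr_add2 char2 ac_simps)

lemma tv_invol [simp]: "tv a (tv a v) = v"
  by (auto simp: tv_def pr_add2 add.assoc char2)

definition isom :: "('v \<Rightarrow> 'v) set" where
  "isom = {f. bij f \<and> (\<forall>u v. f (u + v) = f u + f v) \<and> (\<forall>u v. pr (f u) (f v) = pr u v)}"

lemma isomD:
  assumes "f \<in> isom"
  shows "bij f" "f (u + v) = f u + f v" "pr (f u) (f v) = pr u v"
  using assms by (auto simp: isom_def)

lemma isom_tv: "tv a \<in> isom"
  by (auto simp: isom_def tv_add intro!: o_bij[of "tv a"])

lemma isom_comp: "f \<in> isom \<Longrightarrow> g \<in> isom \<Longrightarrow> f \<circ> g \<in> isom"
  by (auto simp: isom_def bij_comp)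

lemma isom_0 [simp]: "f \<in> isom \<Longrightarrow> f 0 = 0"
  using isomD(2)[of f 0 0] char2[of "f 0"] by simp

lemma isom_inj: "f \<in> isom \<Longrightarrow> f x = f y \<longleftrightarrow> x = y"
  by (meson isomD(1) bij_is_inj inj_eq)

lemma isom_inv:
  assumes f: "f \<in> isom"
  shows "inv_into UNIV f \<in> isom"
proof -
  have [simp]: "f (inv_into UNIV f x) = x" for x
    using isomD(1)[OF f] by (simp add: bij_is_surj surj_f_inv_f)
  have "inv_into UNIV f (u + v) = inv_into UNIV f u + inv_into UNIV f v" for u v
    using isom_inj[OF f, of "inv_into UNIV f (u + v)" "inv_into UNIV f u + inv_into UNIV f v"] by (simp add: isomD(2)[OF f])
  moreover have "pr (inv_into UNIV f u) (inv_into UNIV f v) = pr u v" for u v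
    using isomD(3)[OF f, of "inv_into UNIV f u" "inv_into UNIV f v"] by simp
  ultimately show ?thesis
    using isomD(1)[OF f] by (auto simp: isom_def bij_imp_bij_inv)
qed

lemma isom_f_inv [simp]: "f \<in> isom \<Longrightarrow> f (inv_into UNIV f x) = x"
  by (simp add: isomD(1) bij_is_surj surj_f_inv_f)

lemma isom_inv_f [simp]: "f \<in> isom \<Longrightarrow> inv_into UNIV f (f x) = x"
  by (simp add: isomD(1) bij_is_inj)

lemma isom_conj_tv: "f \<in> isom \<Longrightarrow> f \<circ> tv a \<circ> inv_into UNIV f = tv (f a)"
  by (auto simp: fun_eq_iff tv_def isomD(2)) (metis isomD(3) isom_f_inv)+

lemma pr_inv: "f \<in> isom \<Longrightarrow> pr (f u) v \<longleftrightarrow> pr u (inv_into UNIV f v)"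
  by (metis isomD(3) isom_f_inv)

section \<open>Linear combinations with Boolean coefficients and dual vectors\<close>

fun lin :: "bool list \<Rightarrow> 'v list \<Rightarrow> 'v" where
  "lin (x # xs) (c # cs) = (if x then c else 0) + lin xs cs"
| "lin _ _ = 0"

definition indep :: "'v list \<Rightarrow> bool" where
  "indep cs \<longleftrightarrow> (\<forall>xs. length xs = length cs \<longrightarrow> lin xs cs = 0 \<longrightarrow> True \<notin> set xs)"

lemma lin_add:
  "length xs = length cs \<Longrightarrow> length ys = length cs \<Longrightarrow>
   lin xs cs + lin ys cs = lin (map2 (\<noteq>) xs ys) cs"
proof (induction cs arbitrary: xs ys)
  case (Cons c cs)
  then obtain x xs' y ys' where [simp]: "xs = x # xs'" "ys = y # ys'"
    by (metis length_Suc_conv)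
  show ?case
    using Cons.IH[of xs' ys'] Cons.prems by (auto simp: ac_simps char2)
qed auto

lemma indep_inj:
  assumes "indep cs" "length xs = length cs" "length ys = length cs" "lin xs cs = lin ys cs"
  shows "xs = ys"
proof -
  have "lin (map2 (\<noteq>) xs ys) cs = 0"
    using lin_add[of xs cs ys] assms by (simp only: char2)
  then have "True \<notin> set (map2 (\<noteq>) xs ys)"
    using assms by (auto simp: indep_def simp del: set_map)
  then show ?thesis
    using assms(2,3) by (auto simp: list_eq_iff_nth_eq set_zip)
qed

lemma indep_Cons: "indep (c # cs) \<Longrightarrow> indep cs"
  unfolding indep_def
proof (intro allI impI)
  fix xs assume *: "\<forall>xs. length xs = length (c # cs) \<longrightarrow> lin xs (c # cs) = 0 \<longrightarrow> True \<notin> set xs"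
    and "length xs = length cs" "lin xs cs = 0"
  then show "True \<notin> set xs"
    using *[rule_format, of "False # xs"] by auto
qed

lemma pr_lin_cong:
  assumes "length xs = length cs" "\<And>c. c \<in> set cs \<Longrightarrow> \<not> pr v c"
  shows "\<not> pr v (lin xs cs)"
  using assms
proof (induction cs arbitrary: xs)
  case (Cons c cs)
  then obtain x xs' where [simp]: "xs = x # xs'"
    by (metis length_Suc_conv)
  show ?case
    using Cons by (auto simp: pr_add2)
qed auto

text \<open>By induction it suffices to hit \<open>c\<close> while vanishing on \<open>cs\<close>.
  If that were impossible, \<open>c\<close> could be corrected by the members of \<open>cs\<close>,
  one after the other, until it is orthogonal to everything and hence zero, against
  independence.\<close>

lemma dual_exists:
  assumes "indep cs" "length bs = length cs"
  shows "\<exists>v. map (pr v) cs = bs"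
  using assms
proof (induction cs arbitrary: bs)
  case (Cons c cs)
  have ind: "indep cs"
    using Cons.prems indep_Cons by blast
  obtain d where d: "map (pr (d bs)) cs = bs" if "length bs = length cs" for bs
    using Cons.IH[OF ind] by metis
  have "\<exists>w. pr w c \<and> (\<forall>x\<in>set cs. \<not> pr w x)"
  proof (rule ccontr)
    assume no: "\<nexists>w. pr w c \<and> (\<forall>x\<in>set cs. \<not> pr w x)"
    have "\<exists>xs. length xs = length cs' \<and> (\<forall>v. (\<forall>x\<in>set cs'. \<not> pr v x) \<longrightarrow> \<not> pr v (c' + lin xs cs'))"
      if "\<And>v. (\<forall>x\<in>set cs'. \<not> pr v x) \<Longrightarrow> \<not> pr v c'" for c' cs'
      using that by (intro exI[of _ "replicate (length cs') False"]) (auto simp: pr_add2 pr_lin_cong)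
    \<comment> \<open>After k corrections only the members of \<open>cs\<close> not yet used have to
      be avoided: whatever is orthogonal to them is orthogonal to the corrected vector.\<close>
    have key: "\<exists>xs. length xs = k \<and> (\<forall>v. (\<forall>x\<in>set (drop k cs). \<not> pr v x) \<longrightarrow> \<not> pr v (c + lin xs (take k cs)))"
      if "k \<le> length cs" for k
      using that
    proof (induction k)
      case 0
      then show ?case
        using no by auto
    next
      case (Suc k)
      then obtain xs where xs: "length xs = k"
        "\<And>v. (\<forall>x\<in>set (drop k cs). \<not> pr v x) \<Longrightarrow> \<not> pr v (c + lin xs (take k cs))"
        by auto
      define u where "u = c + lin xs (take k cs)"
      define e where "e = cs ! k"
      have dr: "drop k cs = e # drop (Suc k) cs"
        using Suc.prems by (simp add: Cons_nth_drop_Suc e_def)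
      have tk: "take (Suc k) cs = take k cs @ [e]"
        using Suc.prems by (simp add: take_Suc_conv_app_nth e_def)
      define dk where "dk = d (map (\<lambda>i. i = k) [0..<length cs])"
      have dk: "pr dk (cs ! i) \<longleftrightarrow> i = k" if "i < length cs" for i
      proof -
        have "map (pr dk) cs ! i = map (\<lambda>i. i = k) [0..<length cs] ! i"
          unfolding dk_def by (subst d) auto
        then show ?thesis
          using that by simp
      qed
      have dk0: "\<not> pr dk x" if "x \<in> set (drop (Suc k) cs)" for x
        using that dk by (auto simp: in_set_conv_nth)
      have dke: "pr dk e"
        using dk[of k] Suc.prems by (simp add: e_def)
      have lin_snoc: "lin (xs @ [b]) (take k cs @ [e]) = lin xs (take k cs) + (if b then e else 0)" for b
      proof -
        have "lin (ys @ [b]) (zs @ [e]) = lin ys zs + (if b then e else 0)" if "length ys = length zs" for ys zs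
          using that by (induction ys zs rule: list_induct2) (auto simp: ac_simps)
        then show ?thesis
          using xs(1) Suc.prems by simp
      qed
      \<comment> \<open>The coefficient of \<open>e\<close> must be \<open>pr dk u\<close>: adding
        \<open>dk\<close> makes a vector \<open>v\<close> with \<open>pr v e\<close> orthogonal to
        \<open>e\<close> without touching the later members, so such a \<open>v\<close> has the same
        product with \<open>u\<close> as \<open>dk\<close>.\<close>
      show ?case
      proof (intro exI[of _ "xs @ [pr dk u]"] conjI allI impI)
        show "length (xs @ [pr dk u]) = Suc k"
          using xs by simp
        fix v assume v: "\<forall>x\<in>set (drop (Suc k) cs). \<not> pr v x"
        define v' where "v' = (if pr v e then v + dk else v)"
        have "\<not> pr v' x" if "x \<in> set (drop k cs)" for x
          using that v dk0 dke by (auto simp: dr v'_def pr_add)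
        then have "\<not> pr v' u"
          using xs(2) by (simp add: u_def)
        then show "\<not> pr v (c + lin (xs @ [pr dk u]) (take (Suc k) cs))"
          using dke by (auto simp: tk lin_snoc v'_def u_def pr_add pr_add2 split: if_splits)
      qed
    qed
    obtain xs where "length xs = length cs" "\<And>v. \<not> pr v (c + lin xs cs)"
      using key[of "length cs"] by auto
    then have "c + lin xs cs = 0"
      using nondegenerate[of "c + lin xs cs"] pr_sym[of "c + lin xs cs"] by auto
    then have "lin (True # xs) (c # cs) = 0"
      by simp
    then show False
      using Cons.prems(1) \<open>length xs = length cs\<close> unfolding indep_def
      by (metis length_Cons list.set_intros(1))
  qed
  then obtain w where w: "pr w c" "\<And>x. x \<in> set cs \<Longrightarrow> \<not> pr w x"
    by auto
  obtain b bs' where bs: "bs = b # bs'"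
    using Cons.prems by (metis length_Suc_conv)
  define v where "v = d bs'"
  have v: "map (pr v) cs = bs'"
    unfolding v_def using d bs Cons.prems by auto
  moreover have "map (pr (v + w)) cs = map (pr v) cs"
    using w(2) by (intro map_cong) (auto simp: pr_add)
  ultimately have "map (pr (if pr v c = b then v else v + w)) (c # cs) = bs"
    using w(1) by (simp add: bs pr_add)
  then show ?case
    by blast
qed auto

end

section \<open>Factorizations into transvections\<close>

context symplectic
begin

primrec tvs :: "'v list \<Rightarrow> 'v \<Rightarrow> 'v" where
  "tvs [] = id"
| "tvs (c # cs) = tv c \<circ> tvs cs"

lemma isom_tp: "tvs cs \<in> isom"
proof (induction cs)
  case Nil
  show ?case
    using bij_id by (simp add: isom_def id_def)
next
  case (Cons c cs)
  then show ?case
    unfolding tvs.simps by (intro isom_comp isom_tv)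
qed

lemma tp_append: "tvs (as @ bs) = tvs as \<circ> tvs bs"
  by (induction as) (auto simp: o_assoc)

lemma isom_conj_tp: "f \<in> isom \<Longrightarrow> f \<circ> tvs cs \<circ> inv_into UNIV f = tvs (map f cs)"
proof (induction cs)
  case (Cons c cs)
  have "f \<circ> tvs (c # cs) \<circ> inv_into UNIV f = (f \<circ> tv c \<circ> inv_into UNIV f) \<circ> (f \<circ> tvs cs \<circ> inv_into UNIV f)"
    using Cons.prems by (auto simp: fun_eq_iff)
  also have "\<dots> = tv (f c) \<circ> tvs (map f cs)"
    using Cons by (simp only: isom_conj_tv)
  finally show ?case
    by (simp only: tvs.simps list.map)
qed (auto simp: fun_eq_iff)

text \<open>If \<open>tvs cs v = v + lin xs cs\<close>, each coordinate of \<open>xs\<close> is the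
  product of \<open>v\<close> with that factor, plus the contribution of the factors applied before
  it, which stand further right. Solving for the products of \<open>v\<close> with \<open>cs\<close>
  gives \<open>pre xs cs\<close>.\<close>

fun pre :: "bool list \<Rightarrow> 'v list \<Rightarrow> bool list" where
  "pre (x # xs) (c # cs) = (x \<noteq> pr c (lin xs cs)) # pre xs cs"
| "pre _ _ = []"

text \<open>The Wall form of \<open>tvs cs\<close> in coordinates with respect to \<open>cs\<close>.\<close>

fun wall :: "'v list \<Rightarrow> bool list \<Rightarrow> bool list \<Rightarrow> bool" where
  "wall (c # cs) (x # xs) (y # ys) \<longleftrightarrow> (y \<and> (x \<noteq> pr c (lin xs cs))) \<noteq> wall cs xs ys"
| "wall _ _ _ \<longleftrightarrow> False"

lemma length_pre: "length xs = length cs \<Longrightarrow> length (pre xs cs) = length cs"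
  by (induction xs cs rule: list_induct2) auto

lemma tp_pre: "length xs = length cs \<Longrightarrow> map (pr v) cs = pre xs cs \<Longrightarrow> tvs cs v = v + lin xs cs"
proof (induction xs cs rule: list_induct2)
  case (Cons x xs c cs)
  then have "tvs cs v = v + lin xs cs" "pr c v = (x \<noteq> pr c (lin xs cs))"
    by (auto simp: pr_sym)
  then show ?case
    by (auto simp: tv_def pr_add2 ac_simps)
qed auto

lemma pre_exists: "\<exists>xs. length xs = length cs \<and> map (pr v) cs = pre xs cs"
proof (induction cs)
  case (Cons c cs)
  then obtain xs where "length xs = length cs" "map (pr v) cs = pre xs cs"
    by auto
  then show ?case
    by (intro exI[of _ "(pr v c \<noteq> pr c (lin xs cs)) # xs"]) auto
qed auto

lemma pr_wall:
  "length xs = length cs \<Longrightarrow> length ys = length cs \<Longrightarrow> map (pr v) cs = pre xs cs \<Longrightarrow>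
   pr v (lin ys cs) \<longleftrightarrow> wall cs xs ys"
proof (induction cs arbitrary: xs ys)
  case (Cons c cs)
  then obtain x xs' y ys' where [simp]: "xs = x # xs'" "ys = y # ys'"
    by (metis length_Suc_conv)
  show ?case
    using Cons by (auto simp: pr_add2)
qed auto

lemma lin_False: "(\<forall>x\<in>set xs. \<not> x) \<Longrightarrow> lin xs cs = 0"
  by (induction xs cs rule: lin.induct) auto

lemma lin_unit:
  "length xs = length cs \<Longrightarrow> j < length cs \<Longrightarrow> (\<forall>m<length cs. xs ! m = (m = j)) \<Longrightarrow>
   lin xs cs = cs ! j"
proof (induction xs cs arbitrary: j rule: list_induct2)
  case (Cons x xs c cs)
  show ?case
  proof (cases j)
    case 0
    then have "\<forall>m<length cs. \<not> xs ! m" "x"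
      using Cons.prems(2) by (auto dest: spec[of _ "Suc _"])
    then show ?thesis
      using 0 Cons.hyps by (simp add: lin_False all_set_conv_all_nth)
  next
    case (Suc i)
    then have "\<forall>m<length cs. xs ! m = (m = i)" "\<not> x"
      using Cons.prems(2) by (auto dest: spec[of _ "Suc _"])
    then show ?thesis
      using Suc Cons by simp
  qed
qed auto

lemma pre_nth:
  "length xs = length cs \<Longrightarrow> i < length cs \<Longrightarrow>
   pre xs cs ! i = (xs ! i \<noteq> pr (cs ! i) (lin (drop (Suc i) xs) (drop (Suc i) cs)))"
proof (induction xs cs arbitrary: i rule: list_induct2)
  case (Cons x xs c cs)
  then show ?case
    by (cases i) auto
qed auto

text \<open>Let g be the common product. Both lists are bases of the image of g + 1, and the form
  that sends g v + v and y to \<open>pr v y\<close> depends on g alone. Evaluated at the factors of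
  either list it has ones on the diagonal, the products of the factors on one side and zeros on the
  other.\<close>

theorem Wall_coordinates:
  assumes ind: "indep cs" and tvs: "tvs es = tvs cs" and len: "length es = length cs"
  obtains X where "length X = length cs" "\<And>x. x \<in> set X \<Longrightarrow> length x = length cs"
    "es = map (\<lambda>x. lin x cs) X"
    "\<And>i j. i < length cs \<Longrightarrow> j < length cs \<Longrightarrow>
       wall cs (X ! j) (X ! i) \<longleftrightarrow> i = j \<or> i < j \<and> pr (es ! i) (es ! j)"
proof -
  define S where "S = {xs :: bool list. length xs = length cs}"
  have S: "S = {xs. set xs \<subseteq> UNIV \<and> length xs = length cs}"
    by (auto simp: S_def)
  have finS: "finite S"
    unfolding S by (rule finite_lists_length_eq) simp
  have dual: "\<exists>v. map (pr v) cs' = pre xs cs'" if "indep cs'" "length xs = length cs'" for xs cs'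
    using that by (intro dual_exists) (auto simp: length_pre)
  \<comment> \<open>For any prescribed coordinates in \<open>cs\<close> a dual vector v realizes the
    combination as g v + v, which is also a combination of \<open>es\<close>. Counting then makes
    \<open>es\<close> independent.\<close>
  have "(\<lambda>x. lin x cs) ` S \<subseteq> (\<lambda>x. lin x es) ` S"
  proof clarsimp
    fix x assume "x \<in> S"
    then have "length x = length cs"
      by (simp add: S_def)
    with dual[OF ind] obtain v where v: "map (pr v) cs = pre x cs"
      by blast
    obtain y where y: "length y = length es" "map (pr v) es = pre y es"
      using pre_exists by blast
    have "v + lin x cs = v + lin y es"
      using tp_pre[OF _ v] tp_pre[OF y] tvs \<open>length x = length cs\<close> by simp
    then show "lin x cs \<in> (\<lambda>x. lin x es) ` S"
      using y len by (auto simp: S_def)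
  qed
  moreover have "card ((\<lambda>x. lin x cs) ` S) = card S"
    using indep_inj[OF ind] by (intro card_image) (auto simp: inj_on_def S_def)
  ultimately have "card S \<le> card ((\<lambda>x. lin x es) ` S)"
    by (metis card_mono finS finite_imageI)
  then have inj: "inj_on (\<lambda>x. lin x es) S"
    using card_image_le[OF finS] finS by (intro eq_card_imp_inj_on) (auto intro: antisym)
  have inde: "indep es"
    unfolding indep_def
  proof (intro allI impI)
    fix xs assume xs: "length xs = length es" "lin xs es = 0"
    have "lin (replicate (length es) False) es = 0"
      by (intro lin_False) auto
    then have "xs = replicate (length es) False"
      using inj_onD[OF inj, of xs "replicate (length es) False"] xs len by (auto simp: S_def)
    then show "True \<notin> set xs"
      by auto
  qed
  have "\<exists>x v. length x = length cs \<and> es ! j = lin x cs \<and> map (pr v) cs = pre x cs \<and>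
     (\<forall>i<length cs. pr v (es ! i) \<longleftrightarrow> i = j \<or> i < j \<and> pr (es ! i) (es ! j))"
    if j: "j < length cs" for j
  proof -
    \<comment> \<open>With the unit vector at j as coordinates in \<open>es\<close>, the vector v
      satisfies g v + v = \<open>es ! j\<close>. Its products with \<open>es\<close> are computed by
      \<open>pre\<close> for \<open>es\<close>, and later by \<open>wall\<close> for
      \<open>cs\<close>.\<close>
    define u where "u = map (\<lambda>i. i = j) [0..<length es]"
    have u: "length u = length es" "\<And>m. m < length es \<Longrightarrow> u ! m \<longleftrightarrow> m = j"
      by (auto simp: u_def)
    obtain v where v: "map (pr v) es = pre u es"
      using dual[OF inde u(1)] by blast
    obtain x where x: "length x = length cs" "map (pr v) cs = pre x cs"
      using pre_exists by blast
    have "v + lin x cs = v + lin u es"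
      using tp_pre[OF x] tp_pre[OF u(1) v] tvs by simp
    then have ej: "es ! j = lin x cs"
      using lin_unit[OF u(1), of j] u j len by simp
    have "pr v (es ! i) \<longleftrightarrow> i = j \<or> i < j \<and> pr (es ! i) (es ! j)" if i: "i < length cs" for i
    proof -
      have "pr v (es ! i) = pre u es ! i"
        using i len v by (metis nth_map)
      also have "\<dots> = ((i = j) \<noteq> pr (es ! i) (lin (drop (Suc i) u) (drop (Suc i) es)))"
        using i u len by (simp add: pre_nth)
      also have "lin (drop (Suc i) u) (drop (Suc i) es) = (if i < j then es ! j else 0)"
      proof (cases "i < j")
        case True
        then show ?thesis
          using lin_unit[of "drop (Suc i) u" "drop (Suc i) es" "j - Suc i"] u j len by fastforce
      next
        case False
        then show ?thesis
          using u len by (auto intro!: lin_False simp: in_set_conv_nth)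
      qed
      finally show ?thesis
        by auto
    qed
    then show ?thesis
      using x ej by blast
  qed
  then obtain x v where xv: "\<And>j. j < length cs \<Longrightarrow> length (x j) = length cs \<and> es ! j = lin (x j) cs \<and>
     map (pr (v j)) cs = pre (x j) cs \<and>
     (\<forall>i<length cs. pr (v j) (es ! i) \<longleftrightarrow> i = j \<or> i < j \<and> pr (es ! i) (es ! j))"
    by metis
  show thesis
  proof
    show "length (map x [0..<length cs]) = length cs"
      by simp
    show "length y = length cs" if "y \<in> set (map x [0..<length cs])" for y
      using that xv by auto
    show "es = map (\<lambda>x. lin x cs) (map x [0..<length cs])"
      using xv len by (intro nth_equalityI) auto
    show "wall cs (map x [0..<length cs] ! j) (map x [0..<length cs] ! i) \<longleftrightarrow>
        i = j \<or> i < j \<and> pr (es ! i) (es ! j)" if i: "i < length cs" and j: "j < length cs" for i j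
    proof -
      have "pr (v j) (lin (x i) cs) \<longleftrightarrow> wall cs (x j) (x i)"
        using xv[OF i] xv[OF j] by (intro pr_wall) auto
      then show ?thesis
        using xv[OF i] xv[OF j] i j by (simp only: nth_map_upt diff_zero add_0 minus_nat.diff_0) metis
    qed
  qed
qed

text \<open>In the span of e, f, z, u the set \<open>N\<close> is {e, f, e + f, z}. The factors b1,
  b2 stand for conjugates of f and f + z, and a1, a2 for conjugates of z + u and z + u + e + f; what
  survives conjugation is orthogonality and the membership of the factors and of the sums z and e +
  f. In Wall coordinates these conditions contradict each other.\<close>

lemma kill_321:
  assumes "pr e f" "pr u z" "\<not> pr e z" "\<not> pr e u" "\<not> pr f z" "\<not> pr f u"
    and N: "\<And>x1 x2 x3 x4. N (lin [x1,x2,x3,x4] [e,f,z,u]) \<longleftrightarrow> \<not> x4 \<and> (x3 \<noteq> (x1 \<or> x2))"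
    and tvs: "tvs [b1,b2,a1,a2] = tvs [z+u, z+u+e+f, f, f+z]"
    and b: "N b1" "\<not> N b2" "N (b1 + b2)" "\<not> pr b1 b2"
    and a: "\<not> N a1" "\<not> N a2" "N (a1 + a2)" "\<not> pr a1 a2"
  shows False
proof -
  let ?cs = "[z+u, z+u+e+f, f, f+z]"
  note [simp] = assms(1-6) pr_sym[of f e, simplified assms] pr_sym[of z u, simplified assms] pr_sym[of z e, simplified assms]
    pr_sym[of u e, simplified assms] pr_sym[of z f, simplified assms] pr_sym[of u f, simplified assms]
  \<comment> \<open>Change of basis: \<open>N\<close> is known in terms of e, f, z, u, the Wall form
    in terms of the factors.\<close>
  have lin: "lin [x1,x2,x3,x4] ?cs = lin [x2, x2 \<noteq> (x3 \<noteq> x4), x1 \<noteq> (x2 \<noteq> x4), x1 \<noteq> x2] [e,f,z,u]" for x1 x2 x3 x4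
    by (cases x1; cases x2; cases x3; cases x4) (simp_all add: ac_simps char2)
  have pe: "pr e (lin [x1,x2,x3,x4] [e,f,z,u]) = x2" "pr f (lin [x1,x2,x3,x4] [e,f,z,u]) = x1"
    "pr z (lin [x1,x2,x3,x4] [e,f,z,u]) = x4" "pr u (lin [x1,x2,x3,x4] [e,f,z,u]) = x3" for x1 x2 x3 x4
    by (auto simp: pr_add2)
  have "indep ?cs"
    unfolding indep_def
  proof (intro allI impI)
    fix xs assume "length xs = length ?cs" and 0: "lin xs ?cs = 0"
    then obtain x1 x2 x3 x4 where xs: "xs = [x1,x2,x3,x4]"
      by (auto simp: length_Suc_conv numeral_eq_Suc)
    have "\<not> x2" "\<not> (x2 \<noteq> (x3 \<noteq> x4))" "\<not> (x1 \<noteq> (x2 \<noteq> x4))" "\<not> (x1 \<noteq> x2)"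
      using pe[of x2 "x2 \<noteq> (x3 \<noteq> x4)" "x1 \<noteq> (x2 \<noteq> x4)" "x1 \<noteq> x2"] 0 unfolding xs lin by (simp_all del: lin.simps)
    then show "True \<notin> set xs"
      by (auto simp: xs)
  qed
  from Wall_coordinates[OF this tvs]
  obtain X where X: "length X = 4" "\<And>x. x \<in> set X \<Longrightarrow> length x = 4"
    "[b1,b2,a1,a2] = map (\<lambda>x. lin x ?cs) X"
    and wall: "\<And>i j. i < 4 \<Longrightarrow> j < 4 \<Longrightarrow>
       wall ?cs (X ! j) (X ! i) \<longleftrightarrow> i = j \<or> i < j \<and> pr ([b1,b2,a1,a2] ! i) ([b1,b2,a1,a2] ! j)"
    by (auto simp: numeral_eq_Suc)
  obtain w x y t where Xe: "X = [w,x,y,t]"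
    using X(1) by (auto simp: length_Suc_conv numeral_eq_Suc)
  have len: "length w = 4" "length x = 4" "length y = 4" "length t = 4"
    using X(2) by (auto simp: Xe)
  obtain w1 w2 w3 w4 x1 x2 x3 x4 y1 y2 y3 y4 t1 t2 t3 t4 where
    e: "w = [w1,w2,w3,w4]" "x = [x1,x2,x3,x4]" "y = [y1,y2,y3,y4]" "t = [t1,t2,t3,t4]"
    using len by (auto simp: length_Suc_conv numeral_eq_Suc)
  have b1: "b1 = lin w ?cs" and b2: "b2 = lin x ?cs" and a1: "a1 = lin y ?cs" and a2: "a2 = lin t ?cs"
    using X(3) by (auto simp: Xe)
  have s1: "b1 + b2 = lin [w1\<noteq>x1,w2\<noteq>x2,w3\<noteq>x3,w4\<noteq>x4] ?cs"
    unfolding b1 b2 e by (subst lin_add) auto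
  have s2: "a1 + a2 = lin [y1\<noteq>t1,y2\<noteq>t2,y3\<noteq>t3,y4\<noteq>t4] ?cs"
    unfolding a1 a2 e by (subst lin_add) auto
  \<comment> \<open>Besides triangularity, the last two facts use orthogonality inside each pair of
    factors.\<close>
  have thw: "wall ?cs w w" "wall ?cs x x" "wall ?cs y y" "wall ?cs t t"
    "\<not> wall ?cs w x" "\<not> wall ?cs w y" "\<not> wall ?cs w t" "\<not> wall ?cs x y" "\<not> wall ?cs x t" "\<not> wall ?cs y t"
    "\<not> wall ?cs x w" "\<not> wall ?cs t y"
    using wall[of 0 0] wall[of 1 1] wall[of 2 2] wall[of 3 3] wall[of 1 0] wall[of 2 0] wall[of 3 0] wall[of 2 1] wall[of 3 1]
      wall[of 3 2] wall[of 0 1] wall[of 2 3] a(4) b(4) unfolding Xe by (simp_all add: numeral_eq_Suc del: wall.simps)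
  have thf: "wall ?cs [p1,p2,p3,p4] [q1,q2,q3,q4] \<longleftrightarrow>
     ((q1 \<and> (p1 \<noteq> p4)) \<noteq> ((q2 \<and> (p2 \<noteq> p3)) \<noteq> ((q3 \<and> p3) \<noteq> (q4 \<and> p4))))" for p1 p2 p3 p4 q1 q2 q3 q4
    by (auto simp: pr_add pr_add2)
  show False
    using a(1-3) b(1-3) thw unfolding s1 s2 unfolding b1 b2 a1 a2 e lin N thf
    by (argo)
qed

end

context symplectic
begin

text \<open>The model for \<open>N\<close> is the set of nonzero vectors orthogonal to a totally
  isotropic plane; in the span these are the nonzero combinations of a1, d1, d3. The conjugates of
  the d's are mutually orthogonal like the d's, and so are those of the a's, and they keep their
  status with respect to \<open>N\<close>.\<close>

lemma kill_subspace:
  assumes ind: "indep [a1,a2,d1,d2,d3]"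
    and g: "pr a1 d2" "pr a2 d1" "pr a2 d2" "pr a2 d3" "\<not> pr a1 a2" "\<not> pr a1 d1" "\<not> pr a1 d3"
      "\<not> pr d1 d2" "\<not> pr d1 d3" "\<not> pr d2 d3"
    and N: "\<And>x1 x2 x3 x4 x5. N (lin [x1,x2,x3,x4,x5] [a1,a2,d1,d2,d3]) \<longleftrightarrow>
      \<not> x2 \<and> \<not> x4 \<and> (x1 \<or> x3 \<or> x5)"
    and tvs: "tvs [e1,e2,e3,b1,b2] = tvs [a1,a2,d1,d2,d3]"
    and e: "N e1" "\<not> N e2" "N e3" "\<not> pr e1 e2" "\<not> pr e1 e3" "\<not> pr e2 e3"
    and b: "N b1" "\<not> N b2" "\<not> pr b1 b2"
  shows False
proof -
  let ?cs = "[a1,a2,d1,d2,d3]"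
  from Wall_coordinates[OF ind tvs]
  obtain X where X: "length X = 5" "\<And>x. x \<in> set X \<Longrightarrow> length x = 5"
    "[e1,e2,e3,b1,b2] = map (\<lambda>x. lin x ?cs) X"
    and wall: "\<And>i j. i < 5 \<Longrightarrow> j < 5 \<Longrightarrow>
       wall ?cs (X ! j) (X ! i) \<longleftrightarrow> i = j \<or> i < j \<and> pr ([e1,e2,e3,b1,b2] ! i) ([e1,e2,e3,b1,b2] ! j)"
    by (auto simp: numeral_eq_Suc)
  obtain p q r s t where Xe: "X = [p,q,r,s,t]"
    using X(1) by (auto simp: length_Suc_conv numeral_eq_Suc)
  obtain p1 p2 p3 p4 p5 q1 q2 q3 q4 q5 r1 r2 r3 r4 r5 s1 s2 s3 s4 s5 t1 t2 t3 t4 t5 where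
    c: "p = [p1,p2,p3,p4,p5]" "q = [q1,q2,q3,q4,q5]" "r = [r1,r2,r3,r4,r5]" "s = [s1,s2,s3,s4,s5]"
      "t = [t1,t2,t3,t4,t5]"
    using X(2)[of p] X(2)[of q] X(2)[of r] X(2)[of s] X(2)[of t]
    unfolding Xe by (auto simp: length_Suc_conv numeral_eq_Suc)
  have es: "e1 = lin p ?cs" "e2 = lin q ?cs" "e3 = lin r ?cs" "b1 = lin s ?cs" "b2 = lin t ?cs"
    using X(3) by (auto simp: Xe)
  have thw: "wall ?cs p p" "wall ?cs q q" "wall ?cs r r" "wall ?cs s s" "wall ?cs t t"
    "\<not> wall ?cs p q" "\<not> wall ?cs p r" "\<not> wall ?cs p s" "\<not> wall ?cs p t" "\<not> wall ?cs q r" "\<not> wall ?cs q s"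
    "\<not> wall ?cs q t" "\<not> wall ?cs r s" "\<not> wall ?cs r t" "\<not> wall ?cs s t"
    "\<not> wall ?cs q p" "\<not> wall ?cs r p" "\<not> wall ?cs r q" "\<not> wall ?cs t s"
    using wall[of 0 0] wall[of 1 1] wall[of 2 2] wall[of 3 3] wall[of 4 4] wall[of 1 0] wall[of 2 0] wall[of 3 0] wall[of 4 0]
      wall[of 2 1] wall[of 3 1] wall[of 4 1] wall[of 3 2] wall[of 4 2] wall[of 4 3] wall[of 0 1] wall[of 0 2] wall[of 1 2] wall[of 3 4]
      e(4-6) b(3) unfolding Xe by (simp_all add: numeral_eq_Suc del: wall.simps)
  have thf: "wall ?cs [p1,p2,p3,p4,p5] [q1,q2,q3,q4,q5] \<longleftrightarrow>
     ((q1 \<and> (p1 \<noteq> p4)) \<noteq> ((q2 \<and> (p2 \<noteq> (p3 \<noteq> (p4 \<noteq> p5)))) \<noteq> ((q3 \<and> p3) \<noteq> ((q4 \<and> p4) \<noteq> (q5 \<and> p5)))))"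
    for p1 p2 p3 p4 p5 q1 q2 q3 q4 q5
    using g by (auto simp: pr_add pr_add2)
  show False
    using e(1-3) b(1-2) thw unfolding es c N thf
    by argo
qed

text \<open>Non-orthogonality makes a1, d1, a2, d2, a3, d3 a path. Every factor x of a second
  factorization has \<open>wall\<close> value 1 on the diagonal, so \<open>N\<close> has to be known
  on such vectors only. On these, membership is the same affine condition for a quadric and for a
  hyperplane, so that one refutation serves both.\<close>

lemma kill_path:
  assumes ind: "indep [a1,a2,a3,d1,d2,d3]"
    and g: "pr a1 d1" "pr a2 d1" "pr a2 d2" "pr a3 d2" "pr a3 d3" "\<not> pr a1 d2" "\<not> pr a1 d3" "\<not> pr a2 d3"
      "\<not> pr a3 d1" "\<not> pr a1 a2" "\<not> pr a1 a3" "\<not> pr a2 a3" "\<not> pr d1 d2" "\<not> pr d1 d3" "\<not> pr d2 d3"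
    and N: "\<And>x1 x2 x3 x4 x5 x6. wall [a1,a2,a3,d1,d2,d3] [x1,x2,x3,x4,x5,x6] [x1,x2,x3,x4,x5,x6] \<Longrightarrow>
      N (lin [x1,x2,x3,x4,x5,x6] [a1,a2,a3,d1,d2,d3]) \<longleftrightarrow>
      \<not> (x1 \<noteq> (x2 \<noteq> (x3 \<noteq> (x5 \<noteq> x6))))"
    and tvs: "tvs [e1,e2,e3,b1,b2,b3] = tvs [a1,a2,a3,d1,d2,d3]"
    and e: "N e1" "\<not> N e2" "\<not> N e3" "\<not> pr e1 e2" "\<not> pr e1 e3" "\<not> pr e2 e3"
    and b: "\<not> N b1" "\<not> N b2" "\<not> N b3" "\<not> pr b1 b2" "\<not> pr b1 b3" "\<not> pr b2 b3"
  shows False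
proof -
  let ?cs = "[a1,a2,a3,d1,d2,d3]"
  from Wall_coordinates[OF ind tvs]
  obtain X where X: "length X = 6" "\<And>x. x \<in> set X \<Longrightarrow> length x = 6"
    "[e1,e2,e3,b1,b2,b3] = map (\<lambda>x. lin x ?cs) X"
    and wall: "\<And>i j. i < 6 \<Longrightarrow> j < 6 \<Longrightarrow>
       wall ?cs (X ! j) (X ! i) \<longleftrightarrow> i = j \<or> i < j \<and> pr ([e1,e2,e3,b1,b2,b3] ! i) ([e1,e2,e3,b1,b2,b3] ! j)"
    by (auto simp: numeral_eq_Suc)
  obtain p q r s t u where Xe: "X = [p,q,r,s,t,u]"
    using X(1) by (auto simp: length_Suc_conv numeral_eq_Suc)
  obtain p1 p2 p3 p4 p5 p6 q1 q2 q3 q4 q5 q6 r1 r2 r3 r4 r5 r6 s1 s2 s3 s4 s5 s6 t1 t2 t3 t4 t5 t6 u1 u2 u3 u4 u5 u6 where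
    c: "p = [p1,p2,p3,p4,p5,p6]" "q = [q1,q2,q3,q4,q5,q6]" "r = [r1,r2,r3,r4,r5,r6]" "s = [s1,s2,s3,s4,s5,s6]"
      "t = [t1,t2,t3,t4,t5,t6]" "u = [u1,u2,u3,u4,u5,u6]"
    using X(2)[of p] X(2)[of q] X(2)[of r] X(2)[of s] X(2)[of t] X(2)[of u]
    unfolding Xe by (auto simp: length_Suc_conv numeral_eq_Suc)
  have es: "e1 = lin p ?cs" "e2 = lin q ?cs" "e3 = lin r ?cs" "b1 = lin s ?cs" "b2 = lin t ?cs" "b3 = lin u ?cs"
    using X(3) by (auto simp: Xe)
  have thw: "wall ?cs p p" "wall ?cs q q" "wall ?cs r r" "wall ?cs s s" "wall ?cs t t" "wall ?cs u u"
    "\<not> wall ?cs p q" "\<not> wall ?cs p r" "\<not> wall ?cs p s" "\<not> wall ?cs p t" "\<not> wall ?cs p u" "\<not> wall ?cs q r" "\<not> wall ?cs q s"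
    "\<not> wall ?cs q t" "\<not> wall ?cs q u" "\<not> wall ?cs r s" "\<not> wall ?cs r t" "\<not> wall ?cs r u" "\<not> wall ?cs s t" "\<not> wall ?cs s u" "\<not> wall ?cs t u"
    "\<not> wall ?cs q p" "\<not> wall ?cs r p" "\<not> wall ?cs r q" "\<not> wall ?cs t s" "\<not> wall ?cs u s" "\<not> wall ?cs u t"
    using wall[of 0 0] wall[of 1 1] wall[of 2 2] wall[of 3 3] wall[of 4 4] wall[of 5 5] wall[of 1 0] wall[of 2 0] wall[of 3 0] wall[of 4 0] wall[of 5 0]
      wall[of 2 1] wall[of 3 1] wall[of 4 1] wall[of 5 1] wall[of 3 2] wall[of 4 2] wall[of 5 2] wall[of 4 3] wall[of 5 3] wall[of 5 4]
      wall[of 0 1] wall[of 0 2] wall[of 1 2] wall[of 3 4] wall[of 3 5] wall[of 4 5]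
      e(4-6) b(4-6) unfolding Xe by (simp_all add: numeral_eq_Suc del: wall.simps)
  have thf: "wall ?cs [p1,p2,p3,p4,p5,p6] [q1,q2,q3,q4,q5,q6] \<longleftrightarrow>
     ((q1 \<and> (p1 \<noteq> p4)) \<noteq> ((q2 \<and> (p2 \<noteq> (p4 \<noteq> p5))) \<noteq> ((q3 \<and> (p3 \<noteq> (p5 \<noteq> p6))) \<noteq>
     ((q4 \<and> p4) \<noteq> ((q5 \<and> p5) \<noteq> (q6 \<and> p6))))))"
    for p1 p2 p3 p4 p5 p6 q1 q2 q3 q4 q5 q6
    using g by (auto simp: pr_add pr_add2)
  note Nn = N[OF thw(1)[unfolded c]] N[OF thw(2)[unfolded c]] N[OF thw(3)[unfolded c]] N[OF thw(4)[unfolded c]]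
    N[OF thw(5)[unfolded c]] N[OF thw(6)[unfolded c]]
  show False
    using e(1-3) b(1-3) thw unfolding es c Nn thf
    by argo
qed

end

section \<open>Sets closed under transvections\<close>

context symplectic
begin

section \<open>Character sums, duality and counting\<close>

definition sg :: "bool \<Rightarrow> int" where
  "sg b = (if b then -1 else 1)"

lemma sg_simps [simp]: "sg True = -1" "sg False = 1" "sg b * sg b = 1"
  by (auto simp: sg_def)

lemma sg_neq: "sg (a \<noteq> b) = sg a * sg b"
  by (auto simp: sg_def)

lemma sum_translate: "(\<Sum>v\<in>UNIV. g (v + w)) = (\<Sum>v\<in>UNIV. g (v :: 'v))"
  by (rule sum.reindex_bij_witness[of _ "\<lambda>v. v + w" "\<lambda>v. v + w"]) (auto simp: add.assoc char2)

lemma sum_sg: "(\<Sum>c\<in>UNIV. sg (pr c v)) = (if v = 0 then int (card (UNIV :: 'v set)) else 0)"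
proof (cases "v = 0")
  case False
  then obtain w where w: "pr v w"
    using nondegenerate by blast
  have "(\<Sum>c\<in>UNIV. sg (pr c v)) = (\<Sum>c\<in>UNIV. sg (pr (c + w) v))"
    by (rule sum_translate[symmetric])
  also have "\<dots> = (\<Sum>c\<in>UNIV. - sg (pr c v))"
    using w by (intro sum.cong) (auto simp: pr_add pr_sym[of w] sg_def)
  finally show ?thesis
    using False by (simp add: sum_negf)
qed simp

text \<open>By orthogonality of characters, the character sums of the functionals \<open>l\<close>
  plus \<open>pr c\<close>, taken over all c, add up to the number of vectors, so one of them is
  nonzero. A nonzero additive functional has character sum 0, hence \<open>l\<close> equals that
  \<open>pr c\<close>.\<close>

lemma Riesz:
  assumes "\<And>u v. l (u + v) \<longleftrightarrow> l u \<noteq> l v"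
  obtains c where "\<And>v. l v \<longleftrightarrow> pr c v"
proof -
  have "l 0 = False"
    using assms[of 0 0] by auto
  have "(\<Sum>c\<in>UNIV. \<Sum>v\<in>UNIV. sg (l v) * sg (pr c v)) = (\<Sum>v\<in>UNIV. sg (l v) * (\<Sum>c\<in>UNIV. sg (pr c v)))"
    by (subst sum.swap) (simp add: sum_distrib_left)
  also have "\<dots> = int (card (UNIV :: 'v set))"
    using \<open>l 0 = False\<close> by (simp add: sum_sg if_distrib cong: if_cong)
  finally have "(\<Sum>c\<in>UNIV. \<Sum>v\<in>UNIV. sg (l v) * sg (pr c v)) \<noteq> 0"
    by simp
  then obtain c where c: "(\<Sum>v\<in>UNIV. sg (l v \<noteq> pr c v)) \<noteq> 0"
    unfolding sg_neq by (meson sum.neutral)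
  have "l w \<longleftrightarrow> pr c w" for w
  proof (rule ccontr)
    assume w: "l w \<noteq> pr c w"
    have "(\<Sum>v\<in>UNIV. sg (l v \<noteq> pr c v)) = (\<Sum>v\<in>UNIV. sg (l (v + w) \<noteq> pr c (v + w)))"
      by (rule sum_translate[symmetric])
    also have "\<dots> = (\<Sum>v\<in>UNIV. - sg (l v \<noteq> pr c v))"
      using w by (intro sum.cong) (auto simp: assms pr_add2 sg_def)
    finally show False
      using c by (simp add: sum_negf)
  qed
  then show thesis
    using that by blast
qed

text \<open>A maximal proper subgroup containing \<open>U\<close> has only one other coset, so
  non-membership in it is an additive functional, to which \<open>Riesz\<close> applies.\<close>

lemma perp_nontrivial:
  assumes "0 \<in> U" "\<And>u v. u \<in> U \<Longrightarrow> v \<in> U \<Longrightarrow> u + v \<in> U" "U \<noteq> UNIV"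
  obtains c where "c \<noteq> 0" "\<And>u. u \<in> U \<Longrightarrow> \<not> pr c u"
proof -
  define F where "F = {M. U \<subseteq> M \<and> M \<noteq> UNIV \<and> (\<forall>u\<in>M. \<forall>v\<in>M. u + v \<in> M)}"
  have "finite F" "U \<in> F"
    using assms by (auto simp: F_def)
  then obtain M where M: "M \<in> F" "\<And>M'. M' \<in> F \<Longrightarrow> M \<subseteq> M' \<Longrightarrow> M = M'"
    using finite_has_maximal2[of F U] by metis
  have UM: "U \<subseteq> M" and add: "\<And>u v. u \<in> M \<Longrightarrow> v \<in> M \<Longrightarrow> u + v \<in> M" and "M \<noteq> UNIV"
    using M(1) by (auto simp: F_def)
  have 0: "0 \<in> M"
    using UM assms(1) by auto
  have xor: "x + y \<in> M" if "x \<notin> M" "y \<notin> M" for x y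
  proof -
    define M' where "M' = M \<union> (\<lambda>m. m + x) ` M"
    have sub: "u + v \<in> M'" if "u \<in> M'" "v \<in> M'" for u v
      using that add unfolding M'_def by (auto simp: image_iff ac_simps char2)
    have "M' \<notin> F"
    proof
      assume "M' \<in> F"
      then have "M = M'"
        using M(2) by (auto simp: M'_def)
      then show False
        using 0 \<open>x \<notin> M\<close> by (auto simp: M'_def image_iff)
    qed
    then have "M' = UNIV"
      using sub UM by (auto simp: F_def M'_def)
    then have "y \<in> M'"
      by simp
    then obtain m where "m \<in> M" "y = m + x"
      using \<open>y \<notin> M\<close> by (auto simp: M'_def)
    then show ?thesis
      by (simp add: ac_simps char2)
  qed
  have "(u + v \<notin> M) \<longleftrightarrow> (u \<notin> M) \<noteq> (v \<notin> M)" for u v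
  proof -
    have "v \<in> M" if "u \<in> M" "u + v \<in> M" for u v
      using add[OF that] by simp
    then show ?thesis
      using add[of u v] xor[of u v] by (metis add.commute)
  qed
  then obtain c where "\<And>v. v \<notin> M \<longleftrightarrow> pr c v"
    using Riesz[of "\<lambda>v. v \<notin> M"] by blast
  moreover from this have "c \<noteq> 0"
    using \<open>M \<noteq> UNIV\<close> by auto
  ultimately show thesis
    using that UM by blast
qed

lemma separate: 
  assumes "\<And>v. v \<noteq> 0 \<Longrightarrow> \<exists>a\<in>N. pr a v" "u \<noteq> v"
  shows "\<exists>a\<in>N. pr a u \<noteq> pr a v"
  using assms(1)[of "u + v"] assms(2) by (auto simp: add_eq_0 pr_add2)

text \<open>This stands in for dimension counts: a vector is determined by the set of members of
  \<open>C\<close> that are not orthogonal to it.\<close>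

lemma card_le_separating:
  assumes "finite C" "\<And>v. (\<And>c. c \<in> C \<Longrightarrow> \<not> pr c v) \<Longrightarrow> v = 0"
  shows "card (UNIV :: 'v set) \<le> 2 ^ card C"
proof -
  have "inj (\<lambda>v. {c \<in> C. pr c v})"
  proof (rule injI)
    fix u v assume "{c \<in> C. pr c u} = {c \<in> C. pr c v}"
    then have "\<not> pr c (u + v)" if "c \<in> C" for c
      using that by (auto simp: pr_add2)
    then show "u = v"
      using assms(2)[of "u + v"] by (simp add: add_eq_0)
  qed
  then have "card (UNIV :: 'v set) \<le> card (Pow C)"
    using assms(1) by (intro card_inj_on_le[of "\<lambda>v. {c \<in> C. pr c v}"]) auto
  then show ?thesis
    using assms(1) by (simp add: card_Pow)
qed

text \<open>Two orthogonal hyperbolic planes, spanned by e, f and by z, u. If \<open>N\<close> is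
  closed and omits 0, it meets their sum exactly in e, f, e + f and z, which is the situation of
  \<open>kill_321\<close>.\<close>

definition pattern_321 :: "'v set \<Rightarrow> bool" where
  "pattern_321 N \<longleftrightarrow> (\<exists>e f z u. e \<in> N \<and> f \<in> N \<and> z \<in> N \<and> pr e f \<and> pr u z \<and> \<not> pr e z \<and> \<not> pr e u \<and>
     \<not> pr f z \<and> \<not> pr f u \<and> u \<notin> N \<and> u + z \<notin> N \<and>
     (\<forall>p\<in>{e, f, e + f}. p + z \<notin> N \<and> p + u \<notin> N \<and> p + u + z \<notin> N))"

end

text \<open>Since \<open>tv a b = a + b\<close> when a and b are not orthogonal,
  \<open>closed\<close> is closure under the transvections along members. By nondegeneracy,
  \<open>spans\<close> says that \<open>N\<close> generates the whole space.\<close>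

locale closed_set = symplectic +
  fixes N :: "'a set"
  assumes zero_N: "0 \<notin> N"
    and closed: "a \<in> N \<Longrightarrow> b \<in> N \<Longrightarrow> pr a b \<Longrightarrow> a + b \<in> N"
    and spans: "v \<noteq> 0 \<Longrightarrow> \<exists>a\<in>N. pr a v"
    and card_ge: "2 ^ 8 \<le> card (UNIV :: 'a set)"
begin

lemma closed': "a \<in> N \<and> b \<in> N \<and> pr a b \<Longrightarrow> a + b \<in> N"
  by (simp add: closed)

lemma N_iff: "a \<in> N \<Longrightarrow> pr a x \<Longrightarrow> x + a \<in> N \<longleftrightarrow> x \<in> N"
  using closed[of a x] closed[of a "x + a"] by (auto simp: pr_add2 ac_simps char2)

text \<open>The transvections along e and f fix w and are transitive on the nonzero vectors of the
  plane.\<close>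

lemma plane_iff:
  assumes "e \<in> N" "f \<in> N" "pr e f" "\<not> pr e w" "\<not> pr f w"
  shows "f + w \<in> N \<longleftrightarrow> e + w \<in> N" "e + f + w \<in> N \<longleftrightarrow> e + w \<in> N"
proof -
  have "e + w + f \<in> N \<longleftrightarrow> e + w \<in> N" "f + w + e \<in> N \<longleftrightarrow> f + w \<in> N"
    using assms by (auto intro!: N_iff simp: pr_add2 pr_sym[of f e])
  then show "f + w \<in> N \<longleftrightarrow> e + w \<in> N" "e + f + w \<in> N \<longleftrightarrow> e + w \<in> N"
    by (simp_all add: ac_simps)
qed

text \<open>The orthogonal projection away from the hyperbolic plane of \<open>e\<close> and
  \<open>f\<close>.\<close>

definition comp :: "'a \<Rightarrow> 'a \<Rightarrow> 'a \<Rightarrow> 'a" where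
  "comp e f v = v + ((if pr v f then e else 0) + (if pr v e then f else 0))"

lemma comp_perp: "pr e f \<Longrightarrow> \<not> pr e (comp e f v)" "pr e f \<Longrightarrow> \<not> pr f (comp e f v)"
  using pr_sym[of f e] pr_sym[of v e] pr_sym[of v f] by (auto simp: comp_def pr_add2)

lemma comp_pr: "\<not> pr w e \<Longrightarrow> \<not> pr w f \<Longrightarrow> pr w (comp e f v) \<longleftrightarrow> pr w v"
  by (auto simp: comp_def pr_add2)

text \<open>If the component of a in the plane is nonzero, \<open>plane_iff\<close> exchanges it for
  e.\<close>

lemma comp_cases:
  assumes "e \<in> N" "f \<in> N" "pr e f" "a \<in> N"
  shows "\<not> pr e a \<and> \<not> pr f a \<and> comp e f a = a \<or> (pr e a \<or> pr f a) \<and> e + comp e f a \<in> N"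
proof -
  note [simp] = pr_sym[of a e] pr_sym[of a f]
  have perp: "\<not> pr e (comp e f a)" "\<not> pr f (comp e f a)"
    using comp_perp[OF assms(3)] by auto
  have c: "a = (if pr f a then e else 0) + ((if pr e a then f else 0) + comp e f a)"
    by (auto simp: comp_def ac_simps char2)
  show ?thesis
    using plane_iff[OF assms(1-3) perp] c assms(4) by (cases "pr e a"; cases "pr f a") (auto simp: ac_simps)
qed

text \<open>The pattern arises from a hyperbolic plane inside \<open>N\<close>, a vector \<open>u\<close> orthogonal to the plane all
  of whose translates by the plane lie outside \<open>N\<close>, and a further member \<open>z\<close> of \<open>N\<close>.\<close>

lemma pattern_321I:
  assumes "e \<in> N" "f \<in> N" "z \<in> N" "pr e f" "pr u z" "\<not> pr e z" "\<not> pr e u" "\<not> pr f z" "\<not> pr f u"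
    "u \<notin> N" "e + u \<notin> N" "e + z \<notin> N"
  shows "pattern_321 N"
proof -
  have p: "p + u \<notin> N" "p + z \<notin> N" "\<not> pr z p" if "p \<in> {e, f, e + f}" for p
    using plane_iff[of e f u] plane_iff[of e f z] that assms by (auto simp: pr_add pr_add2 pr_sym[of z])
  have "p + u + z \<notin> N" if "p \<in> {e, f, e + f}" for p
    using N_iff[of z "p + u"] p[OF that] assms by (auto simp: pr_add2 pr_sym[of z u])
  moreover have "u + z \<notin> N"
    using N_iff[of z u] assms by (auto simp: pr_sym[of z u])
  ultimately show ?thesis
    unfolding pattern_321_def using assms p by blast
qed

text \<open>\<open>M\<close> and the rest of \<open>N\<close> are orthogonal to each other. Take a
  plane in one part and z in the other; u is the sum of a vector of the first part, projected away
  from the plane, and a neighbour of z. Such mixed vectors are never in \<open>N\<close>. This fails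
  only if each part lies in a single plane, and then four vectors would separate the whole
  space.\<close>

lemma pattern_321_disconnected:
  assumes "M \<subseteq> N" "M \<noteq> {}" "M \<noteq> N" and adj: "\<And>a b. a \<in> M \<Longrightarrow> b \<in> N \<Longrightarrow> pr a b \<Longrightarrow> b \<in> M"
  shows "pattern_321 N"
proof -
  have *: "pattern_321 N" if M: "M1 \<union> M2 = N" "M1 \<inter> M2 = {}" and orth: "\<And>a b. a \<in> M1 \<Longrightarrow> b \<in> M2 \<Longrightarrow> \<not> pr a b"
    and ef: "e \<in> M1" "f \<in> M1" "pr e f" and x: "x \<in> M1" "x \<noteq> e" "x \<noteq> f" "x \<noteq> e + f" and z: "z \<in> M2"
  for M1 M2 e f x z
  proof -
    have orth': "\<not> pr b a" if "a \<in> M1" "b \<in> M2" for a b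
      using orth[OF that] by (simp add: pr_sym)
    obtain u2 where u2: "u2 \<in> N" "pr u2 z"
      using spans[of z] zero_N M z by blast
    have "u2 \<in> M2"
      using u2 orth z M by blast
    define u1 where "u1 = comp e f x"
    have u1: "u1 \<noteq> 0" "\<not> pr e u1" "\<not> pr f u1"
      using comp_perp[OF ef(3)] x zero_N M by (auto simp: u1_def comp_def add_eq_0 split: if_splits)
    have u1M: "\<not> pr m u1" if "m \<in> M2" for m
      unfolding u1_def using that ef x orth' by (subst comp_pr) auto
    \<comment> \<open>A member of \<open>N\<close> lies in one part and is orthogonal to the other,
      whereas x1 has a neighbour in \<open>M1\<close> and x2 has one in \<open>M2\<close>, and both
      are neighbours of the sum.\<close>
    have notN: "x1 + x2 \<notin> N" if xs: "\<And>m. m \<in> M2 \<Longrightarrow> \<not> pr m x1" "\<And>m. m \<in> M1 \<Longrightarrow> \<not> pr m x2" "x1 \<noteq> 0" "x2 \<noteq> 0" for x1 x2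
    proof
      assume N: "x1 + x2 \<in> N"
      obtain a b where a: "a \<in> N" "pr a x1" and b: "b \<in> N" "pr b x2"
        using spans xs(3,4) by blast
      have "a \<in> M1" "b \<in> M2"
        using a b xs(1,2) M by blast+
      then have "pr a (x1 + x2)" "pr b (x1 + x2)"
        using a b xs(1,2) by (auto simp: pr_add2)
      then show False
        using N M \<open>a \<in> M1\<close> \<open>b \<in> M2\<close> orth orth' by blast
    qed
    have ne: "e + u1 \<noteq> 0" "e \<noteq> 0" "z \<noteq> 0" "u2 \<noteq> 0"
      using u1 ef zero_N M z u2 pr_sym[of e f] by (auto simp: add_eq_0)
    show ?thesis
    proof (rule pattern_321I)
      show "e \<in> N" "f \<in> N" "z \<in> N" "pr e f"
        using ef M z by auto
      show "pr (u1 + u2) z"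
        using u2 u1M[OF z] by (simp add: pr_add pr_sym[of u1])
      show "\<not> pr e z" "\<not> pr f z"
        using ef z orth by auto
      show "\<not> pr e (u1 + u2)" "\<not> pr f (u1 + u2)"
        using u1 ef \<open>u2 \<in> M2\<close> orth by (auto simp: pr_add2)
      show "u1 + u2 \<notin> N" "e + z \<notin> N"
        using u1 u1M ne \<open>u2 \<in> M2\<close> orth orth' ef z by (intro notN; blast)+
      have "(e + u1) + u2 \<notin> N"
        using u1 u1M ne \<open>u2 \<in> M2\<close> orth orth' ef z by (intro notN) (auto simp: pr_add2)
      then show "e + (u1 + u2) \<notin> N"
        by (simp add: ac_simps)
    qed
  qed
  define M' where "M' = N - M"
  have M: "M \<union> M' = N" "M \<inter> M' = {}" "M' \<union> M = N" "M' \<inter> M = {}"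
    using assms by (auto simp: M'_def)
  have orth: "\<not> pr a b" "\<not> pr b a" if "a \<in> M" "b \<in> M'" for a b
    using adj[of a b] that by (auto simp: M'_def pr_sym)
  obtain e e' where e: "e \<in> M" "e' \<in> M'"
    using assms by (auto simp: M'_def)
  obtain f f' where f: "f \<in> N" "pr f e" "f' \<in> N" "pr f' e'"
    using spans[of e] spans[of e'] e zero_N M by blast
  have f': "f \<in> M" "f' \<in> M'"
    using f e orth M by blast+
  show ?thesis
  proof (cases "M \<subseteq> {e, f, e + f} \<and> M' \<subseteq> {e', f', e' + f'}")
    case True
    have "card (UNIV :: 'a set) \<le> 2 ^ card {e, f, e', f'}"
    proof (rule card_le_separating)
      fix v assume v: "\<And>c. c \<in> {e, f, e', f'} \<Longrightarrow> \<not> pr c v"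
      have "\<not> pr a v" if "a \<in> N" for a
        using that True M v by (auto simp: pr_add)
      then show "v = 0"
        using spans by blast
    qed simp
    also have "\<dots> \<le> 2 ^ 4"
      by (intro power_increasing) (auto simp: card_insert_if)
    finally show ?thesis
      using card_ge by simp
  next
    case False
    then consider x where "x \<in> M" "x \<noteq> e" "x \<noteq> f" "x \<noteq> e + f"
      | x where "x \<in> M'" "x \<noteq> e'" "x \<noteq> f'" "x \<noteq> e' + f'"
      by blast
    then show ?thesis
    proof cases
      case (1 x)
      then show ?thesis
        using *[OF M(1,2) orth(1) e(1) f'(1)] f(2) e(2) by (simp add: pr_sym)
    next
      case (2 x)
      then show ?thesis
        using *[OF M(3,4) orth(2) e(2) f'(2)] f(4) e(1) by (simp add: pr_sym)
    qed
  qed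
qed

end

section \<open>Closed sets whose non-orthogonality graph is connected\<close>

locale connected_closed_set = closed_set +
  assumes connected: "\<lbrakk>M \<subseteq> N; M \<noteq> {}; \<And>a b. a \<in> M \<Longrightarrow> b \<in> N \<Longrightarrow> pr a b \<Longrightarrow> b \<in> M\<rbrakk> \<Longrightarrow> M = N"
    and proper: "N \<noteq> UNIV - {0}"
begin

text \<open>If some plane of \<open>N\<close> and some \<open>w\<close> orthogonal to it generate seven vectors of \<open>N\<close>, the set
  \<open>X\<close> of all such \<open>w\<close> spreads along the connected set \<open>N\<close> and \<open>N\<close> consists of all nonzero vectors.\<close>

lemma not_both:
  assumes e: "e \<in> N" and f: "f \<in> N" and ef: "pr e f" and w: "\<not> pr e w" "\<not> pr f w" "w \<in> N"
  shows "e + w \<notin> N"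
proof
  assume ew: "e + w \<in> N"
  define X where "X = {x. \<not> pr e x \<and> \<not> pr f x \<and> x \<in> N \<and> e + x \<in> N}"
  have wX: "w \<in> X"
    using w ew by (simp add: X_def)
  have XD: "\<not> pr e x" "\<not> pr f x" "x \<in> N" "e + x \<in> N" "f + x \<in> N" "e + f + x \<in> N" "x \<noteq> 0" if "x \<in> X" for x
    using that plane_iff[OF e f ef, of x] zero_N by (auto simp: X_def)
  have spread: "y \<in> X" if x: "x \<in> X" and y: "\<not> pr e y" "\<not> pr f y" "y \<in> N \<or> e + y \<in> N" "pr x y" for x y
  proof -
    have "y \<in> N \<and> e + y \<in> N"
    proof (cases "y \<in> N")
      case True
      have "x + y \<in> N"
        using True XD[OF x] y by (auto intro: closed)
      moreover have "(e + x) + y \<in> N"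
        using True XD[OF x] y by (intro closed') (auto simp: pr_add)
      then have "(e + x + y) + x \<in> N"
        using True XD[OF x] y by (intro closed') (auto simp: pr_add pr_sym[of y x])
      ultimately show ?thesis
        using True by (simp add: ac_simps char2)
    next
      case False
      then have ey: "e + y \<in> N"
        using y by auto
      have "(e + x) + (e + y) \<in> N"
        using ey XD[OF x] y pr_sym[of x e] by (intro closed') (auto simp: pr_add pr_add2)
      then have "x + y \<in> N"
        by (simp add: ac_simps char2)
      then have "(x + y) + x \<in> N"
        using XD[OF x] y pr_sym[of x y] by (intro closed') (auto simp: pr_add pr_add2)
      then show ?thesis
        using ey by (simp add: ac_simps char2)
    qed
    then show ?thesis
      using y by (simp add: X_def)
  qed
  have compE: "comp e f a = 0 \<or> comp e f a \<in> N \<or> e + comp e f a \<in> N" "\<not> pr e (comp e f a)" "\<not> pr f (comp e f a)"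
    if "a \<in> N" for a
    using comp_cases[OF e f ef that] that comp_perp[OF ef] by auto
  have adjacent: "\<exists>t\<in>N. pr (comp e f t) x" if x: "\<not> pr e x" "\<not> pr f x" "x \<noteq> 0" for x
  proof -
    obtain t where "t \<in> N" "pr t x"
      using spans x(3) by blast
    then show ?thesis
      using comp_pr[of x e f t] x pr_sym by blast
  qed
  \<comment> \<open>If y is not in \<open>X\<close>, then \<open>X\<close> is orthogonal to y by
    \<open>spread\<close>. A neighbour t' of w in \<open>X\<close> brings w + y into
    \<open>X\<close>. A projection s' not orthogonal to y lies outside \<open>X\<close>, so it is
    orthogonal to w and to w + y, hence to y: a contradiction.\<close>
  have Y: "y \<in> X" if y: "\<not> pr e y" "\<not> pr f y" "y \<noteq> 0" "e + y \<in> N" for y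
  proof (rule ccontr)
    assume yX: "y \<notin> X"
    have ortho: "\<not> pr x y" if "x \<in> X" for x
      using spread[OF that] y yX by blast
    obtain t where t: "t \<in> N" "pr (comp e f t) w"
      using adjacent[of w] w zero_N by blast
    define t' where "t' = comp e f t"
    have t': "t' \<in> X"
      using spread[OF wX, of t'] t compE[OF t(1)] pr_sym[of w t'] by (auto simp: t'_def)
    have "(e + y) + (f + w) \<in> N"
      using y XD[OF wX] ef ortho[OF wX] pr_sym[of y f] pr_sym[of y w] by (intro closed') (auto simp: pr_add pr_add2)
    then have "e + f + (w + y) \<in> N"
      by (simp add: ac_simps)
    then have "e + (w + y) \<in> N"
      using plane_iff(2)[OF e f ef, of "w + y"] y XD[OF wX] by (auto simp: pr_add2)
    then have wy: "w + y \<in> X"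
      using spread[OF t', of "w + y"] y XD[OF wX] t(2) ortho[OF t'] by (auto simp: pr_add2 t'_def)
    obtain s where s: "s \<in> N" "pr (comp e f s) y"
      using adjacent[of y] y by blast
    define s' where "s' = comp e f s"
    have s'X: "s' \<notin> X"
      using ortho s(2) by (auto simp: s'_def)
    have "\<not> pr x s'" if "x \<in> X" for x
      using spread[OF that, of s'] s'X compE[OF s(1)] s(2) by (auto simp: s'_def)
    then have "\<not> pr w s'" "\<not> pr (w + y) s'"
      using wX wy by auto
    then show False
      using s(2) pr_sym[of y s'] by (auto simp: pr_add s'_def)
  qed
  \<comment> \<open>Starting from e, which projects to 0, adjacency in \<open>N\<close> never leaves
    the members that project into \<open>X\<close> or to 0.\<close>
  have N_eq: "{a \<in> N. comp e f a \<in> X \<or> comp e f a = 0} = N"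
  proof (rule connected)
    have "comp e f e = 0"
      using ef by (simp add: comp_def char2)
    then show "{a \<in> N. comp e f a \<in> X \<or> comp e f a = 0} \<noteq> {}"
      using e by blast
    fix a b assume a: "a \<in> {a \<in> N. comp e f a \<in> X \<or> comp e f a = 0}" and b: "b \<in> N" "pr a b"
    show "b \<in> {a \<in> N. comp e f a \<in> X \<or> comp e f a = 0}"
    proof (cases "e + comp e f b \<in> N \<and> comp e f b \<noteq> 0")
      case True
      then show ?thesis
        using Y[of "comp e f b"] b comp_perp[OF ef] by auto
    next
      case False
      show ?thesis
      proof (cases "comp e f b = 0")
        case nz: False
        then have b0: "\<not> pr e b" "\<not> pr f b" "comp e f b = b"
          using False comp_cases[OF e f ef b(1)] by auto
        then have "pr (comp e f a) b"
          using comp_pr[of b e f a] b pr_sym by blast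
        then have "comp e f a \<in> X"
          using a by auto
        then have "b \<in> X"
          using spread[of "comp e f a" b] b0 b \<open>pr (comp e f a) b\<close> by auto
        then show ?thesis
          using b b0 by simp
      qed (use b in auto)
    qed
  qed auto
  \<comment> \<open>\<open>U\<close> will be a subgroup containing \<open>N\<close>. A proper one
    would have a nonzero orthogonal vector, which \<open>spans\<close> excludes.\<close>
  define U where "U = {v. comp e f v \<in> X \<or> comp e f v = 0}"
  have comp_add: "comp e f (u + v) = comp e f u + comp e f v" for u v
    by (auto simp: comp_def pr_add ac_simps char2)
  have Xadd: "x + y \<in> X \<or> x + y = 0" if x: "x \<in> X" and y: "y \<in> X" for x y
  proof (cases "pr x y \<or> x = y")
    case True
    have "x + y \<in> X" if "pr x y"
      using spread[OF x, of "x + y"] closed[OF XD(3)[OF x] XD(3)[OF y] that] XD[OF x] XD[OF y] that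
      by (auto simp: pr_add2)
    then show ?thesis
      using True by (auto simp: char2)
  next
    case False
    have "(e + x) + (f + y) \<in> N"
      using XD[OF x] XD[OF y] ef False pr_sym[of x f] by (intro closed') (auto simp: pr_add pr_add2)
    then have "e + f + (x + y) \<in> N"
      by (simp add: ac_simps)
    then have "e + (x + y) \<in> N"
      using plane_iff(2)[OF e f ef, of "x + y"] XD[OF x] XD[OF y] by (auto simp: pr_add2)
    then show ?thesis
      using Y[of "x + y"] XD[OF x] XD[OF y] by (auto simp: pr_add2)
  qed
  have "U = UNIV"
  proof (rule ccontr)
    assume "U \<noteq> UNIV"
    moreover have "0 \<in> U"
      by (simp add: U_def comp_def)
    moreover have "u + v \<in> U" if "u \<in> U" "v \<in> U" for u v
      using that Xadd by (auto simp: U_def comp_add)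
    ultimately obtain c where c: "c \<noteq> 0" "\<And>u. u \<in> U \<Longrightarrow> \<not> pr c u"
      using perp_nontrivial[of U] by metis
    have "N \<subseteq> U"
      using N_eq by (auto simp: U_def)
    then show False
      using spans[OF c(1)] c(2) pr_sym by blast
  qed
  have "v \<in> N" if "v \<noteq> 0" for v
  proof -
    have v: "v = (if pr v f then e else 0) + ((if pr v e then f else 0) + comp e f v)"
      by (auto simp: comp_def ac_simps char2)
    have "e + f \<in> N"
      using closed[OF e f ef] .
    moreover have "comp e f v \<in> X \<or> comp e f v = 0"
      using \<open>U = UNIV\<close> by (auto simp: U_def)
    ultimately show ?thesis
      using v XD[of "comp e f v"] e f that by (cases "pr v f"; cases "pr v e") (auto simp: ac_simps)
  qed
  then show False
    using proper zero_N by auto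
qed

text \<open>A member c that is not orthogonal to exactly one of a and b forms with it a hyperbolic
  plane orthogonal to the other, and \<open>not_both\<close> applies.\<close>

lemma no_orthogonal_triple:
  assumes "a \<in> N" "b \<in> N" "\<not> pr a b" "a \<noteq> b"
  shows "a + b \<notin> N"
proof -
  obtain c where "c \<in> N" "pr c a \<noteq> pr c b"
    using separate[of N a b] spans assms(4) by blast
  then show ?thesis
    using not_both[of a c b] not_both[of b c a] assms pr_sym[of c a] pr_sym[of c b] pr_sym[of a b]
    by (auto simp: add.commute)
qed

text \<open>The law for a quadratic form has one case per membership of u and v.
  \<open>shift\<close> supplies the orthogonal pair with one member, closure and
  \<open>no_orthogonal_triple\<close> treat two members, and for two non-orthogonal nonmembers a
  member separating them is added to both.\<close>

lemma quadric:
  assumes shift: "\<And>c a. \<lbrakk>c \<notin> N; c \<noteq> 0; a \<in> N; \<not> pr a c\<rbrakk> \<Longrightarrow> a + c \<in> N"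
  shows "u + v \<in> N \<longleftrightarrow> (u \<in> N) \<noteq> ((v \<in> N) \<noteq> pr u v)"
proof -
  have one: "u + v \<in> N \<longleftrightarrow> \<not> pr u v" if "u \<in> N" "v \<notin> N" for u v
    using N_iff[of u v] shift[of v u] that by (cases "v = 0") (auto simp: add.commute)
  have *: "u + v \<in> N" if uv: "u \<notin> N" "v \<notin> N" "pr u v" and a: "a \<in> N" "pr a u" "\<not> pr a v" for u v a
  proof -
    have "u + a \<notin> N" "v + a \<in> N" "u + a \<noteq> 0"
      using one[of a u] one[of a v] uv a by (auto simp: add.commute add_eq_0)
    then have "(v + a) + (u + a) \<in> N"
      using uv a pr_sym[of v u] pr_sym[of a u] pr_sym[of v a] by (intro shift[of "u + a" "v + a"]) (auto simp: pr_add pr_add2)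
    then show ?thesis
      by (simp add: ac_simps char2)
  qed
  show ?thesis
  proof (cases "u \<in> N"; cases "v \<in> N")
    assume "u \<notin> N" "v \<notin> N"
    show ?thesis
    proof (cases "pr u v")
      case True
      then have "u \<noteq> v"
        by auto
      then obtain a where "a \<in> N" "pr a u \<noteq> pr a v"
        using separate[of N u v] spans by blast
      then show ?thesis
        using *[of u v a] *[of v u a] True \<open>u \<notin> N\<close> \<open>v \<notin> N\<close> pr_sym[of u v] by (auto simp: add.commute)
    next
      case False
      then have "u + v \<notin> N"
        using shift[of u "u + v"] \<open>u \<notin> N\<close> \<open>v \<notin> N\<close> pr_sym[of u v]
        by (cases "u = 0") (auto simp: pr_add ac_simps char2)
      then show ?thesis
        using False \<open>u \<notin> N\<close> \<open>v \<notin> N\<close> by simp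
    qed
  next
    assume "u \<in> N" "v \<in> N"
    then show ?thesis
      using closed no_orthogonal_triple[of u v] zero_N by (cases "u = v") (auto simp: char2)
  qed (use one[of u v] one[of v u] pr_sym[of u v] in \<open>auto simp: add.commute\<close>)
qed

text \<open>The vectors c and d violate the \<open>shift\<close> hypothesis of
  \<open>quadric\<close>. In a plane through d orthogonal to c, the vector c itself serves as u of
  the pattern, unless all members orthogonal to the plane are orthogonal to c. Then the y orthogonal
  to the plane with d + y in \<open>N\<close> are pairwise non-orthogonal, as happens for the
  vectors e_i + e_j of a symmetric group, and a sum of four of them serves as u.\<close>

lemma pattern_321_connected:
  assumes c: "c \<notin> N" "c \<noteq> 0" and d: "d \<in> N" "\<not> pr d c" "d + c \<notin> N"
  shows "pattern_321 N"
proof -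
  define Y where "Y e f = {y. \<not> pr e y \<and> \<not> pr f y \<and> y \<noteq> 0 \<and> e + y \<in> N}" for e f
  have Ysum: "y + y' \<in> (if pr y y' then N else Y e f)" "\<not> pr e (y + y')" "\<not> pr f (y + y')"
    if "e \<in> N" "f \<in> N" "pr e f" "y \<in> Y e f" "y' \<in> Y e f" "y \<noteq> y'" for e f y y'
  proof -
    note plane = plane_iff[OF that(1-3)]
    show p: "\<not> pr e (y + y')" "\<not> pr f (y + y')"
      using that by (auto simp: Y_def pr_add2)
    show "y + y' \<in> (if pr y y' then N else Y e f)"
    proof (cases "pr y y'")
      case True
      have "(e + y) + (e + y') \<in> N"
        using True that(4,5) pr_sym[of y e] by (intro closed') (auto simp: Y_def pr_add pr_add2)
      then show ?thesis
        using True by (simp add: ac_simps char2)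
    next
      case False
      have "f + y' \<in> N"
        using plane(1)[of y'] that(5) by (auto simp: Y_def)
      then have "(e + y) + (f + y') \<in> N"
        using False that(3-5) pr_sym[of y f] by (intro closed') (auto simp: Y_def pr_add pr_add2)
      then have "e + f + (y + y') \<in> N"
        by (simp add: ac_simps)
      then show ?thesis
        using plane(2)[of "y + y'"] p False that(6) by (auto simp: Y_def add_eq_0)
    qed
  qed
  have YZ: "y + z \<in> Y e f" if "e \<in> N" "f \<in> N" "y \<in> Y e f" "z \<in> N" "\<not> pr e z" "\<not> pr f z" "pr y z" for e f y z
  proof -
    have "(e + y) + z \<in> N"
      using that by (intro closed') (auto simp: Y_def pr_add)
    moreover have "y + z \<noteq> 0"
      using that(7) by (auto simp: add_eq_0)
    ultimately show ?thesis
      using that by (auto simp: Y_def pr_add2 ac_simps)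
  qed
  \<comment> \<open>The members that are not orthogonal to the plane or to some vector of
    \<open>Y e f\<close> are closed under adjacency, hence are all of \<open>N\<close>. So a vector
    w orthogonal to the plane and to \<open>Y e f\<close> would be orthogonal to
    \<open>N\<close>.\<close>
  have Yspan: "\<exists>y\<in>Y e f. pr y w" if ef: "e \<in> N" "f \<in> N" "pr e f" and w: "\<not> pr e w" "\<not> pr f w" "w \<noteq> 0" for e f w
  proof (rule ccontr)
    assume no: "\<not> (\<exists>y\<in>Y e f. pr y w)"
    define L where "L = {a \<in> N. pr e a \<or> pr f a \<or> (\<exists>y\<in>Y e f. pr y a)}"
    have "L = N"
    proof (rule connected)
      show "L \<subseteq> N"
        by (auto simp: L_def)
      have "f \<in> L"
        using ef by (auto simp: L_def)
      then show "L \<noteq> {}"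
        by blast
      fix a b assume a: "a \<in> L" and b: "b \<in> N" "pr a b"
      have "\<exists>y\<in>Y e f. pr y b" if be: "\<not> pr e b" "\<not> pr f b"
      proof (cases "pr e a \<or> pr f a")
        case True
        have pb: "pr (comp e f a) b"
          using comp_pr[of b e f a] be b(2) pr_sym by blast
        have "comp e f a \<in> Y e f"
          using comp_cases[OF ef, of a] True a comp_perp[OF ef(3)] pb by (auto simp: Y_def L_def)
        then show ?thesis
          using pb by blast
      next
        case False
        then obtain y where y: "y \<in> Y e f" "pr y a"
          using a by (auto simp: L_def)
        show ?thesis
        proof (cases "pr y b")
          case False
          then have "pr (y + a) b"
            using b(2) by (auto simp: pr_add)
          moreover have "y + a \<in> Y e f"
            using YZ[OF ef(1,2) y(1)] \<open>\<not> (pr e a \<or> pr f a)\<close> a y(2) by (auto simp: L_def)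
          ultimately show ?thesis
            by blast
        qed (use y in blast)
      qed
      then show "b \<in> L"
        using b by (auto simp: L_def)
    qed
    have "\<not> pr a w" if "a \<in> N" for a
    proof (cases "pr e a \<or> pr f a")
      case True
      then have "comp e f a = 0 \<or> comp e f a \<in> Y e f"
        using comp_cases[OF ef that] comp_perp[OF ef(3)] by (auto simp: Y_def)
      then have "\<not> pr (comp e f a) w"
        using no by auto
      then show ?thesis
        using comp_pr[of w e f a] w pr_sym by blast
    next
      case False
      moreover have "a \<in> L"
        using that \<open>L = N\<close> by simp
      ultimately obtain y where y: "y \<in> Y e f" "pr y a"
        unfolding L_def by blast
      have "y + a \<in> Y e f"
        using YZ[OF ef(1,2) y(1) that] False y by auto
      then have "\<not> pr (y + a) w" "\<not> pr y w"
        using no y by auto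
      then show ?thesis
        by (auto simp: pr_add)
    qed
    then show False
      using spans w(3) by blast
  qed
  \<comment> \<open>The plane through d has to be orthogonal to c. Otherwise all neighbours of d in
    \<open>N\<close> are neighbours of c; but for b and b + y, with y from \<open>Y b d\<close> not
    orthogonal to c + d, the products with c differ.\<close>
  have "\<exists>b\<in>N. pr d b \<and> \<not> pr b c"
  proof (rule ccontr)
    assume "\<not> ?thesis"
    then have no: "pr b c" if "b \<in> N" "pr d b" for b
      using that by blast
    obtain b where b: "b \<in> N" "pr d b"
      using spans[of d] d zero_N pr_sym by metis
    have w: "\<not> pr d (c + d)" "\<not> pr b (c + d)" "c + d \<noteq> 0"
      using b no d c by (auto simp: pr_add2 pr_sym[of b d] add_eq_0)
    obtain y where y: "y \<in> Y b d" "pr y (c + d)"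
      using Yspan[OF b(1) d(1) _ w(2,1,3)] b(2) pr_sym by blast
    then have "pr (b + y) c"
      using no[of "b + y"] b by (auto simp: Y_def pr_add2)
    then show False
      using y no[OF b] by (auto simp: Y_def pr_add pr_add2 pr_sym[of _ d])
  qed
  then obtain b where b: "b \<in> N" "pr d b" "\<not> pr b c"
    by blast
  then have ef: "d \<in> N" "b \<in> N" "pr d b"
    using d by auto
  let ?Y = "Y d b"
  show ?thesis
  proof (cases "\<exists>z\<in>N. \<not> pr d z \<and> \<not> pr b z \<and> pr z c")
    case True
    then obtain z where "z \<in> N" "\<not> pr d z" "\<not> pr b z" "pr z c"
      by blast
    then show ?thesis
      using c d b ef not_both[OF ef] pr_sym[of z c] by (intro pattern_321I[of d b z c]) auto
  next
    case False
    \<comment> \<open>The sum y + y' is a member orthogonal to the plane, so it is orthogonal to c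
      in the present case.\<close>
    have same: "pr y c \<longleftrightarrow> pr y' c" if "y \<in> ?Y" "y' \<in> ?Y" "pr y y'" for y y'
    proof -
      have "y \<noteq> y'"
        using that(3) by auto
      then have "\<not> pr (y + y') c"
        using Ysum[OF ef that(1,2)] False that(3) by auto
      then show ?thesis
        by (simp add: pr_add)
    qed
    obtain y1 where y1: "y1 \<in> ?Y" "pr y1 c"
      using Yspan[OF ef] c d b by blast
    \<comment> \<open>By \<open>same\<close>, vectors of Y with different products with c are
      orthogonal. A neighbour t of y in Y has product 0 with c, so it is orthogonal to y1 and y1 +
      y, which have product 1, and thus to y.\<close>
    have all1: "pr y c" if y: "y \<in> ?Y" for y
    proof (rule ccontr)
      assume yc: "\<not> pr y c"
      have "y1 \<noteq> y" "\<not> pr y1 y"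
        using y1 yc same[OF y1(1) y] by auto
      then have s: "y1 + y \<in> ?Y" "pr (y1 + y) c"
        using Ysum[OF ef y1(1) y] y1 yc by (auto simp: pr_add)
      obtain t where t: "t \<in> ?Y" "pr t y"
        using Yspan[OF ef, of y] y by (auto simp: Y_def)
      then have "\<not> pr t c"
        using same[OF t(1) y] yc by auto
      then have "\<not> pr t y1" "\<not> pr t (y1 + y)"
        using same[OF t(1) y1(1)] same[OF t(1) s(1)] s y1 by auto
      then show False
        using t(2) by (auto simp: pr_add2)
    qed
    have nonorth: "pr y y'" if "y \<in> ?Y" "y' \<in> ?Y" "y \<noteq> y'" for y y'
    proof (rule ccontr)
      assume "\<not> pr y y'"
      then have "y + y' \<in> ?Y"
        using Ysum(1)[OF ef that] by simp
      then show False
        using all1[of "y + y'"] all1[of y] all1[of y'] that by (simp add: pr_add)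
    qed
    \<comment> \<open>The plane contributes two of the at least eight vectors needed to separate the
      space. Six vectors leave room for four of them and a fifth one different from their
      sum.\<close>
    have "card ?Y \<ge> 6"
    proof -
      have "card (UNIV :: 'a set) \<le> 2 ^ card ({d, b} \<union> ?Y)"
      proof (rule card_le_separating)
        fix v assume "\<And>c. c \<in> {d, b} \<union> ?Y \<Longrightarrow> \<not> pr c v"
        then show "v = 0"
          using Yspan[OF ef, of v] by blast
      qed simp
      then have "(2::nat) ^ 8 \<le> 2 ^ card ({d, b} \<union> ?Y)"
        using card_ge by (rule order_trans[rotated])
      then have "8 \<le> card ({d, b} \<union> ?Y)"
        by (subst (asm) power_increasing_iff) auto
      also have "\<dots> \<le> card {d, b} + card ?Y"
        by (rule card_Un_le)
      also have "card {d, b} \<le> 2"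
        by (simp add: card_insert_if)
      finally show ?thesis
        by simp
    qed
    then obtain T where T: "T \<subseteq> ?Y" "card T = 4"
      using obtain_subset_with_card_n[of 4 ?Y] by auto
    then obtain p q r s where Te: "T = {p, q, r, s}" and dist: "p \<noteq> q" "p \<noteq> r" "p \<noteq> s" "q \<noteq> r" "q \<noteq> s" "r \<noteq> s"
      by (auto simp: card_Suc_eq numeral_eq_Suc)
    have "card (insert (p + q + r + s) T) \<le> 5"
      using T by (simp add: card_insert_if)
    then have "\<not> ?Y \<subseteq> insert (p + q + r + s) T"
      using \<open>card ?Y \<ge> 6\<close> card_mono[of "insert (p + q + r + s) T" ?Y] by auto
    then obtain t where t: "t \<in> ?Y" "t \<noteq> p + q + r + s" "t \<notin> T"
      by blast
    have Y5: "p \<in> ?Y" "q \<in> ?Y" "r \<in> ?Y" "s \<in> ?Y" "t \<in> ?Y"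
      using T t Te by auto
    have n: "pr p q" "pr p r" "pr p s" "pr p t" "pr q r" "pr q s" "pr q t" "pr r s" "pr r t" "pr s t"
      using nonorth Y5 dist t Te by auto
    \<comment> \<open>In a family of pairwise non-orthogonal vectors, a sum of four is
      non-orthogonal to each summand (three ones) and orthogonal to every further vector (four
      ones). So c' has product 1 with the member s + t of \<open>N\<close>.\<close>
    define c' where "c' = p + q + r + s"
    have p: "pr p c'" "pr q c'" "pr s c'" "\<not> pr t c'"
      using n pr_sym[of q p] pr_sym[of s p] pr_sym[of s q] pr_sym[of s r] pr_sym[of t p] pr_sym[of t q] pr_sym[of t r] pr_sym[of t s]
      by (auto simp: c'_def pr_add2)
    have perp: "\<not> pr d c'" "\<not> pr b c'"
      using Y5 by (auto simp: c'_def pr_add2 Y_def)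
    have "c' \<noteq> 0"
      using p by auto
    have c'Y: "d + c' \<notin> N"
    proof
      assume "d + c' \<in> N"
      then have "c' \<in> ?Y"
        using perp \<open>c' \<noteq> 0\<close> by (auto simp: Y_def)
      then show False
        using nonorth[of t c'] t p by (auto simp: c'_def)
    qed
    have c'N: "c' \<notin> N"
    proof
      assume "c' \<in> N"
      then have "p + c' \<in> ?Y"
        using YZ[OF ef(1,2) Y5(1)] perp p by auto
      moreover have "p + c' \<noteq> q"
        using dist by (auto simp: c'_def ac_simps add_eq_0)
      ultimately have "pr q (p + c')"
        using nonorth Y5 by blast
      then show False
        using p n pr_sym[of p q] by (auto simp: pr_add2)
    qed
    have z: "s + t \<in> N" "\<not> pr d (s + t)" "\<not> pr b (s + t)"
      using Ysum[OF ef Y5(4,5)] n t Te by auto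
    moreover have "pr c' (s + t)"
      using p by (auto simp: pr_add2 pr_sym[of c'])
    ultimately show ?thesis
      using c'N c'Y perp ef not_both[OF ef] by (intro pattern_321I[of d b "s + t" c']) auto
  qed
qed

end

context closed_set
begin

lemma quadric_or_pattern:
  assumes "N \<noteq> UNIV - {0}"
  shows "pattern_321 N \<or> (\<forall>u v. u + v \<in> N \<longleftrightarrow> (u \<in> N) \<noteq> ((v \<in> N) \<noteq> pr u v))"
proof (cases "\<exists>M\<subseteq>N. M \<noteq> {} \<and> M \<noteq> N \<and> (\<forall>a\<in>M. \<forall>b\<in>N. pr a b \<longrightarrow> b \<in> M)")
  case True
  then show ?thesis
    using pattern_321_disconnected by blast
next
  case False
  interpret connected_closed_set pr N
    using False assms by unfold_locales blast+
  show ?thesis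
    using quadric pattern_321_connected by blast
qed

end

section \<open>Complements that are single orbits\<close>

context symplectic
begin

text \<open>A set that splits off: every vector can be moved into the orthogonal complement of \<open>C\<close>
  without changing its products with that complement.\<close>

definition splits :: "'v set \<Rightarrow> bool" where
  "splits C \<longleftrightarrow> (\<forall>w. \<exists>w'. (\<forall>c\<in>C. \<not> pr c w') \<and> (\<forall>v. (\<forall>c\<in>C. \<not> pr c v) \<longrightarrow> pr v w' = pr v w))"

lemma splits_empty: "splits {}"
  by (auto simp: splits_def)

lemma splits_insert:
  assumes C: "splits C" and ef: "pr e f" "\<And>c. c \<in> C \<Longrightarrow> \<not> pr c e" "\<And>c. c \<in> C \<Longrightarrow> \<not> pr c f"
  shows "splits (insert e (insert f C))"
  unfolding splits_def
proof
  fix w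
  obtain w' where w': "\<And>c. c \<in> C \<Longrightarrow> \<not> pr c w'" "\<And>v. (\<And>c. c \<in> C \<Longrightarrow> \<not> pr c v) \<Longrightarrow> pr v w' = pr v w"
    using C unfolding splits_def by metis
  define x where "x = w' + ((if pr w' f then e else 0) + (if pr w' e then f else 0))"
  have "\<not> pr e x" "\<not> pr f x"
    using ef(1) pr_sym[of f e] pr_sym[of w' e] pr_sym[of w' f] by (auto simp: x_def pr_add2)
  moreover have "\<not> pr c x" if "c \<in> C" for c
    using w'(1)[OF that] ef(2,3)[OF that] by (auto simp: x_def pr_add2)
  moreover have "pr v x = pr v w" if "\<not> pr e v" "\<not> pr f v" "\<And>c. c \<in> C \<Longrightarrow> \<not> pr c v" for v
    using that w'(2)[of v] pr_sym[of v e] pr_sym[of v f] by (auto simp: x_def pr_add2)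
  ultimately show "\<exists>w'. (\<forall>c\<in>insert e (insert f C). \<not> pr c w') \<and>
      (\<forall>v. (\<forall>c\<in>insert e (insert f C). \<not> pr c v) \<longrightarrow> pr v w' = pr v w)"
    by auto
qed

lemma nonzero_perp:
  assumes "finite C" "2 ^ card C < card (UNIV :: 'v set)"
  obtains v where "v \<noteq> 0" "\<And>c. c \<in> C \<Longrightarrow> \<not> pr c v"
  using card_le_separating[OF assms(1)] assms(2) by (meson linorder_not_less)

lemma splits_partner:
  assumes "splits C" "v \<noteq> 0" "\<And>c. c \<in> C \<Longrightarrow> \<not> pr c v"
  obtains w where "pr v w" "\<And>c. c \<in> C \<Longrightarrow> \<not> pr c w"
  using nondegenerate[OF assms(2)] assms(1,3) unfolding splits_def by metis

end

text \<open>The factorization x y = y' x' is stated for lists of vectors, because conjugating a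
  product of transvections just moves the vectors; this keeps the factors visible to
  \<open>Wall_coordinates\<close>.\<close>

locale commuting = symplectic +
  fixes H :: "('a \<Rightarrow> 'a) set" and N :: "'a set"
  assumes H_isom: "H \<subseteq> isom"
    and commute: "\<exists>h\<in>H. \<exists>h'\<in>H. tvs (map h' bs @ map h as) = tvs (as @ bs)"
    and H_N: "h \<in> H \<Longrightarrow> h a \<in> N \<longleftrightarrow> a \<in> N"
    and zero_N: "0 \<notin> N"
    and closed: "a \<in> N \<Longrightarrow> b \<in> N \<Longrightarrow> pr a b \<Longrightarrow> a + b \<in> N"
    and card_ge: "2 ^ 8 \<le> card (UNIV :: 'a set)"
begin

lemma H_simps [simp]:
  assumes "h \<in> H"
  shows "h a \<in> N \<longleftrightarrow> a \<in> N" "h (a + b) = h a + h b" "pr (h a) (h b) = pr a b"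
  using H_N[OF assms] isomD(2,3)[of h] H_isom assms by auto

lemma perp_card:
  assumes "finite C" "card C \<le> 7"
  obtains v where "v \<noteq> 0" "\<And>c. c \<in> C \<Longrightarrow> \<not> pr c v"
proof -
  have "(2::nat) ^ card C \<le> 2 ^ 7"
    using assms by (intro power_increasing) auto
  also have "\<dots> < card (UNIV :: 'a set)"
    using card_ge by simp
  finally show thesis
    using nonzero_perp[OF assms(1)] that by blast
qed

lemma no_pattern_321: "\<not> pattern_321 N"
proof
  assume "pattern_321 N"
  then obtain e f z u where p: "e \<in> N" "f \<in> N" "z \<in> N" "pr e f" "pr u z" "\<not> pr e z" "\<not> pr e u"
    "\<not> pr f z" "\<not> pr f u" "u \<notin> N" "u + z \<notin> N"
    and q: "\<And>p. p \<in> {e, f, e + f} \<Longrightarrow> p + z \<notin> N \<and> p + u \<notin> N \<and> p + u + z \<notin> N"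
    unfolding pattern_321_def by blast
  have "e + f \<in> N"
    using p by (auto intro: closed)
  note q' = q[of e] q[of f] q[of "e + f"]
  have N: "lin [x1,x2,x3,x4] [e,f,z,u] \<in> N \<longleftrightarrow> \<not> x4 \<and> (x3 \<noteq> (x1 \<or> x2))" for x1 x2 x3 x4
    using p q' \<open>e + f \<in> N\<close> zero_N
    by (cases x1; cases x2; cases x3; cases x4) (simp_all add: ac_simps)
  obtain h h' where h: "h \<in> H" "h' \<in> H"
    and tvs: "tvs (map h' [f, f + z] @ map h [z + u, z + u + e + f]) = tvs ([z + u, z + u + e + f] @ [f, f + z])"
    using commute by blast
  note [simp] = pr_sym[of f e] pr_sym[of z u] pr_sym[of z e] pr_sym[of u e] pr_sym[of z f] pr_sym[of u f]
  show False
  proof (rule kill_321[OF p(4,5,6,7,8,9) N])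
    show "tvs [h' f, h' (f + z), h (z + u), h (z + u + e + f)] = tvs [z + u, z + u + e + f, f, f + z]"
      using tvs by (simp only: append_Cons append_Nil list.map)
    show "h' f \<in> N" "h' (f + z) \<notin> N" "h (z + u) \<notin> N" "h (z + u + e + f) \<notin> N"
      using p q' H_N[OF h(1)] H_N[OF h(2)] by (auto simp: ac_simps)
    show "\<not> pr (h' f) (h' (f + z))" "\<not> pr (h (z + u)) (h (z + u + e + f))"
      using p isomD(3)[of h] isomD(3)[of h'] h H_isom by (auto simp: pr_add pr_add2)
    have "h' f + h' (f + z) = h' z"
      using h by (simp add: char2)
    then show "h' f + h' (f + z) \<in> N"
      using p h by simp
    have "h (z + u) + h (z + u + e + f) = h ((z + u) + (z + u + e + f))"
      using h by (metis H_simps(2))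
    also have "(z + u) + (z + u + e + f) = e + f"
      by (simp add: ac_simps char2)
    finally show "h (z + u) + h (z + u + e + f) \<in> N"
      using H_N[OF h(1)] \<open>e + f \<in> N\<close> by simp
  qed
qed

lemma no_path:
  assumes ind: "indep [a1,a2,a3,d1,d2,d3]"
    and g: "pr a1 d1" "pr a2 d1" "pr a2 d2" "pr a3 d2" "pr a3 d3" "\<not> pr a1 d2" "\<not> pr a1 d3" "\<not> pr a2 d3"
      "\<not> pr a3 d1" "\<not> pr a1 a2" "\<not> pr a1 a3" "\<not> pr a2 a3" "\<not> pr d1 d2" "\<not> pr d1 d3" "\<not> pr d2 d3"
    and N: "\<And>x1 x2 x3 x4 x5 x6. wall [a1,a2,a3,d1,d2,d3] [x1,x2,x3,x4,x5,x6] [x1,x2,x3,x4,x5,x6] \<Longrightarrow>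
      lin [x1,x2,x3,x4,x5,x6] [a1,a2,a3,d1,d2,d3] \<in> N \<longleftrightarrow> \<not> (x1 \<noteq> (x2 \<noteq> (x3 \<noteq> (x5 \<noteq> x6))))"
  shows False
proof -
  have n: "d1 \<in> N" "d2 \<notin> N" "d3 \<notin> N" "a1 \<notin> N" "a2 \<notin> N" "a3 \<notin> N"
    using N[of False False False True False False] N[of False False False False True False]
      N[of False False False False False True] N[of True False False False False False]
      N[of False True False False False False] N[of False False True False False False] by simp_all
  obtain h h' where h: "h \<in> H" "h' \<in> H"
    and tvs: "tvs (map h' [d1,d2,d3] @ map h [a1,a2,a3]) = tvs ([a1,a2,a3] @ [d1,d2,d3])"
    using commute by blast
  show False
  proof (rule kill_path[OF ind g N])
    show "tvs [h' d1,h' d2,h' d3,h a1,h a2,h a3] = tvs [a1,a2,a3,d1,d2,d3]"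
      using tvs by (simp only: append_Cons append_Nil list.map)
  qed (use h n g in auto)
qed

text \<open>On the span of independent factors the diagonal of the Wall form is itself a quadratic
  form polarizing to \<open>pr\<close>, so the form defining \<open>N\<close> differs from it by an
  additive functional. Where the diagonal is 1, membership in \<open>N\<close> means that this
  functional vanishes; among the six factors it vanishes at d1 only.\<close>

lemma not_quadric:
  assumes quad: "\<And>u v. u + v \<in> N \<longleftrightarrow> (u \<in> N) \<noteq> ((v \<in> N) \<noteq> pr u v)"
  shows False
proof -
  \<comment> \<open>Of orthogonal v, x and their sum, not all three can take the value 1, which
    yields a nonzero e outside \<open>N\<close>. For a partner f of e, the values at f and e + f
    differ.\<close>
  have pair: "\<exists>e f. pr e f \<and> e \<notin> N \<and> f \<notin> N \<and> (\<forall>c\<in>C. \<not> pr c e \<and> \<not> pr c f)"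
    if C: "splits C" "finite C" "card C \<le> 4" for C
  proof -
    have "\<exists>e. e \<noteq> 0 \<and> e \<notin> N \<and> (\<forall>c\<in>C. \<not> pr c e)"
    proof -
      obtain v where v: "v \<noteq> 0" "\<And>c. c \<in> C \<Longrightarrow> \<not> pr c v"
        using perp_card[of C] C by auto
      obtain w where w: "pr v w" "\<And>c. c \<in> C \<Longrightarrow> \<not> pr c w"
        using splits_partner[OF C(1) v] by blast
      have "card (insert v (insert w C)) \<le> 7"
        using C by (simp add: card_insert_if)
      then obtain x where x: "x \<noteq> 0" "\<And>c. c \<in> insert v (insert w C) \<Longrightarrow> \<not> pr c x"
        using perp_card[of "insert v (insert w C)"] C by blast
      have "v + x \<noteq> 0"
        using x(2)[of w] w(1) pr_sym by (auto simp: add_eq_0)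
      moreover have "v \<notin> N \<or> x \<notin> N \<or> v + x \<notin> N"
        using quad[of v x] x(2)[of v] by auto
      ultimately show ?thesis
        using v x by (auto simp: pr_add2)
    qed
    then obtain e where e: "e \<noteq> 0" "e \<notin> N" "\<And>c. c \<in> C \<Longrightarrow> \<not> pr c e"
      by blast
    obtain f where f: "pr e f" "\<And>c. c \<in> C \<Longrightarrow> \<not> pr c f"
      using splits_partner[OF C(1) e(1,3)] by blast
    have "f \<notin> N \<or> e + f \<notin> N"
      using quad[of e f] e f by auto
    then show ?thesis
    proof
      assume "e + f \<notin> N"
      then show ?thesis
        using e f by (intro exI[of _ e] exI[of _ "e + f"]) (auto simp: pr_add2)
    qed (use e f in blast)
  qed
  obtain e1 f1 where p1: "pr e1 f1" "e1 \<notin> N" "f1 \<notin> N"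
    using pair[OF splits_empty] by auto
  have s1: "splits {e1, f1}"
    using splits_insert[OF splits_empty p1(1)] by simp
  obtain e2 f2 where p2: "pr e2 f2" "e2 \<notin> N" "f2 \<notin> N" "\<not> pr e1 e2" "\<not> pr f1 e2" "\<not> pr e1 f2" "\<not> pr f1 f2"
    using pair[OF s1] card_length[of "[e1, f1]"] by auto
  have s2: "splits {e2, f2, e1, f1}"
    using p2 by (intro splits_insert[OF s1]) auto
  obtain e3 f3 where p3: "pr e3 f3" "e3 \<notin> N" "f3 \<notin> N" "\<not> pr e1 e3" "\<not> pr f1 e3" "\<not> pr e1 f3" "\<not> pr f1 f3"
      "\<not> pr e2 e3" "\<not> pr f2 e3" "\<not> pr e2 f3" "\<not> pr f2 f3"
    using pair[OF s2] card_length[of "[e2, f2, e1, f1]"] by auto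
  note p = p1 p2 p3
  have ps: "pr f1 e1" "pr f2 e2" "pr f3 e3" "\<not> pr e2 e1" "\<not> pr e2 f1" "\<not> pr f2 e1" "\<not> pr f2 f1"
    "\<not> pr e3 e1" "\<not> pr e3 f1" "\<not> pr f3 e1" "\<not> pr f3 f1" "\<not> pr e3 e2" "\<not> pr e3 f2" "\<not> pr f3 e2" "\<not> pr f3 f2"
    using p pr_sym by blast+
  note [simp] = p ps
  \<comment> \<open>In path order: e1, e1 + f1, e1 + e2, f2, e2 + e3, f3. Only e1 + f1 takes the
    value 1.\<close>
  let ?cs = "[e1, e1 + e2, e2 + e3, e1 + f1, f2, f3]"
  have prs: "pr f1 (lin [x1,x2,x3,x4,x5,x6] ?cs) = (x1 \<noteq> (x2 \<noteq> x4))"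
    "pr e1 (lin [x1,x2,x3,x4,x5,x6] ?cs) = x4" "pr f2 (lin [x1,x2,x3,x4,x5,x6] ?cs) = (x2 \<noteq> x3)"
    "pr e2 (lin [x1,x2,x3,x4,x5,x6] ?cs) = x5" "pr f3 (lin [x1,x2,x3,x4,x5,x6] ?cs) = x3"
    "pr e3 (lin [x1,x2,x3,x4,x5,x6] ?cs) = x6" for x1 x2 x3 x4 x5 x6
    by (auto simp: pr_add2)
  show False
  proof (rule no_path)
    show "indep ?cs"
      unfolding indep_def
    proof (intro allI impI)
      fix xs assume "length xs = length ?cs" and 0: "lin xs ?cs = 0"
      then obtain x1 x2 x3 x4 x5 x6 where xs: "xs = [x1,x2,x3,x4,x5,x6]"
        by (auto simp: length_Suc_conv numeral_eq_Suc)
      show "True \<notin> set xs"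
        using prs[of x1 x2 x3 x4 x5 x6] 0 unfolding xs by (auto simp del: lin.simps)
    qed
    have q: "(if b then v else 0) + w \<in> N \<longleftrightarrow> (b \<and> ((v \<in> N) \<noteq> pr v w)) \<noteq> (w \<in> N)" for b v w
      using quad[of v w] by auto
    fix x1 x2 x3 x4 x5 x6
    assume "wall ?cs [x1,x2,x3,x4,x5,x6] [x1,x2,x3,x4,x5,x6]"
    then show "lin [x1,x2,x3,x4,x5,x6] ?cs \<in> N \<longleftrightarrow> \<not> (x1 \<noteq> (x2 \<noteq> (x3 \<noteq> (x5 \<noteq> x6))))"
      using zero_N by (cases x1; cases x2; cases x3; cases x4; cases x5; cases x6) (simp_all add: q quad pr_add pr_add2)
  qed (auto simp: pr_add pr_add2)
qed

text \<open>Here the additive functional of the path is \<open>pr v\<close> itself. The path is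
  built from the hyperbolic pairs v, f1 and e2, f2 and e3, f3 so that only its vertex d1 = e2 + f3
  is orthogonal to v.\<close>

lemma not_vector:
  assumes v: "v \<noteq> 0" and N: "\<And>x. x \<in> N \<longleftrightarrow> x \<noteq> 0 \<and> \<not> pr v x"
  shows False
proof -
  obtain f1 where p1: "pr v f1"
    using nondegenerate v by blast
  have s1: "splits {v, f1}"
    using splits_insert[OF splits_empty p1] by simp
  obtain e2 where e2: "e2 \<noteq> 0" "\<And>c. c \<in> {v, f1} \<Longrightarrow> \<not> pr c e2"
    using perp_card[of "{v, f1}"] card_length[of "[v, f1]"] by auto
  obtain f2 where f2: "pr e2 f2" "\<And>c. c \<in> {v, f1} \<Longrightarrow> \<not> pr c f2"
    using splits_partner[OF s1 e2] by blast
  have s2: "splits {e2, f2, v, f1}"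
    using e2 f2 by (intro splits_insert[OF s1]) auto
  obtain e3 where e3: "e3 \<noteq> 0" "\<And>c. c \<in> {e2, f2, v, f1} \<Longrightarrow> \<not> pr c e3"
    using perp_card[of "{e2, f2, v, f1}"] card_length[of "[e2, f2, v, f1]"] by auto
  obtain f3 where f3: "pr e3 f3" "\<And>c. c \<in> {e2, f2, v, f1} \<Longrightarrow> \<not> pr c f3"
    using splits_partner[OF s2 e3] by blast
  have p: "pr v f1" "pr e2 f2" "pr e3 f3" "\<not> pr v e2" "\<not> pr v f2" "\<not> pr f1 e2" "\<not> pr f1 f2"
    "\<not> pr v e3" "\<not> pr v f3" "\<not> pr f1 e3" "\<not> pr f1 f3" "\<not> pr e2 e3" "\<not> pr e2 f3" "\<not> pr f2 e3" "\<not> pr f2 f3"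
    using p1 e2 f2 e3 f3 by auto
  have ps: "pr f1 v" "pr f2 e2" "pr f3 e3" "\<not> pr e2 v" "\<not> pr f2 v" "\<not> pr e2 f1" "\<not> pr f2 f1"
    "\<not> pr e3 v" "\<not> pr f3 v" "\<not> pr e3 f1" "\<not> pr f3 f1" "\<not> pr e3 e2" "\<not> pr f3 e2" "\<not> pr e3 f2" "\<not> pr f3 f2"
    using p pr_sym by blast+
  note [simp] = p ps
  let ?cs = "[f1 + f2 + f3, f1 + e2 + e3, v + f1 + e2 + f3, e2 + f3, f1 + f3, f1]"
  have prs: "pr v (lin [x1,x2,x3,x4,x5,x6] ?cs) = (x1 \<noteq> (x2 \<noteq> (x3 \<noteq> (x5 \<noteq> x6))))"
    "pr f1 (lin [x1,x2,x3,x4,x5,x6] ?cs) = x3" "pr e2 (lin [x1,x2,x3,x4,x5,x6] ?cs) = x1"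
    "pr f2 (lin [x1,x2,x3,x4,x5,x6] ?cs) = (x2 \<noteq> (x3 \<noteq> x4))"
    "pr e3 (lin [x1,x2,x3,x4,x5,x6] ?cs) = (x1 \<noteq> (x3 \<noteq> (x4 \<noteq> x5)))"
    "pr f3 (lin [x1,x2,x3,x4,x5,x6] ?cs) = x2" for x1 x2 x3 x4 x5 x6
    by (auto simp: pr_add2)
  have ind: "indep ?cs"
    unfolding indep_def
  proof (intro allI impI)
    fix xs assume "length xs = length ?cs" and 0: "lin xs ?cs = 0"
    then obtain x1 x2 x3 x4 x5 x6 where xs: "xs = [x1,x2,x3,x4,x5,x6]"
      by (auto simp: length_Suc_conv numeral_eq_Suc)
    show "True \<notin> set xs"
      using prs[of x1 x2 x3 x4 x5 x6] 0 unfolding xs by (auto simp del: lin.simps)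
  qed
  show False
  proof (rule no_path[OF ind])
    fix x1 x2 x3 x4 x5 x6
    assume wall: "wall ?cs [x1,x2,x3,x4,x5,x6] [x1,x2,x3,x4,x5,x6]"
    \<comment> \<open>A diagonal Wall value 1 requires a nonzero coordinate; this excludes 0, the
      one vector orthogonal to v outside \<open>N\<close>.\<close>
    have "lin [x1,x2,x3,x4,x5,x6] ?cs \<noteq> 0"
    proof
      assume "lin [x1,x2,x3,x4,x5,x6] ?cs = 0"
      then have "True \<notin> set [x1,x2,x3,x4,x5,x6]"
        using ind unfolding indep_def by (metis length_Cons list.size(3))
      then show False
        using wall by simp
    qed
    then show "lin [x1,x2,x3,x4,x5,x6] ?cs \<in> N \<longleftrightarrow> \<not> (x1 \<noteq> (x2 \<noteq> (x3 \<noteq> (x5 \<noteq> x6))))"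
      unfolding N prs by blast
  qed (auto simp: pr_add pr_add2)
qed

text \<open>The vectors u1, u2 are dual to v1, v2, and x is orthogonal to R, u1 and u2. On the span
  of the five factors, orthogonality to R reduces to orthogonality to v1 and v2, which is the
  pattern of \<open>kill_subspace\<close>.\<close>

lemma not_subspace:
  assumes R0: "0 \<in> R" and R: "\<And>u v. u \<in> R \<Longrightarrow> v \<in> R \<Longrightarrow> u + v \<in> R \<and> \<not> pr u v"
    and v: "v1 \<in> R" "v2 \<in> R" "v1 \<noteq> 0" "v2 \<noteq> 0" "v1 \<noteq> v2"
    and N: "\<And>x. x \<in> N \<longleftrightarrow> x \<noteq> 0 \<and> (\<forall>r\<in>R. \<not> pr r x)"
  shows False
proof -
  have ind2: "indep [v1, v2]"
    unfolding indep_def using v by (auto simp: length_Suc_conv add_eq_0 numeral_eq_Suc split: if_splits)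
  obtain u1 where u1: "pr u1 v1" "\<not> pr u1 v2"
    using dual_exists[OF ind2, of "[True, False]"] by auto
  obtain u2' where u2': "\<not> pr u2' v1" "pr u2' v2"
    using dual_exists[OF ind2, of "[False, True]"] by auto
  have vv: "\<not> pr v1 v2"
    using R v by blast
  define u2 where "u2 = (if pr u2' u1 then u2' + v1 else u2')"
  have u2: "\<not> pr u2 v1" "pr u2 v2" "\<not> pr u2 u1"
    using u1 u2' vv pr_sym[of v1 u1] by (auto simp: u2_def pr_add)
  \<comment> \<open>If R is just the plane of v1 and v2, only four orthogonality conditions remain.
    Otherwise a further vector of R is made orthogonal to u1 and u2 by adding v1 and v2.\<close>
  have "\<exists>x. x \<noteq> 0 \<and> \<not> pr u1 x \<and> \<not> pr u2 x \<and> (\<forall>r\<in>R. \<not> pr r x)"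
  proof (cases "R \<subseteq> {0, v1, v2, v1 + v2}")
    case True
    obtain x where x: "x \<noteq> 0" "\<And>c. c \<in> {v1, v2, u1, u2} \<Longrightarrow> \<not> pr c x"
      using perp_card[of "{v1, v2, u1, u2}"] card_length[of "[v1, v2, u1, u2]"] by auto
    then show ?thesis
      using True by (intro exI[of _ x]) (auto simp: pr_add)
  next
    case False
    then obtain r where r: "r \<in> R" "r \<notin> {0, v1, v2, v1 + v2}"
      by blast
    define x where "x = r + ((if pr u1 r then v1 else 0) + (if pr u2 r then v2 else 0))"
    have "x \<in> R"
      using r R R0 v by (auto simp: x_def)
    moreover have "x \<noteq> 0"
      using r by (auto simp: x_def add_eq_0)
    moreover have "\<not> pr u1 x" "\<not> pr u2 x"
      using u1 u2 by (auto simp: x_def pr_add2)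
    ultimately show ?thesis
      using R by blast
  qed
  then obtain x where x: "x \<noteq> 0" "\<not> pr u1 x" "\<not> pr u2 x" "\<And>r. r \<in> R \<Longrightarrow> \<not> pr r x"
    by blast
  have p: "pr u1 v1" "pr u2 v2" "\<not> pr u1 v2" "\<not> pr u2 v1" "\<not> pr u1 u2" "\<not> pr v1 v2" "\<not> pr u1 x" "\<not> pr u2 x"
    "\<not> pr v1 x" "\<not> pr v2 x"
    using u1 u2 vv x v pr_sym by blast+
  have ps: "pr v1 u1" "pr v2 u2" "\<not> pr v2 u1" "\<not> pr v1 u2" "\<not> pr u2 u1" "\<not> pr v2 v1" "\<not> pr x u1" "\<not> pr x u2"
    "\<not> pr x v1" "\<not> pr x v2"
    using p pr_sym by blast+
  note [simp] = p ps
  let ?cs = "[v1 + v2 + x, u1 + v1 + u2 + v2, v1, v1 + u2 + v2, v1 + x]"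
  have prs: "pr v1 (lin [x1,x2,x3,x4,x5] ?cs) = x2" "pr v2 (lin [x1,x2,x3,x4,x5] ?cs) = (x2 \<noteq> x4)"
    "pr u1 (lin [x1,x2,x3,x4,x5] ?cs) = (x1 \<noteq> (x2 \<noteq> (x3 \<noteq> (x4 \<noteq> x5))))"
    "pr u2 (lin [x1,x2,x3,x4,x5] ?cs) = (x1 \<noteq> (x2 \<noteq> x4))" for x1 x2 x3 x4 x5
    by (auto simp: pr_add2)
  have ne0: "lin [x1,x2,x3,x4,x5] ?cs = 0 \<longleftrightarrow> \<not> (x1 \<or> x2 \<or> x3 \<or> x4 \<or> x5)" for x1 x2 x3 x4 x5
  proof
    assume 0: "lin [x1,x2,x3,x4,x5] ?cs = 0"
    have "\<not> x2" "\<not> x4" "\<not> x1" "x3 = x5"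
      using prs[of x1 x2 x3 x4 x5] 0 by (auto simp del: lin.simps)
    then show "\<not> (x1 \<or> x2 \<or> x3 \<or> x4 \<or> x5)"
      using 0 x(1) by auto
  qed auto
  have ind: "indep ?cs"
    unfolding indep_def
  proof (intro allI impI)
    fix xs assume "length xs = length ?cs" and 0: "lin xs ?cs = 0"
    then obtain x1 x2 x3 x4 x5 where xs: "xs = [x1,x2,x3,x4,x5]"
      by (auto simp: length_Suc_conv numeral_eq_Suc)
    show "True \<notin> set xs"
      using ne0[of x1 x2 x3 x4 x5] 0 unfolding xs by (auto simp del: lin.simps)
  qed
  have Nl: "lin [x1,x2,x3,x4,x5] ?cs \<in> N \<longleftrightarrow> \<not> x2 \<and> \<not> x4 \<and> (x1 \<or> x3 \<or> x5)" for x1 x2 x3 x4 x5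
  proof (cases "x2 \<or> x4")
    case True
    then show ?thesis
      using prs(1,2)[of x1 x2 x3 x4 x5] v unfolding N by blast
  next
    case False
    have "\<not> pr r (lin [x1,False,x3,False,x5] ?cs)" if "r \<in> R" for r
      using R[OF that v(1)] R[OF that v(2)] x(4)[OF that] by (auto simp: pr_add2)
    then show ?thesis
      using False ne0[of x1 x2 x3 x4 x5] unfolding N by auto
  qed
  have n: "v1 \<in> N" "v1 + u2 + v2 \<notin> N" "v1 + x \<in> N" "v1 + v2 + x \<in> N" "u1 + v1 + u2 + v2 \<notin> N"
    using Nl[of False False True False False] Nl[of False False False True False]
      Nl[of False False False False True] Nl[of True False False False False]
      Nl[of False True False False False] by simp_all
  obtain h h' where h: "h \<in> H" "h' \<in> H"
    and tvs: "tvs (map h' [v1, v1 + u2 + v2, v1 + x] @ map h [v1 + v2 + x, u1 + v1 + u2 + v2]) =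
      tvs ([v1 + v2 + x, u1 + v1 + u2 + v2] @ [v1, v1 + u2 + v2, v1 + x])"
    using commute by blast
  have pH: "pr (h a) (h b) = pr a b" "pr (h' a) (h' b) = pr a b" "h a \<in> N \<longleftrightarrow> a \<in> N" "h' a \<in> N \<longleftrightarrow> a \<in> N" for a b
    using h by auto
  show False
  proof (rule kill_subspace[OF ind _ _ _ _ _ _ _ _ _ _ Nl])
    show "tvs [h' v1, h' (v1 + u2 + v2), h' (v1 + x), h (v1 + v2 + x), h (u1 + v1 + u2 + v2)] =
      tvs [v1 + v2 + x, u1 + v1 + u2 + v2, v1, v1 + u2 + v2, v1 + x]"
      using tvs by (simp only: append_Cons append_Nil list.map)
  qed (unfold pH, auto simp: n pr_add pr_add2)
qed

text \<open>When \<open>N\<close> does not generate the space, let R be its orthogonal space, which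
  is nonzero and \<open>H\<close>-invariant. An \<open>H\<close>-invariant property of one nonzero
  nonmember holds for all of them. Applied to lying in R and to being orthogonal to R, this shows
  that R is totally isotropic and that \<open>N\<close> is everything nonzero orthogonal to
  R.\<close>

theorem transitive_complement_impossible:
  assumes N: "N \<noteq> {}" "N \<noteq> UNIV - {0}"
    and orb: "\<And>c c'. \<lbrakk>c \<notin> N; c \<noteq> 0; c' \<notin> N; c' \<noteq> 0\<rbrakk> \<Longrightarrow> \<exists>h\<in>H. h c = c'"
  shows False
proof (cases "\<forall>v. v \<noteq> 0 \<longrightarrow> (\<exists>a\<in>N. pr a v)")
  case True
  interpret closed_set pr N
    using True zero_N closed card_ge by unfold_locales auto
  show False
    using quadric_or_pattern[OF N(2)] no_pattern_321 not_quadric by blast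
next
  case False
  define R where "R = {v. \<forall>a\<in>N. \<not> pr a v}"
  obtain v where v: "v \<in> R" "v \<noteq> 0"
    using False by (auto simp: R_def)
  have R_add: "x + y \<in> R" if "x \<in> R" "y \<in> R" for x y
    using that by (auto simp: R_def pr_add2)
  have HR: "h x \<in> R" if "h \<in> H" "x \<in> R" for h x
  proof -
    have h: "h \<in> isom"
      using that H_isom by blast
    have "\<not> pr a (h x)" if "a \<in> N" for a
    proof -
      have "inv_into UNIV h a \<in> N"
        using H_N[OF \<open>h \<in> H\<close>, of "inv_into UNIV h a"] that h by simp
      then have "\<not> pr (inv_into UNIV h a) x"
        using \<open>x \<in> R\<close> by (auto simp: R_def)
      then show ?thesis
        using isomD(3)[OF h, of "inv_into UNIV h a" x] h by simp
    qed
    then show ?thesis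
      by (simp add: R_def)
  qed
  obtain a where a: "a \<in> N"
    using N by blast
  obtain w where w: "w \<notin> R"
    using nondegenerate[of a] a zero_N by (auto simp: R_def)
  \<comment> \<open>Otherwise all nonzero nonmembers lie in R with r. Everything outside R is then
    in \<open>N\<close>, so orthogonal to r, and the vectors outside R generate the space.\<close>
  have RN: "r \<in> N" if r: "r \<in> R" "r \<noteq> 0" for r
  proof (rule ccontr)
    assume rN: "r \<notin> N"
    have out: "\<not> pr r x" if "x \<notin> R" for x
    proof -
      have "x \<noteq> 0"
        using that by (auto simp: R_def)
      have "x \<in> N"
      proof (rule ccontr)
        assume "x \<notin> N"
        then obtain h where "h \<in> H" "h r = x"
          using orb[OF rN r(2)] \<open>x \<noteq> 0\<close> by blast
        then show False
          using HR r that by blast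
      qed
      then show ?thesis
        using r pr_sym by (auto simp: R_def)
    qed
    have "\<not> pr r x" for x
    proof (cases "x \<in> R")
      case True
      have "x + w \<notin> R"
        using R_add[OF True, of "x + w"] w by auto
      then show ?thesis
        using out[of "x + w"] out[OF w] by (auto simp: pr_add2)
    qed (use out in blast)
    then show False
      using nondegenerate r by blast
  qed
  \<comment> \<open>If one nonmember were orthogonal to R, all would be; members are so by
    definition, and v would be orthogonal to everything.\<close>
  have NR: "x \<in> N \<longleftrightarrow> x \<noteq> 0 \<and> (\<forall>r\<in>R. \<not> pr r x)" for x
  proof
    assume "x \<in> N"
    then show "x \<noteq> 0 \<and> (\<forall>r\<in>R. \<not> pr r x)"
      using zero_N pr_sym by (auto simp: R_def)
  next
    assume x: "x \<noteq> 0 \<and> (\<forall>r\<in>R. \<not> pr r x)"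
    show "x \<in> N"
    proof (rule ccontr)
      assume xN: "x \<notin> N"
      have "\<not> pr v y" for y
      proof (cases "y \<in> N \<or> y = 0")
        case False
        then obtain h where h: "h \<in> H" "h x = y"
          using orb[of x y] x xN by blast
        have hi: "h \<in> isom"
          using h H_isom by blast
        have "inv_into UNIV h v \<in> R"
        proof -
          have "\<not> pr b (inv_into UNIV h v)" if "b \<in> N" for b
          proof -
            have "\<not> pr (h b) v"
              using that H_N[OF h(1)] v by (auto simp: R_def)
            then show ?thesis
              using pr_inv[OF hi] by simp
          qed
          then show ?thesis
            by (simp add: R_def)
        qed
        then have "\<not> pr (inv_into UNIV h v) x"
          using x by blast
        then show ?thesis
          using isomD(3)[OF hi, of "inv_into UNIV h v" x] hi h by simp
      qed (use v pr_sym in \<open>auto simp: R_def\<close>)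
      then show False
        using nondegenerate v by blast
    qed
  qed
  show False
  proof (cases "R = {0, v}")
    case True
    then show False
      using not_vector[OF v(2)] NR by auto
  next
    case False
    have "0 \<in> R"
      by (simp add: R_def)
    then have "\<not> R \<subseteq> {0, v}"
      using False v(1) by auto
    then obtain v' where v': "v' \<in> R" "v' \<noteq> 0" "v' \<noteq> v"
      by auto
    show False
    proof (rule not_subspace[OF \<open>0 \<in> R\<close> _ v(1) v'(1) v(2) v'(2) v'(3)[symmetric] NR])
      show "x + y \<in> R \<and> \<not> pr x y" if "x \<in> R" "y \<in> R" for x y
        using R_add[OF that] RN[OF that(2)] NR[of y] that(1) by (cases "y = 0") auto
    qed
  qed
qed

end

section \<open>Quadratic forms\<close>

context symplectic
begin

lemma isom_id: "id \<in> isom"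
  using bij_id by (simp add: isom_def id_def)

lemma inv_comp_isom: "f \<in> isom \<Longrightarrow> g \<in> isom \<Longrightarrow> inv_into UNIV (f \<circ> g) = inv_into UNIV g \<circ> inv_into UNIV f"
  by (simp add: isomD(1) o_inv_distrib)

lemma inv_inv_isom: "f \<in> isom \<Longrightarrow> inv_into UNIV (inv_into UNIV f) = f"
  by (simp add: isomD(1) inv_inv_eq)

lemma inv_tv [simp]: "inv_into UNIV (tv a) = tv a"
  by (rule inv_equality) auto

text \<open>The induction is on the number of moved points. Vectors of the form f y + y are
  orthogonal to the fixed points of f, so transvections along sums of such vectors keep these fixed;
  one or two of them carry f v back to v.\<close>

lemma transvections_generate:
  assumes "f \<in> isom"
  shows "\<exists>cs. f = tvs cs"
  using assms
proof (induction "card {x. f x \<noteq> x}" arbitrary: f rule: less_induct)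
  case less
  note f = isomD(2,3)[OF less.prems]
  show ?case
  proof (cases "\<forall>v. f v = v")
    case True
    then have "f = tvs []"
      by (auto simp: fun_eq_iff)
    then show ?thesis
      by blast
  next
    case False
    have fixed: "\<not> pr (f v + v) x" if "f x = x" for x v
      using f(2)[of v x] that by (simp add: pr_add)
    have step: "\<exists>cs. f = tvs cs" if x: "f v \<noteq> v" and as: "tvs as (f v) = v" "\<And>x. f x = x \<Longrightarrow> tvs as x = x" for v as
    proof -
      have "card {x. (tvs as \<circ> f) x \<noteq> x} < card {x. f x \<noteq> x}"
      proof (rule psubset_card_mono)
        have "{x. (tvs as \<circ> f) x \<noteq> x} \<subseteq> {x. f x \<noteq> x} - {v}"
          using as by auto
        then show "{x. (tvs as \<circ> f) x \<noteq> x} \<subset> {x. f x \<noteq> x}"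
          using x by blast
      qed simp
      then obtain cs where cs: "tvs as \<circ> f = tvs cs"
        using less.hyps isom_comp[OF isom_tp less.prems] by blast
      have "tvs (rev as) \<circ> tvs as = id" for as
        by (induction as) (auto simp: tp_append fun_eq_iff)
      then have "f = tvs (rev as) \<circ> (tvs as \<circ> f)"
        by (simp add: o_assoc)
      then have "f = tvs (rev as @ cs)"
        unfolding cs tp_append .
      then show ?thesis
        by blast
    qed
    show ?thesis
    proof (cases "\<exists>v. pr v (f v)")
      case True
      then obtain v where v: "pr v (f v)"
        by blast
      show ?thesis
      proof (rule step[of v "[f v + v]"])
        show "f v \<noteq> v"
          using v by auto
        show "tvs [f v + v] (f v) = v"
          using v by (simp add: tv_def pr_add)
        show "tvs [f v + v] x = x" if "f x = x" for x
          using fixed[OF that, of v] by (simp add: tv_def)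
      qed
    next
      case no: False
      obtain v where v: "f v \<noteq> v"
        using False by blast
      have "inv_into UNIV f v \<noteq> v"
        using v isom_f_inv[OF less.prems, of v] by auto
      then obtain u where u: "pr (inv_into UNIV f v + v) u"
        using nondegenerate[of "inv_into UNIV f v + v"] by (auto simp: add_eq_0)
      have fu: "pr (f u) v \<longleftrightarrow> pr u (inv_into UNIV f v)"
        using pr_inv[OF less.prems] by simp
      have uv: "pr u (f v) \<longleftrightarrow> pr v (f u)"
        using no f(1)[of u v] by (metis pr_add pr_add2)
      \<comment> \<open>The intermediate vector v + a has to be non-orthogonal to both v and f v.
        The choice of u gives \<open>pr a v\<close>; since \<open>pr y (f y)\<close> is identically
        false, polarizing it shows that a has the same product with f v.\<close>
      define a where "a = f u + u"
      have a: "pr a v" "pr a (f v)"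
        using u uv fu f(2)[of u v] pr_sym[of u v] pr_sym[of v "f u"] pr_sym[of u "inv_into UNIV f v"]
        by (auto simp: a_def pr_add)
      define w where "w = v + a"
      have w: "pr w v" "pr w (f v)" "pr v w" "\<not> pr v (f v)"
        using a no pr_sym[of v w] by (auto simp: w_def pr_add)
      show ?thesis
      proof (rule step[of v "[w + v, f v + w]"])
        show "f v \<noteq> v"
          by (rule v)
        show "tvs [w + v, f v + w] (f v) = v"
          using w by (simp add: tv_def pr_add char2 ac_simps)
        fix x assume x: "f x = x"
        have "\<not> pr (w + v) x"
          using fixed[OF x, of u] by (simp add: w_def a_def ac_simps)
        moreover have "\<not> pr (f v + w) x"
          using fixed[OF x, of u] fixed[OF x, of v] by (auto simp: w_def a_def pr_add)
        ultimately show "tvs [w + v, f v + w] x = x"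
          by (simp add: tv_def)
      qed
    qed
  qed
qed

section \<open>The quadratic forms polarizing to the symplectic form and their classes\<close>

definition quad :: "('v \<Rightarrow> bool) \<Rightarrow> bool" where
  "quad q \<longleftrightarrow> (\<forall>u v. q (u + v) \<longleftrightarrow> q u \<noteq> (q v \<noteq> pr u v))"

lemma quadD: "quad q \<Longrightarrow> q (u + v) \<longleftrightarrow> q u \<noteq> (q v \<noteq> pr u v)"
  by (simp add: quad_def)

lemma quad_0: "quad q \<Longrightarrow> \<not> q 0"
  using quadD[of q 0 0] by auto

text \<open>A form on a maximal subgroup extends to one more vector x: give x the value 0, and
  polarization dictates the values on the coset of x.\<close>

lemma quad_exists: "\<exists>q. quad q"
proof -
  define P where "P U \<longleftrightarrow> 0 \<in> U \<and> (\<forall>u\<in>U. \<forall>v\<in>U. u + v \<in> U) \<and>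
    (\<exists>q. \<forall>u\<in>U. \<forall>v\<in>U. q (u + v) \<longleftrightarrow> q u \<noteq> (q v \<noteq> pr u v))" for U :: "'v set"
  have "P {0}"
    unfolding P_def by (intro conjI exI[of _ "\<lambda>_. False"]) auto
  then have "\<exists>U\<in>{U. P U}. {0} \<subseteq> U \<and> (\<forall>U'\<in>{U. P U}. U \<subseteq> U' \<longrightarrow> U = U')"
    by (intro finite_has_maximal2) simp_all
  then obtain U where "U \<in> {U. P U}" and max: "\<forall>U'\<in>{U. P U}. U \<subseteq> U' \<longrightarrow> U = U'"
    by (elim bexE conjE)
  have maxU: "U = U'" if "P U'" "U \<subseteq> U'" for U'
    by (rule max[rule_format, OF CollectI]) (rule that)+
  have "P U"
    using \<open>U \<in> {U. P U}\<close> by (rule CollectD)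
  then have 0: "0 \<in> U" and add: "\<And>u v. u \<in> U \<Longrightarrow> v \<in> U \<Longrightarrow> u + v \<in> U"
    and "\<exists>q. \<forall>u\<in>U. \<forall>v\<in>U. q (u + v) \<longleftrightarrow> q u \<noteq> (q v \<noteq> pr u v)"
    unfolding P_def by (elim conjE; simp only:)+
  then obtain q where "\<forall>u\<in>U. \<forall>v\<in>U. q (u + v) \<longleftrightarrow> q u \<noteq> (q v \<noteq> pr u v)"
    by (elim exE)
  then have q: "\<And>u v. u \<in> U \<Longrightarrow> v \<in> U \<Longrightarrow> q (u + v) \<longleftrightarrow> q u \<noteq> (q v \<noteq> pr u v)"
    by (simp only:)
  have "x \<in> U" for x
  proof (rule ccontr)
    assume x: "x \<notin> U"
    define U' where "U' = U \<union> (\<lambda>u. u + x) ` U"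
    define q' where "q' y = (if y \<in> U then q y else q (y + x) \<noteq> pr (y + x) x)" for y
    have ux: "u + x \<notin> U" if "u \<in> U" for u
      using add[OF that, of "u + x"] x by auto
    have q'U: "q' u = q u" "q' (u + x) = (q u \<noteq> pr u x)" if "u \<in> U" for u
      using that ux[OF that] by (auto simp: q'_def add.assoc char2)
    have xx: "(u + x) + v = (u + v) + x" "u + (v + x) = (u + v) + x" "(u + x) + (v + x) = u + v" for u v
      by (simp_all add: ac_simps char2)
    have "P U'"
      unfolding P_def
    proof (intro conjI ballI exI)
      show "0 \<in> U'"
        using 0 by (simp add: U'_def)
      fix y z assume "y \<in> U'" "z \<in> U'"
      then obtain u v where u: "u \<in> U" "y = u \<or> y = u + x" and v: "v \<in> U" "z = v \<or> z = v + x"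
        by (auto simp: U'_def)
      have m: "u + v \<in> U'" "u + v + x \<in> U'"
        using add[OF u(1) v(1)] by (simp_all add: U'_def)
      have p: "pr (u + x) v \<longleftrightarrow> pr u v \<noteq> pr v x" "pr u (v + x) \<longleftrightarrow> pr u v \<noteq> pr u x"
        "pr (u + x) (v + x) \<longleftrightarrow> pr u v \<noteq> (pr u x \<noteq> pr v x)" "pr (u + v) x \<longleftrightarrow> pr u x \<noteq> pr v x"
        using pr_sym[of x v] by (simp_all add: pr_add pr_add2) argo
      note e = q'U[OF u(1)] q'U[OF v(1)] q'U[OF add[OF u(1) v(1)]]
      have "y + z \<in> U' \<and> (q' (y + z) \<longleftrightarrow> q' y \<noteq> (q' z \<noteq> pr y z))"
        using u(2) v(2)
      proof (elim disjE)
        assume y: "y = u" and z: "z = v"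
        show ?thesis
          unfolding y z xx e p q[OF u(1) v(1)] using m by argo
      next
        assume y: "y = u" and z: "z = v + x"
        show ?thesis
          unfolding y z xx e p q[OF u(1) v(1)] using m by argo
      next
        assume y: "y = u + x" and z: "z = v"
        show ?thesis
          unfolding y z xx e p q[OF u(1) v(1)] using m by argo
      next
        assume y: "y = u + x" and z: "z = v + x"
        show ?thesis
          unfolding y z xx(3)[of u v] e p q[OF u(1) v(1)] using m by argo
      qed
      then show "y + z \<in> U'" "q' (y + z) \<longleftrightarrow> q' y \<noteq> (q' z \<noteq> pr y z)"
        by blast+
    qed
    then have "U = U'"
      by (rule maxU) (simp add: U'_def)
    moreover have "0 + x \<in> U'"
      unfolding U'_def using 0 by (intro UnI2 imageI)
    ultimately show False
      using x by simp
  qed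
  then have "quad q"
    using q by (simp add: quad_def)
  then show ?thesis
    by blast
qed

text \<open>Two forms with the same polarization differ by an additive functional, so by
  \<open>Riesz\<close> this reaches every form from a single one.\<close>

definition qc :: "('v \<Rightarrow> bool) \<Rightarrow> 'v \<Rightarrow> 'v \<Rightarrow> bool" where
  "qc q c = (\<lambda>v. q v \<noteq> pr c v)"

lemma qc_apply: "qc q c v \<longleftrightarrow> q v \<noteq> pr c v"
  by (simp add: qc_def)

lemma qc_qc: "qc (qc q c) d = qc q (c + d)"
  by (auto simp: qc_def pr_add fun_eq_iff)

lemma qc_inj: "qc q c = qc q d \<longleftrightarrow> c = d"
proof
  assume "qc q c = qc q d"
  then have "\<not> pr (c + d) v" for v
    by (auto simp: qc_def fun_eq_iff pr_add)
  then show "c = d"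
    using nondegenerate[of "c + d"] add_eq_0 by blast
qed simp

lemma quad_qc: "quad q \<Longrightarrow> quad (qc q c)"
  by (auto simp: quad_def qc_def pr_add2)

lemma qc_0 [simp]: "qc q 0 = q"
  by (simp add: qc_def)

lemma quad_tv: "quad q \<Longrightarrow> q \<circ> tv a = (if q a then q else qc q a)"
  by (auto simp: fun_eq_iff tv_def qc_def quadD pr_sym)

lemma qc_isom: "f \<in> isom \<Longrightarrow> qc q c \<circ> f = qc (q \<circ> f) (inv_into UNIV f c)"
  by (auto simp: fun_eq_iff qc_def) (metis isomD(3) isom_f_inv)+

text \<open>The quadratic forms in the class of \<open>q\<close> are those with the Arf invariant of \<open>q\<close>.\<close>

definition arf :: "('v \<Rightarrow> bool) \<Rightarrow> ('v \<Rightarrow> bool) set" where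
  "arf q = {qc q c | c. \<not> q c}"

lemma arf_refl: "quad q \<Longrightarrow> q \<in> arf q"
  using quad_0 by (force simp: arf_def intro: exI[of _ 0])

text \<open>For \<open>p = qc q c\<close> with c singular for q, one has
  \<open>p d = q (c + d)\<close>: the parametrization of the class is merely shifted by c.\<close>

lemma arf_eq:
  assumes "quad q" "p \<in> arf q"
  shows "arf p = arf q"
proof -
  obtain c where c: "p = qc q c" "\<not> q c"
    using assms by (auto simp: arf_def)
  have *: "p d \<longleftrightarrow> q (c + d)" for d
    using c assms by (auto simp: qc_apply quadD pr_sym)
  have "r \<in> arf p \<longleftrightarrow> r \<in> arf q" for r
  proof -
    have "r \<in> arf p \<longleftrightarrow> (\<exists>d. r = qc q (c + d) \<and> \<not> q (c + d))"
      by (auto simp: arf_def * c(1)[symmetric] qc_qc[symmetric])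
    also have "\<dots> \<longleftrightarrow> r \<in> arf q"
    proof
      assume "r \<in> arf q"
      then obtain e where "r = qc q e" "\<not> q e"
        by (auto simp: arf_def)
      then show "\<exists>d. r = qc q (c + d) \<and> \<not> q (c + d)"
        by (intro exI[of _ "c + e"]) simp
    qed (auto simp: arf_def)
    finally show ?thesis .
  qed
  then show ?thesis
    by blast
qed

lemma arf_isom:
  assumes q: "quad q" and p: "p \<in> arf q" and f: "f \<in> isom"
  shows "p \<circ> f \<in> arf q"
proof -
  have "p \<circ> tvs cs \<in> arf q" if "p \<in> arf q" for p cs
    using that
  proof (induction cs arbitrary: p)
    case (Cons c cs)
    have p: "quad p"
      using Cons.prems q quad_qc by (auto simp: arf_def)
    have "p \<circ> tv c \<in> arf p"
      unfolding quad_tv[OF p] using arf_refl[OF p] by (auto simp: arf_def)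
    then have "p \<circ> tv c \<in> arf q"
      using arf_eq[OF q Cons.prems] by simp
    from Cons.IH[OF this] show ?case
      by (simp add: o_assoc)
  qed simp
  then show ?thesis
    using transvections_generate[OF f] p by blast
qed

lemma quad_arf: "quad q \<Longrightarrow> p \<in> arf q \<Longrightarrow> quad p"
  using quad_qc by (auto simp: arf_def)

lemma arf_transitive:
  assumes q: "quad q" and p: "p \<in> arf q"
  shows "\<exists>f\<in>isom. q \<circ> f = p"
proof -
  obtain c where "p = qc q c" "\<not> q c"
    using p by (auto simp: arf_def)
  then show ?thesis
    using quad_tv[OF q, of c] isom_tv by (intro bexI[of _ "tv c"]) auto
qed

lemma common_neighbour:
  assumes "c \<noteq> 0" "d \<noteq> 0" "c \<noteq> d"
  shows "\<exists>x. pr x c \<and> pr x d"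
proof -
  have "indep [c, d]"
    unfolding indep_def using assms by (auto simp: length_Suc_conv add_eq_0 numeral_eq_Suc split: if_splits)
  then show ?thesis
    using dual_exists[of "[c, d]" "[True, True]"] by auto
qed

text \<open>This is transitivity of the orthogonal group of q on nonzero singular vectors. If c and
  d are not orthogonal, then q takes the value 1 at c + d, so the transvection along c + d preserves
  q, and it exchanges c and d. Orthogonal ones are linked through a singular common
  neighbour.\<close>

lemma arf_two_transitive_aux:
  assumes q: "quad q" and c: "\<not> q c" "c \<noteq> 0" and d: "\<not> q d" "d \<noteq> 0"
  shows "\<exists>f\<in>isom. q \<circ> f = q \<and> qc q c \<circ> f = qc q d"
proof -
  have *: "\<exists>f\<in>isom. q \<circ> f = q \<and> qc q c \<circ> f = qc q d" if "\<not> q c" "\<not> q d" "pr c d" for c d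
  proof -
    have "q \<circ> tv (c + d) = q"
      using that quad_tv[OF q, of "c + d"] quadD[OF q, of c d] by simp
    moreover have "tv (c + d) c = d"
      using that pr_sym[of d c] by (simp add: tv_def pr_add char2 ac_simps)
    ultimately show ?thesis
      using isom_tv[of "c + d"] qc_isom[OF isom_tv, of q c "c + d"] by auto
  qed
  show ?thesis
  proof (cases "c = d")
    case True
    then show ?thesis
      using isom_id by (intro bexI[of _ id]) auto
  next
    case False
    obtain x where x: "pr x c" "pr x d"
      using common_neighbour[OF c(2) d(2) False] by blast
    show ?thesis
    proof (cases "pr c d")
      case False
      \<comment> \<open>Both x and x + c are common neighbours of c and d, and q takes different
        values at them.\<close>
      define y where "y = (if q x then x + c else x)"
      have y: "pr c y" "pr y d" "\<not> q y"
        using x c False quadD[OF q, of x c] pr_sym[of x c] by (auto simp: y_def pr_add pr_add2)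
      obtain f g where f: "f \<in> isom" "q \<circ> f = q" "qc q c \<circ> f = qc q y"
        and g: "g \<in> isom" "q \<circ> g = q" "qc q y \<circ> g = qc q d"
        using *[OF c(1) y(3,1)] *[OF y(3) d(1) y(2)] by blast
      have "q \<circ> (f \<circ> g) = q" "qc q c \<circ> (f \<circ> g) = qc q d"
        using f g by (simp_all only: o_assoc)
      then show ?thesis
        using isom_comp[OF f(1) g(1)] by blast
    qed (use * c d in blast)
  qed
qed

lemma arf_two_transitive:
  assumes q: "quad q" and "p \<in> arf q" "r \<in> arf q" "p \<noteq> r" "p' \<in> arf q" "r' \<in> arf q" "p' \<noteq> r'"
  shows "\<exists>f\<in>isom. p \<circ> f = p' \<and> r \<circ> f = r'"
proof -
  have qp: "quad p" "quad p'"
    using assms quad_arf by blast+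
  obtain f where f: "f \<in> isom" "p \<circ> f = p'"
    using arf_transitive[of p p'] arf_eq[OF q assms(2)] assms qp by auto
  have "r \<circ> f \<in> arf p'"
    using arf_isom[OF q assms(3) f(1)] arf_eq[OF q assms(5)] by simp
  then obtain c where c: "r \<circ> f = qc p' c" "\<not> p' c"
    by (auto simp: arf_def)
  obtain d where d: "r' = qc p' d" "\<not> p' d"
    using arf_eq[OF q assms(5)] assms by (auto simp: arf_def)
  have "r \<circ> f \<noteq> p \<circ> f"
  proof
    assume "r \<circ> f = p \<circ> f"
    then have "r \<circ> f \<circ> inv_into UNIV f = p \<circ> f \<circ> inv_into UNIV f"
      by simp
    then show False
      using assms(4) f(1) by (auto simp: fun_eq_iff)
  qed
  then have "c \<noteq> 0" "d \<noteq> 0"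
    using c d f assms by auto
  then obtain g where g: "g \<in> isom" "p' \<circ> g = p'" "qc p' c \<circ> g = qc p' d"
    using arf_two_transitive_aux[OF qp(2)] c d by blast
  have "p \<circ> (f \<circ> g) = p'" "r \<circ> (f \<circ> g) = r'"
    using f g c d by (simp_all only: o_assoc)
  then show ?thesis
    using isom_comp[OF f(1) g(1)] by blast
qed

end

section \<open>Commuting convolutions\<close>

text \<open>Integer-valued functions suffice, as only indicator functions of classes and counting
  functions of relations are convolved.\<close>

locale commutative_pair = symplectic +
  fixes H :: "('a \<Rightarrow> 'a) set"
  assumes H_isom: "H \<subseteq> isom"
    and H_id: "id \<in> H"
    and H_comp: "h \<in> H \<Longrightarrow> k \<in> H \<Longrightarrow> h \<circ> k \<in> H"
    and H_inv: "h \<in> H \<Longrightarrow> inv_into UNIV h \<in> H"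
    and convolution_commute: "\<lbrakk>\<And>h g. h \<in> H \<Longrightarrow> g \<in> isom \<Longrightarrow> \<phi> (h \<circ> g \<circ> inv_into UNIV h) = \<phi> g;
      \<And>h g. h \<in> H \<Longrightarrow> g \<in> isom \<Longrightarrow> \<psi> (h \<circ> g \<circ> inv_into UNIV h) = \<psi> g; g \<in> isom\<rbrakk> \<Longrightarrow>
      (\<Sum>x\<in>isom. \<phi> x * \<psi> (inv_into UNIV x \<circ> g)) = (\<Sum>x\<in>isom. \<psi> x * (\<phi> (inv_into UNIV x \<circ> g) :: int))"
    and card_ge: "2 ^ 8 \<le> card (UNIV :: 'a set)"
begin

text \<open>Convolve the indicator functions of the \<open>H\<close>-classes of x and y. At x y one
  order is positive because of the factorization into x and y, so the other order has a nonzero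
  term.\<close>

lemma conjugates_commute:
  assumes "x \<in> isom" "y \<in> isom"
  shows "\<exists>h\<in>H. \<exists>h'\<in>H. (h' \<circ> y \<circ> inv_into UNIV h') \<circ> (h \<circ> x \<circ> inv_into UNIV h) = x \<circ> y"
proof -
  define X where "X z = {h \<circ> z \<circ> inv_into UNIV h | h. h \<in> H}" for z :: "'a \<Rightarrow> 'a"
  define \<phi> where "\<phi> z w = (if w \<in> X z then 1 else 0 :: int)" for z w
  have X_self: "z \<in> X z" for z
    using H_id by (force simp: X_def intro: exI[of _ id])
  have X_inv: "h \<circ> g \<circ> inv_into UNIV h \<in> X z" if h: "h \<in> H" and g: "g \<in> X z" for h g z
  proof -
    obtain k where k: "k \<in> H" "g = k \<circ> z \<circ> inv_into UNIV k"
      using g by (auto simp: X_def)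
    have "inv_into UNIV (h \<circ> k) = inv_into UNIV k \<circ> inv_into UNIV h"
      using h k H_isom by (intro inv_comp_isom) auto
    then have "h \<circ> g \<circ> inv_into UNIV h = (h \<circ> k) \<circ> z \<circ> inv_into UNIV (h \<circ> k)"
      by (simp add: k o_assoc)
    then show ?thesis
      using H_comp[OF h k(1)] unfolding X_def by blast
  qed
  have \<phi>_inv: "\<phi> z (h \<circ> g \<circ> inv_into UNIV h) = \<phi> z g" if h: "h \<in> H" for z h g
  proof -
    have hi: "h \<in> isom"
      using h H_isom by blast
    have "inv_into UNIV h \<circ> (h \<circ> g \<circ> inv_into UNIV h) \<circ> inv_into UNIV (inv_into UNIV h) = g"
      using hi by (simp add: fun_eq_iff inv_inv_isom)
    then show ?thesis
      using X_inv[OF h, of g z] X_inv[OF H_inv[OF h], of "h \<circ> g \<circ> inv_into UNIV h" z] by (auto simp: \<phi>_def)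
  qed
  have "(\<Sum>g\<in>isom. \<phi> x g * \<phi> y (inv_into UNIV g \<circ> (x \<circ> y))) = (\<Sum>g\<in>isom. \<phi> y g * \<phi> x (inv_into UNIV g \<circ> (x \<circ> y)))"
    using \<phi>_inv assms by (intro convolution_commute isom_comp) auto
  moreover have "(\<Sum>g\<in>isom. \<phi> x g * \<phi> y (inv_into UNIV g \<circ> (x \<circ> y))) \<noteq> 0"
  proof
    assume "(\<Sum>g\<in>isom. \<phi> x g * \<phi> y (inv_into UNIV g \<circ> (x \<circ> y))) = 0"
    then have "\<phi> x x * \<phi> y (inv_into UNIV x \<circ> (x \<circ> y)) = 0"
      using assms(1) by (subst (asm) sum_nonneg_eq_0_iff) (auto simp: \<phi>_def)
    moreover have "inv_into UNIV x \<circ> (x \<circ> y) = y"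
      using assms(1) by (simp add: fun_eq_iff)
    ultimately show False
      using X_self by (simp add: \<phi>_def)
  qed
  ultimately obtain g where g: "g \<in> isom" "\<phi> y g * \<phi> x (inv_into UNIV g \<circ> (x \<circ> y)) \<noteq> 0"
    by (metis (no_types, lifting) sum.neutral)
  then obtain h h' where h: "h' \<in> H" "g = h' \<circ> y \<circ> inv_into UNIV h'" "h \<in> H" "inv_into UNIV g \<circ> (x \<circ> y) = h \<circ> x \<circ> inv_into UNIV h"
    by (auto simp: \<phi>_def X_def split: if_splits)
  have "g \<circ> (inv_into UNIV g \<circ> (x \<circ> y)) = x \<circ> y"
    using g(1) by (simp add: fun_eq_iff)
  then show ?thesis
    using h by metis
qed

lemma tp_commute: "\<exists>h\<in>H. \<exists>h'\<in>H. tvs (map h' bs @ map h as) = tvs (as @ bs)"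
proof -
  obtain h h' where h: "h \<in> H" "h' \<in> H"
    and eq: "(h' \<circ> tvs bs \<circ> inv_into UNIV h') \<circ> (h \<circ> tvs as \<circ> inv_into UNIV h) = tvs as \<circ> tvs bs"
    using conjugates_commute[OF isom_tp isom_tp] by blast
  then have "tvs (map h' bs @ map h as) = tvs (as @ bs)"
    using H_isom isom_conj_tp[of h as] isom_conj_tp[of h' bs] by (simp add: tp_append subset_iff)
  then show ?thesis
    using h by blast
qed

section \<open>The group algebra acting on functions on a class of forms\<close>

definition acts :: "(('a \<Rightarrow> 'a) \<Rightarrow> int) \<Rightarrow> (('a \<Rightarrow> bool) \<Rightarrow> int) \<Rightarrow> ('a \<Rightarrow> bool) \<Rightarrow> int" where
  "acts \<phi> f w = (\<Sum>g\<in>isom. \<phi> g * f (w \<circ> g))"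

lemma acts_acts: "acts \<phi> (acts \<psi> f) w = (\<Sum>x\<in>isom. (\<Sum>g\<in>isom. \<phi> g * \<psi> (inv_into UNIV g \<circ> x)) * f (w \<circ> x))"
proof -
  have "acts \<phi> (acts \<psi> f) w = (\<Sum>g\<in>isom. \<Sum>k\<in>isom. \<phi> g * \<psi> k * f (w \<circ> g \<circ> k))"
    by (simp add: acts_def sum_distrib_left mult.assoc)
  also have "\<dots> = (\<Sum>g\<in>isom. \<Sum>x\<in>isom. \<phi> g * \<psi> (inv_into UNIV g \<circ> x) * f (w \<circ> x))"
  proof (rule sum.cong[OF refl])
    fix g assume g: "g \<in> isom"
    have eq: "g \<circ> (inv_into UNIV g \<circ> x) = x" "inv_into UNIV g \<circ> (g \<circ> x) = x" for x
      using g by (auto simp: fun_eq_iff)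
    show "(\<Sum>k\<in>isom. \<phi> g * \<psi> k * f (w \<circ> g \<circ> k)) = (\<Sum>x\<in>isom. \<phi> g * \<psi> (inv_into UNIV g \<circ> x) * f (w \<circ> x))"
      using g by (intro sum.reindex_bij_witness[of _ "\<lambda>x. inv_into UNIV g \<circ> x" "\<lambda>k. g \<circ> k"])
        (auto simp: eq isom_comp isom_inv o_assoc[symmetric])
  qed
  also have "\<dots> = (\<Sum>x\<in>isom. (\<Sum>g\<in>isom. \<phi> g * \<psi> (inv_into UNIV g \<circ> x)) * f (w \<circ> x))"
    by (subst sum.swap) (simp add: sum_distrib_right)
  finally show ?thesis .
qed

lemma acts_commute:
  assumes "\<And>h g. h \<in> H \<Longrightarrow> g \<in> isom \<Longrightarrow> \<phi> (h \<circ> g \<circ> inv_into UNIV h) = \<phi> g"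
    "\<And>h g. h \<in> H \<Longrightarrow> g \<in> isom \<Longrightarrow> \<psi> (h \<circ> g \<circ> inv_into UNIV h) = \<psi> g"
  shows "acts \<phi> (acts \<psi> f) w = acts \<psi> (acts \<phi> f) w"
  unfolding acts_acts
proof (rule sum.cong[OF refl])
  fix x assume "x \<in> isom"
  then have "(\<Sum>g\<in>isom. \<phi> g * \<psi> (inv_into UNIV g \<circ> x)) = (\<Sum>g\<in>isom. \<psi> g * \<phi> (inv_into UNIV g \<circ> x))"
    using assms by (intro convolution_commute)
  then show "(\<Sum>g\<in>isom. \<phi> g * \<psi> (inv_into UNIV g \<circ> x)) * f (w \<circ> x) = (\<Sum>g\<in>isom. \<psi> g * \<phi> (inv_into UNIV g \<circ> x)) * f (w \<circ> x)"
    by (rule arg_cong)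
qed

context
  fixes q0 :: "'a \<Rightarrow> bool" and \<Omega> :: "('a \<Rightarrow> bool) set"
  assumes q0: "quad q0" and \<Omega>: "\<Omega> = arf q0"
begin

lemma \<Omega>_comp: "p \<in> \<Omega> \<Longrightarrow> g \<in> isom \<Longrightarrow> p \<circ> g \<in> \<Omega>"
  using arf_isom[OF q0] by (simp add: \<Omega>)

lemma \<Omega>_comp_bij: "g \<in> isom \<Longrightarrow> bij_betw (\<lambda>p. p \<circ> g) \<Omega> \<Omega>"
  by (rule bij_betw_byWitness[of _ "\<lambda>p. p \<circ> inv_into UNIV g"]) (auto simp: \<Omega>_comp isom_inv comp_assoc fun_eq_iff)

lemma comp_inj: "g \<in> isom \<Longrightarrow> p \<circ> g = r \<circ> g \<longleftrightarrow> p = (r :: 'a \<Rightarrow> bool)"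
  by (auto simp: fun_eq_iff) (metis isom_f_inv)+

lemma two_transitive:
  assumes "p \<in> \<Omega>" "r \<in> \<Omega>" "p \<noteq> r" "p' \<in> \<Omega>" "r' \<in> \<Omega>" "p' \<noteq> r'"
  shows "\<exists>f\<in>isom. p \<circ> f = p' \<and> r \<circ> f = r'"
  using arf_two_transitive[OF q0] assms unfolding \<Omega> by blast

definition pairs :: "('a \<Rightarrow> bool) \<Rightarrow> ('a \<Rightarrow> bool) \<Rightarrow> ('a \<Rightarrow> bool) \<Rightarrow> ('a \<Rightarrow> bool) \<Rightarrow> ('a \<Rightarrow> 'a) set" where
  "pairs p w q r = {g \<in> isom. p \<circ> g = q \<and> w \<circ> g = r}"

lemma card_pairs_le:
  assumes "p \<in> \<Omega>" "w \<in> \<Omega>" "p \<noteq> w" "q \<in> \<Omega>" "r \<in> \<Omega>" "q \<noteq> r"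
    "p' \<in> \<Omega>" "w' \<in> \<Omega>" "p' \<noteq> w'" "q' \<in> \<Omega>" "r' \<in> \<Omega>" "q' \<noteq> r'"
  shows "card (pairs p w q r) \<le> card (pairs p' w' q' r')"
proof -
  obtain a where a: "a \<in> isom" "p' \<circ> a = p" "w' \<circ> a = w"
    using two_transitive assms by blast
  obtain b where b: "b \<in> isom" "q \<circ> b = q'" "r \<circ> b = r'"
    using two_transitive assms by blast
  show ?thesis
  proof (rule card_inj_on_le[of "\<lambda>g. a \<circ> g \<circ> b"])
    show "inj_on (\<lambda>g. a \<circ> g \<circ> b) (pairs p w q r)"
    proof (rule inj_onI)
      fix g h assume "a \<circ> g \<circ> b = a \<circ> h \<circ> b"
      then have "inv_into UNIV a \<circ> (a \<circ> g \<circ> b) \<circ> inv_into UNIV b = inv_into UNIV a \<circ> (a \<circ> h \<circ> b) \<circ> inv_into UNIV b"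
        by simp
      then show "g = h"
        using a(1) b(1) by (simp add: fun_eq_iff)
    qed
    show "(\<lambda>g. a \<circ> g \<circ> b) ` pairs p w q r \<subseteq> pairs p' w' q' r'"
    proof
      fix x assume "x \<in> (\<lambda>g. a \<circ> g \<circ> b) ` pairs p w q r"
      then obtain g where g: "g \<in> isom" "p \<circ> g = q" "w \<circ> g = r" "x = a \<circ> g \<circ> b"
        by (auto simp: pairs_def)
      have "p' \<circ> x = p' \<circ> a \<circ> g \<circ> b" "w' \<circ> x = w' \<circ> a \<circ> g \<circ> b"
        by (simp_all add: g o_assoc)
      then show "x \<in> pairs p' w' q' r'"
        using a b g by (simp add: pairs_def isom_comp)
    qed
  qed (auto simp: pairs_def)
qed

lemma card_pairs_eq:
  assumes "p \<in> \<Omega>" "w \<in> \<Omega>" "p \<noteq> w" "q \<in> \<Omega>" "r \<in> \<Omega>" "q \<noteq> r"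
    "p' \<in> \<Omega>" "w' \<in> \<Omega>" "p' \<noteq> w'" "q' \<in> \<Omega>" "r' \<in> \<Omega>" "q' \<noteq> r'"
  shows "card (pairs p w q r) = card (pairs p' w' q' r')"
  using card_pairs_le assms by (intro antisym) blast+

text \<open>Carries a relation on the class over to the group. An invariant relation yields a
  function constant under conjugation by \<open>H\<close>, so that commutativity applies to
  it.\<close>

definition kern :: "(('a \<Rightarrow> bool) \<times> ('a \<Rightarrow> bool)) set \<Rightarrow> ('a \<Rightarrow> 'a) \<Rightarrow> int" where
  "kern E g = (\<Sum>p\<in>\<Omega>. of_bool ((p, p \<circ> g) \<in> E))"

lemma kern_invariant:
  assumes E: "\<And>h p q. h \<in> H \<Longrightarrow> (p, q) \<in> E \<Longrightarrow> (p \<circ> h, q \<circ> h) \<in> E" and h: "h \<in> H" and g: "g \<in> isom"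
  shows "kern E (h \<circ> g \<circ> inv_into UNIV h) = kern E g"
proof -
  have hi: "h \<in> isom"
    using h H_isom by blast
  have "(p, p \<circ> (h \<circ> g \<circ> inv_into UNIV h)) \<in> E \<longleftrightarrow> (p \<circ> h, (p \<circ> h) \<circ> g) \<in> E" for p
  proof -
    have "(p \<circ> (h \<circ> g \<circ> inv_into UNIV h)) \<circ> h = p \<circ> h \<circ> g" "(p \<circ> h) \<circ> inv_into UNIV h = p" "((p \<circ> h) \<circ> g) \<circ> inv_into UNIV h = p \<circ> (h \<circ> g \<circ> inv_into UNIV h)"
      using hi by (auto simp: fun_eq_iff)
    then show ?thesis
      using E[OF h, of p "p \<circ> (h \<circ> g \<circ> inv_into UNIV h)"] E[OF H_inv[OF h], of "p \<circ> h" "(p \<circ> h) \<circ> g"] by metis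
  qed
  then have "kern E (h \<circ> g \<circ> inv_into UNIV h) = (\<Sum>p\<in>\<Omega>. of_bool ((p \<circ> h, (p \<circ> h) \<circ> g) \<in> E))"
    by (simp only: kern_def)
  also have "\<dots> = kern E g"
    unfolding kern_def by (rule sum.reindex_bij_betw[OF \<Omega>_comp_bij[OF hi]])
  finally show ?thesis .
qed

text \<open>On functions with sum zero, \<open>kern E\<close> acts like the matrix \<open>E\<close>, up to a constant.\<close>

lemma acts_kern:
  assumes two: "a \<in> \<Omega>" "b \<in> \<Omega>" "a \<noteq> b"
  shows "\<exists>\<beta>>0. \<forall>E f w. E \<subseteq> \<Omega> \<times> \<Omega> \<longrightarrow> (\<Sum>p\<in>\<Omega>. f p) = 0 \<longrightarrow> w \<in> \<Omega> \<longrightarrow>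
    acts (kern E) f w = \<beta> * (int (card \<Omega>) * (\<Sum>q\<in>\<Omega>. of_bool ((w, q) \<in> E) * f q) -
      (\<Sum>p\<in>\<Omega>. \<Sum>q\<in>\<Omega>. of_bool ((p, q) \<in> E) * f q))"
proof -
  define n where "n = card (pairs a b a b)"
  have n: "card (pairs p w q r) = n" if "p \<in> \<Omega>" "w \<in> \<Omega>" "p \<noteq> w" "q \<in> \<Omega>" "r \<in> \<Omega>" "q \<noteq> r" for p w q r
    unfolding n_def using that two by (intro card_pairs_eq)
  have "id \<in> pairs a b a b"
    by (simp add: pairs_def isom_id)
  then have "n > 0"
    unfolding n_def card_gt_0_iff by auto
  have split: "(\<Sum>g | g \<in> isom \<and> p \<circ> g = q. F (w \<circ> g)) = int n * (\<Sum>r\<in>\<Omega>-{q}. F r)"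
    if "p \<in> \<Omega>" "w \<in> \<Omega>" "p \<noteq> w" "q \<in> \<Omega>" for p w q and F :: "('a \<Rightarrow> bool) \<Rightarrow> int"
  proof -
    have "(\<Sum>g | g \<in> isom \<and> p \<circ> g = q. F (w \<circ> g)) =
        (\<Sum>r\<in>\<Omega>-{q}. \<Sum>g | g \<in> {g. g \<in> isom \<and> p \<circ> g = q} \<and> w \<circ> g = r. F (w \<circ> g))"
      using that comp_inj by (intro sum.group[symmetric]) (auto simp: \<Omega>_comp)
    also have "\<dots> = (\<Sum>r\<in>\<Omega>-{q}. \<Sum>g\<in>pairs p w q r. F r)"
      by (intro sum.cong) (auto simp: pairs_def)
    also have "\<dots> = (\<Sum>r\<in>\<Omega>-{q}. int n * F r)"
      using n that by (intro sum.cong) auto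
    finally show ?thesis
      by (simp add: sum_distrib_left)
  qed
  define N where "N = int (card \<Omega>)"
  have stab: "int (card {g \<in> isom. p \<circ> g = q}) = int n * (N - 1)" if "p \<in> \<Omega>" "q \<in> \<Omega>" for p q
  proof -
    obtain w where "w \<in> \<Omega>" "p \<noteq> w"
      using two by blast
    from split[OF that(1) this that(2), of "\<lambda>_. 1"] show ?thesis
      using that(2) card_gt_0_iff[of \<Omega>] by (auto simp: N_def card_Diff_singleton of_nat_diff)
  qed
  show ?thesis
  proof (intro exI[of _ "int n"] conjI allI impI)
    show "0 < int n"
      using \<open>n > 0\<close> by simp
    fix E :: "(('a \<Rightarrow> bool) \<times> ('a \<Rightarrow> bool)) set" and f :: "('a \<Rightarrow> bool) \<Rightarrow> int" and w
    assume E: "E \<subseteq> \<Omega> \<times> \<Omega>" and f: "(\<Sum>p\<in>\<Omega>. f p) = 0" and w: "w \<in> \<Omega>"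
    \<comment> \<open>For p = w all transporters send w to q. For p different from w, the images of
      w are spread evenly over the class without q, where f has sum \<open>- f q\<close>.\<close>
    have inner: "(\<Sum>g | g \<in> isom \<and> p \<circ> g = q. f (w \<circ> g)) = int n * (N * of_bool (p = w) - 1) * f q"
      if p: "p \<in> \<Omega>" "q \<in> \<Omega>" for p q
    proof (cases "p = w")
      case True
      then have "(\<Sum>g | g \<in> isom \<and> p \<circ> g = q. f (w \<circ> g)) = (\<Sum>g | g \<in> isom \<and> p \<circ> g = q. f q)"
        by (intro sum.cong) auto
      also have "\<dots> = int (card {g \<in> isom. p \<circ> g = q}) * f q"
        by simp
      also have "\<dots> = int n * (N * of_bool (p = w) - 1) * f q"
        unfolding stab[OF p] using True by simp
      finally show ?thesis .
    next
      case False
      have "(\<Sum>r\<in>\<Omega>-{q}. f r) = - f q"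
        using f p(2) by (simp add: sum_diff1)
      then show ?thesis
        using split[OF p(1) w False p(2), of f] False by simp
    qed
    have "acts (kern E) f w = (\<Sum>g\<in>isom. \<Sum>p\<in>\<Omega>. of_bool ((p, p \<circ> g) \<in> E) * f (w \<circ> g))"
      by (simp add: acts_def kern_def sum_distrib_right)
    also have "\<dots> = (\<Sum>p\<in>\<Omega>. \<Sum>g\<in>isom. of_bool ((p, p \<circ> g) \<in> E) * f (w \<circ> g))"
      by (rule sum.swap)
    also have "\<dots> = (\<Sum>p\<in>\<Omega>. \<Sum>q\<in>\<Omega>. \<Sum>g | g \<in> isom \<and> p \<circ> g = q. of_bool ((p, p \<circ> g) \<in> E) * f (w \<circ> g))"
      using \<Omega>_comp by (intro sum.cong[OF refl] sum.group[symmetric]) auto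
    also have "\<dots> = (\<Sum>p\<in>\<Omega>. \<Sum>q\<in>\<Omega>. of_bool ((p, q) \<in> E) * (\<Sum>g | g \<in> isom \<and> p \<circ> g = q. f (w \<circ> g)))"
      by (simp add: sum_distrib_left)
    also have "\<dots> = (\<Sum>p\<in>\<Omega>. \<Sum>q\<in>\<Omega>. of_bool ((p, q) \<in> E) * (int n * (N * of_bool (p = w) - 1) * f q))"
      using inner by (intro sum.cong) auto
    also have "\<dots> = (\<Sum>p\<in>\<Omega>. int n * (N * of_bool (p = w) - 1) * (\<Sum>q\<in>\<Omega>. of_bool ((p, q) \<in> E) * f q))"
      by (simp only: sum_distrib_left mult_ac)
    also have "\<dots> = (\<Sum>p\<in>\<Omega>. (if p = w then int n * N * (\<Sum>q\<in>\<Omega>. of_bool ((p, q) \<in> E) * f q) else 0) -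
        int n * (\<Sum>q\<in>\<Omega>. of_bool ((p, q) \<in> E) * f q))"
      by (intro sum.cong) (auto simp: algebra_simps)
    also have "\<dots> = int n * N * (\<Sum>q\<in>\<Omega>. of_bool ((w, q) \<in> E) * f q) -
        int n * (\<Sum>p\<in>\<Omega>. \<Sum>q\<in>\<Omega>. of_bool ((p, q) \<in> E) * f q)"
      using w by (simp add: sum_subtractf sum_distrib_left)
    finally show "acts (kern E) f w = int n * (int (card \<Omega>) * (\<Sum>q\<in>\<Omega>. of_bool ((w, q) \<in> E) * f q) -
      (\<Sum>p\<in>\<Omega>. \<Sum>q\<in>\<Omega>. of_bool ((p, q) \<in> E) * f q))"
      by (simp add: N_def algebra_simps)
  qed
qed

text \<open>The diagonal kernel of \<open>A\<close> and the kernel \<open>E\<close> commute; applied to the difference of two point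
  masses in \<open>B\<close> this shows that the columns of \<open>E\<close> are equal.\<close>

lemma block_constant:
  assumes AB: "A \<union> B = \<Omega>" "A \<inter> B = {}"
    and A: "\<And>h p. h \<in> H \<Longrightarrow> p \<in> A \<Longrightarrow> p \<circ> h \<in> A"
    and E: "E \<subseteq> A \<times> B" "\<And>h p q. h \<in> H \<Longrightarrow> (p, q) \<in> E \<Longrightarrow> (p \<circ> h, q \<circ> h) \<in> E"
    and a: "a \<in> A" and b: "b \<in> B" "b' \<in> B"
  shows "(a, b) \<in> E \<longleftrightarrow> (a, b') \<in> E"
proof (cases "b = b'")
  case False
  have in\<Omega>: "a \<in> \<Omega>" "b \<in> \<Omega>" "b' \<in> \<Omega>" "a \<noteq> b"
    using AB a b by auto
  obtain \<beta> where \<beta>: "\<beta> > 0" and act': "\<forall>E f w. E \<subseteq> \<Omega> \<times> \<Omega> \<longrightarrow> (\<Sum>p\<in>\<Omega>. f p) = 0 \<longrightarrow> w \<in> \<Omega> \<longrightarrow>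
    acts (kern E) f w = \<beta> * (int (card \<Omega>) * (\<Sum>q\<in>\<Omega>. of_bool ((w, q) \<in> E) * f q) -
      (\<Sum>p\<in>\<Omega>. \<Sum>q\<in>\<Omega>. of_bool ((p, q) \<in> E) * f q))"
    using acts_kern[OF in\<Omega>(1,2,4)] by (elim exE conjE)
  note act = act'[rule_format]
  \<comment> \<open>The other invariant relation, to be compared with \<open>E\<close>: as a matrix
    it is the projection onto functions supported on \<open>A\<close>.\<close>
  define L where "L = {(p, p) | p. p \<in> A}"
  have L\<Omega>: "L \<subseteq> \<Omega> \<times> \<Omega>" and E\<Omega>: "E \<subseteq> \<Omega> \<times> \<Omega>"
    using AB E by (auto simp: L_def)
  have Lsum: "(\<Sum>q\<in>\<Omega>. of_bool ((w, q) \<in> L) * f q) = of_bool (w \<in> A) * (f w :: int)" for w f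
  proof -
    have "(\<Sum>q\<in>\<Omega>. of_bool ((w, q) \<in> L) * f q) = (\<Sum>q\<in>\<Omega>. if q = w then of_bool (w \<in> A) * f w else 0)"
      by (intro sum.cong) (auto simp: L_def)
    then show ?thesis
      using AB by auto
  qed
  define f :: "('a \<Rightarrow> bool) \<Rightarrow> int" where "f p = of_bool (p = b) - of_bool (p = b')" for p
  have f0: "(\<Sum>p\<in>\<Omega>. f p) = 0"
    using in\<Omega> by (simp add: f_def sum_subtractf of_bool_def)
  have fA: "f p = 0" if "p \<in> A" for p
    using that b AB by (auto simp: f_def)
  define c where "c p = (\<Sum>q\<in>\<Omega>. of_bool ((p, q) \<in> E) * f q)" for p
  have c: "c p = of_bool ((p, b) \<in> E) - of_bool ((p, b') \<in> E)" for p
  proof -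
    have "c p = (\<Sum>q\<in>\<Omega>. (if q = b then of_bool ((p, b) \<in> E) else 0) - (if q = b' then of_bool ((p, b') \<in> E) else 0))"
      unfolding c_def by (intro sum.cong) (auto simp: f_def)
    then show ?thesis
      using in\<Omega> by (simp add: sum_subtractf)
  qed
  define s where "s = (\<Sum>p\<in>\<Omega>. c p)"
  define k where "k = acts (kern E) f"
  have k: "k w = \<beta> * (int (card \<Omega>) * c w - s)" if "w \<in> \<Omega>" for w
    unfolding k_def c_def s_def by (rule act[OF E\<Omega> f0 that])
  have k0: "(\<Sum>p\<in>\<Omega>. k p) = 0"
    using k by (simp add: sum_subtractf sum_distrib_left[symmetric] s_def)
  have fL: "acts (kern L) f w = 0" if "w \<in> \<Omega>" for w
  proof -
    have "of_bool (p \<in> A) * f p = 0" for p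
      using fA by auto
    then show ?thesis
      using act[OF L\<Omega> f0 that] by (simp only: Lsum) simp
  qed
  then have z: "acts (kern E) (acts (kern L) f) b = 0"
    using \<Omega>_comp in\<Omega> by (subst acts_def) simp
  have bA: "b \<notin> A"
    using AB b by auto
  \<comment> \<open>At b, outside \<open>A\<close>, only the correction term survives and shows that
    k has sum 0 over \<open>A\<close>. With this the same formula at points of \<open>A\<close>
    isolates k.\<close>
  have "acts (kern L) k b = \<beta> * (int (card \<Omega>) * (of_bool (b \<in> A) * k b) - (\<Sum>p\<in>\<Omega>. of_bool (p \<in> A) * k p))"
    using act[OF L\<Omega> k0 in\<Omega>(2)] by (simp only: Lsum)
  moreover have "acts (kern L) k b = acts (kern E) (acts (kern L) f) b"
    unfolding k_def using A E by (intro acts_commute kern_invariant) (auto simp: L_def)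
  ultimately have kA: "(\<Sum>p\<in>\<Omega>. of_bool (p \<in> A) * k p) = 0"
    using z \<beta> bA by simp
  have kw: "k w = 0" if w: "w \<in> A" for w
  proof -
    have w\<Omega>: "w \<in> \<Omega>"
      using w AB by blast
    have "acts (kern L) k w = acts (kern E) (acts (kern L) f) w"
      unfolding k_def using A E by (intro acts_commute kern_invariant) (auto simp: L_def)
    also have "\<dots> = 0"
      using \<Omega>_comp[OF w\<Omega>] fL by (simp add: acts_def[of "kern E" "acts (kern L) f"])
    finally have "\<beta> * (int (card \<Omega>) * k w) = 0"
      using act[OF L\<Omega> k0 w\<Omega>] w unfolding Lsum kA by simp
    moreover have "card \<Omega> \<noteq> 0"
      using w\<Omega> by auto
    ultimately show ?thesis
      using \<beta> by simp
  qed
  have cs: "int (card \<Omega>) * c w = s" if "w \<in> A" for w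
    using kw[OF that] k[of w] \<beta> that AB by auto
  \<comment> \<open>Rows outside \<open>A\<close> are empty. Summing the equation \<open>cs\<close>
    over \<open>A\<close> equates |Omega| s with |A| s, and \<open>A\<close> is smaller since it
    misses b.\<close>
  have "s = (\<Sum>p\<in>A. c p)"
    unfolding s_def using AB E by (intro sum.mono_neutral_right) (auto simp: c)
  then have "int (card \<Omega>) * s = (\<Sum>p\<in>A. int (card \<Omega>) * c p)"
    by (simp add: sum_distrib_left)
  also have "\<dots> = int (card A) * s"
    using cs by simp
  finally have "s = 0 \<or> card \<Omega> = card A"
    by auto
  moreover have "card A < card \<Omega>"
    using AB b in\<Omega> by (intro psubset_card_mono) auto
  ultimately have "c a = 0"
    using cs[OF a] in\<Omega> by auto
  then show ?thesis
    by (auto simp: c split: if_splits)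
qed simp

text \<open>The orbit of (a, b) is an invariant relation between A and B.
  \<open>block_constant\<close>, applied to it and to its converse, spreads it along the row of a
  and then along every column.\<close>

lemma transitive_on_product:
  assumes AB: "A \<union> B = \<Omega>" "A \<inter> B = {}"
    and A: "\<And>h p. h \<in> H \<Longrightarrow> p \<in> A \<Longrightarrow> p \<circ> h \<in> A"
    and ab: "a \<in> A" "a' \<in> A" "b \<in> B" "b' \<in> B"
  shows "\<exists>h\<in>H. a \<circ> h = a' \<and> b \<circ> h = b'"
proof -
  have B: "p \<circ> h \<in> B" if h: "h \<in> H" and p: "p \<in> B" for h p
  proof (rule ccontr)
    have hi: "h \<in> isom"
      using h H_isom by blast
    assume "p \<circ> h \<notin> B"
    then have "p \<circ> h \<in> A"
      using \<Omega>_comp[of p h] AB p hi by blast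
    then have "p \<circ> h \<circ> inv_into UNIV h \<in> A"
      using A H_inv[OF h] by blast
    moreover have "p \<circ> h \<circ> inv_into UNIV h = p"
      using hi by (simp add: fun_eq_iff)
    ultimately show False
      using AB p by auto
  qed
  define E where "E = {(a \<circ> h, b \<circ> h) | h. h \<in> H}"
  have E: "E \<subseteq> A \<times> B" "(p \<circ> h, q \<circ> h) \<in> E" if "h \<in> H" "(p, q) \<in> E" for h p q
    using that A B ab H_comp by (auto simp: E_def comp_assoc)
  have "E \<subseteq> A \<times> B"
    using A B ab by (auto simp: E_def)
  have "(a, b) \<in> E"
    using H_id by (force simp: E_def intro: exI[of _ id])
  then have 1: "(a, b') \<in> E"
    using block_constant[OF AB A \<open>E \<subseteq> A \<times> B\<close> E(2) ab(1,3,4)] by blast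
  have "(b', a) \<in> E\<inverse> \<longleftrightarrow> (b', a') \<in> E\<inverse>"
    using AB B E(2) \<open>E \<subseteq> A \<times> B\<close> ab by (intro block_constant[of B A "E\<inverse>"]) auto
  then have "(a', b') \<in> E"
    using 1 by simp
  then show ?thesis
    by (auto simp: E_def)
qed

end

text \<open>If \<open>H\<close> were transitive on every class, the sum of signs of a form over S
  would depend only on its class, hence take two values. Fourier inversion over all forms recovers
  the indicator of S, and at nonzero x it comes out independent of x.\<close>

lemma intransitive_on_forms:
  assumes S: "\<And>h v. h \<in> H \<Longrightarrow> v \<in> S \<Longrightarrow> h v \<in> S" and uv: "u \<in> S" "u \<noteq> 0" "v \<notin> S" "v \<noteq> 0"
  shows "\<exists>q p. quad q \<and> p \<in> arf q \<and> (\<forall>h\<in>H. q \<circ> h \<noteq> p)"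
proof (rule ccontr)
  assume "\<not> ?thesis"
  then have trans: "\<exists>h\<in>H. q \<circ> h = p" if "quad q" "p \<in> arf q" for p q
    using that by blast
  obtain q0 where q0: "quad q0"
    using quad_exists by blast
  define s where "s q = (\<Sum>w\<in>S. sg (q w))" for q
  have s_comp: "s (q \<circ> h) = s q" if h: "h \<in> H" for q h
  proof -
    have hi: "h \<in> isom"
      using h H_isom by blast
    have "bij_betw h S S"
      using S[OF h] S[OF H_inv[OF h]] hi by (intro bij_betw_byWitness[of _ "inv_into UNIV h"]) auto
    then show ?thesis
      unfolding s_def o_def by (rule sum.reindex_bij_betw)
  qed
  have s_class: "s p = s q" if "quad q" "p \<in> arf q" for p q
    using trans[OF that] s_comp by blast
  have "\<exists>s1. \<forall>c. q0 c \<longrightarrow> s (qc q0 c) = s1"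
  proof (cases "\<exists>d. q0 d")
    case True
    then obtain d where d: "q0 d"
      by blast
    have "s (qc q0 c) = s (qc q0 d)" if "q0 c" for c
    proof (rule s_class)
      show "quad (qc q0 d)"
        using q0 by (rule quad_qc)
      have "\<not> qc q0 d (d + c)"
        using that d q0 by (auto simp: qc_apply quadD pr_add2)
      moreover have "qc q0 c = qc (qc q0 d) (d + c)"
        by (simp add: qc_qc)
      ultimately show "qc q0 c \<in> arf (qc q0 d)"
        by (auto simp: arf_def)
    qed
    then show ?thesis
      by blast
  qed auto
  then obtain s1 where s1: "\<And>c. q0 c \<Longrightarrow> s (qc q0 c) = s1"
    by blast
  define s0 where "s0 = s q0"
  have s0: "s (qc q0 c) = s0" if "\<not> q0 c" for c
    unfolding s0_def using that by (intro s_class[OF q0]) (auto simp: arf_def)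
  define M where "M = int (card (UNIV :: 'a set))"
  define \<Gamma> where "\<Gamma> = (\<Sum>c\<in>UNIV. sg (q0 c))"
  have key: "2 * (M * of_bool (x \<in> S)) = (s0 - s1) * \<Gamma>" if x: "x \<noteq> 0" for x
  proof -
    have "(\<Sum>c\<in>UNIV. s (qc q0 c) * sg (pr c x)) = (\<Sum>c\<in>UNIV. \<Sum>w\<in>S. sg (q0 w) * sg (pr c (w + x)))"
      unfolding s_def sum_distrib_right by (intro sum.cong refl) (auto simp: qc_def pr_add2 sg_def)
    also have "\<dots> = (\<Sum>w\<in>S. sg (q0 w) * (\<Sum>c\<in>UNIV. sg (pr c (w + x))))"
      by (subst sum.swap) (simp add: sum_distrib_left)
    also have "\<dots> = (\<Sum>w\<in>S. if w = x then sg (q0 x) * M else 0)"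
      by (intro sum.cong) (auto simp: sum_sg M_def add_eq_0)
    also have "\<dots> = sg (q0 x) * (M * of_bool (x \<in> S))"
      by simp
    finally have 1: "(\<Sum>c\<in>UNIV. s (qc q0 c) * sg (pr c x)) = sg (q0 x) * (M * of_bool (x \<in> S))" .
    \<comment> \<open>Interpolation: \<open>q0 c\<close> decides the class of
      \<open>qc q0 c\<close>, so s is half of (s0 + s1) + (s0 - s1) times the sign of
      \<open>q0 c\<close>.\<close>
    have "2 * (s (qc q0 c) * sg (pr c x)) = (s0 + s1) * sg (pr c x) + (s0 - s1) * sg (q0 c \<noteq> pr c x)" for c
      using s0[of c] s1[of c] by (cases "q0 c"; cases "pr c x") (auto simp: algebra_simps)
    then have "2 * (\<Sum>c\<in>UNIV. s (qc q0 c) * sg (pr c x)) =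
        (\<Sum>c\<in>UNIV. (s0 + s1) * sg (pr c x) + (s0 - s1) * sg (q0 c \<noteq> pr c x))"
      by (simp add: sum_distrib_left)
    also have "\<dots> = (s0 + s1) * (\<Sum>c\<in>UNIV. sg (pr c x)) + (s0 - s1) * (\<Sum>c\<in>UNIV. sg (q0 c \<noteq> pr c x))"
      by (simp add: sum.distrib sum_distrib_left)
    also have "(\<Sum>c\<in>UNIV. sg (pr c x)) = 0"
      using x by (simp add: sum_sg)
    also have "(\<Sum>c\<in>UNIV. sg (q0 c \<noteq> pr c x)) = (\<Sum>c\<in>UNIV. sg (q0 (c + x) \<noteq> pr (c + x) x))"
      by (rule sum_translate[symmetric])
    also have "\<dots> = sg (q0 x) * \<Gamma>"
      unfolding \<Gamma>_def sum_distrib_left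
      by (intro sum.cong refl) (auto simp: quadD[OF q0] pr_add sg_def)
    finally have "2 * (sg (q0 x) * (M * of_bool (x \<in> S))) = (s0 - s1) * (sg (q0 x) * \<Gamma>)"
      unfolding 1 by simp
    then show ?thesis
      by (cases "q0 x") (auto simp: algebra_simps)
  qed
  have "2 * M = 0"
    using key[OF uv(2)] key[OF uv(4)] uv by simp
  then show False
    by (simp add: M_def)
qed

theorem transitive_on_nonzero:
  assumes "u \<noteq> 0" "v \<noteq> 0"
  shows "\<exists>h\<in>H. h u = v"
proof (rule ccontr)
  assume no: "\<not> ?thesis"
  define S where "S = {h u | h. h \<in> H}"
  have "h w \<in> S" if "h \<in> H" "w \<in> S" for h w
    using that H_comp[of h] by (auto simp: S_def) (metis comp_apply)
  moreover have "u \<in> S" "v \<notin> S"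
    using no H_id by (force simp: S_def intro: exI[of _ id])+
  ultimately obtain q p where q: "quad q" and p: "p \<in> arf q" "\<And>h. h \<in> H \<Longrightarrow> q \<circ> h \<noteq> p"
    using intransitive_on_forms[of S u v] assms by blast
  define A where "A = {q \<circ> h | h. h \<in> H}"
  define B where "B = arf q - A"
  have A\<Omega>: "A \<subseteq> arf q"
    using arf_isom[OF q arf_refl[OF q]] H_isom by (auto simp: A_def)
  then have AB: "A \<union> B = arf q" "A \<inter> B = {}"
    by (auto simp: B_def)
  have A: "r \<circ> h \<in> A" if "h \<in> H" "r \<in> A" for h r
    using that H_comp by (auto simp: A_def comp_assoc)
  have "q \<in> A" "p \<in> B"
    using p H_id by (force simp: A_def B_def intro: exI[of _ id])+
  define N where "N = {c. c \<noteq> 0 \<and> (\<forall>r\<in>A. r \<circ> tv c \<in> A)}"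
  have outside: "\<exists>r\<in>A. qc r c \<in> B" if c: "c \<notin> N" "c \<noteq> 0" for c
  proof -
    obtain r where r: "r \<in> A" "r \<circ> tv c \<notin> A"
      using c by (auto simp: N_def)
    then have "quad r"
      using A\<Omega> quad_arf[OF q] by blast
    then have "r \<circ> tv c = qc r c"
      using r quad_tv[of r c] by (auto split: if_splits)
    then show ?thesis
      using r A\<Omega> arf_isom[OF q _ isom_tv, of r c] by (auto simp: B_def)
  qed
  \<comment> \<open>A nonmember c is recovered from the pair \<open>r\<close>, \<open>qc r c\<close>
    in A x B, on which \<open>H\<close> is transitive.\<close>
  have orb: "\<exists>h\<in>H. h c = c'" if c: "c \<notin> N" "c \<noteq> 0" and c': "c' \<notin> N" "c' \<noteq> 0" for c c'
  proof -
    obtain r where r: "r \<in> A" "qc r c \<in> B"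
      using outside[OF c] by blast
    obtain r' where r': "r' \<in> A" "qc r' c' \<in> B"
      using outside[OF c'] by blast
    obtain h where h: "h \<in> H" "r \<circ> h = r'" "qc r c \<circ> h = qc r' c'"
      using transitive_on_product[OF q refl AB A r(1) r'(1) r(2) r'(2)] by blast
    have "h \<in> isom"
      using h H_isom by blast
    then have "qc r' (inv_into UNIV h c) = qc r' c'"
      using qc_isom[of h r c] h by simp
    then have "inv_into UNIV h c = c'"
      by (simp add: qc_inj)
    then show ?thesis
      using H_inv[OF h(1)] by blast
  qed
  interpret commuting pr H N
  proof
    show "H \<subseteq> isom"
      by (rule H_isom)
    show "\<exists>h\<in>H. \<exists>h'\<in>H. tvs (map h' bs @ map h as) = tvs (as @ bs)" for as bs
      by (rule tp_commute)
    show "0 \<notin> N"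
      by (simp add: N_def)
    show "2 ^ 8 \<le> card (UNIV :: 'a set)"
      by (rule card_ge)
    have imp: "h a \<in> N" if h: "h \<in> H" and a: "a \<in> N" for h a
    proof -
      have hi: "h \<in> isom"
        using h H_isom by blast
      have "r \<circ> tv (h a) \<in> A" if "r \<in> A" for r
      proof -
        have "((r \<circ> h) \<circ> tv a) \<circ> inv_into UNIV h \<in> A"
          using A[OF H_inv[OF h]] A[OF h that] a by (auto simp: N_def)
        then show ?thesis
          by (simp add: isom_conj_tv[OF hi, symmetric] o_assoc)
      qed
      moreover have "h a \<noteq> 0"
        using a hi isom_inj[OF hi, of a 0] by (auto simp: N_def)
      ultimately show ?thesis
        by (simp add: N_def)
    qed
    show "h a \<in> N \<longleftrightarrow> a \<in> N" if "h \<in> H" for h a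
      using imp[OF that, of a] imp[OF H_inv[OF that], of "h a"] H_isom that by auto
    show "a + b \<in> N" if ab: "a \<in> N" "b \<in> N" "pr a b" for a b
    proof -
      have "r \<circ> tv (a + b) \<in> A" if "r \<in> A" for r
      proof -
        have "tv (a + b) = tv (tv a b)"
          using ab by (simp add: tv_def ac_simps)
        also have "\<dots> = tv a \<circ> tv b \<circ> tv a"
          using isom_conj_tv[OF isom_tv, of a b] by simp
        finally have "r \<circ> tv (a + b) = ((r \<circ> tv a) \<circ> tv b) \<circ> tv a"
          by (simp add: o_assoc)
        then show ?thesis
          using that ab by (simp add: N_def)
      qed
      moreover have "a + b \<noteq> 0"
        using ab by (auto simp: add_eq_0)
      ultimately show ?thesis
        by (simp add: N_def)
    qed
  qed
  show False
  proof (rule transitive_complement_impossible)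
    show "N \<noteq> {}"
      using orb[of u v] assms no by blast
    obtain c where c: "p = qc q c" "\<not> q c"
      using p by (auto simp: arf_def)
    then have "q \<circ> tv c = p"
      by (simp add: quad_tv[OF q])
    then have "c \<notin> N"
      using \<open>q \<in> A\<close> \<open>p \<in> B\<close> AB by (auto simp: N_def)
    moreover have "c \<noteq> 0"
      using c \<open>q \<in> A\<close> \<open>p \<in> B\<close> AB by auto
    ultimately show "N \<noteq> UNIV - {0}"
      by blast
  qed (use orb in blast)
qed

end

section \<open>Matrix representations\<close>

text \<open>Matrices of all sizes form one type without a neutral element of addition, so \<open>sum\<close> is not available.\<close>

definition msum :: "nat \<Rightarrow> nat \<Rightarrow> ('b \<Rightarrow> complex mat) \<Rightarrow> 'b set \<Rightarrow> complex mat" where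
  "msum n m f S = Matrix.mat n m (\<lambda>ij. \<Sum>s\<in>S. f s $$ ij)"

lemma msum_carrier [simp]: "msum n m f S \<in> carrier_mat n m"
  by (simp add: msum_def)

lemma msum_dim [simp]: "dim_row (msum n m f S) = n" "dim_col (msum n m f S) = m"
  by (simp_all add: msum_def)

lemma msum_cong:
  assumes "\<And>s. s \<in> S \<Longrightarrow> f s = g s"
  shows "msum n m f S = msum n m g S"
  using assms by (auto simp: msum_def intro!: eq_matI)

lemma msum_mult:
  assumes "\<And>s. s \<in> S \<Longrightarrow> f s \<in> carrier_mat n m" "X \<in> carrier_mat m k"
  shows "msum n m f S * X = msum n k (\<lambda>s. f s * X) S"
proof (rule eq_matI)
  fix i j assume "i < dim_row (msum n k (\<lambda>s. f s * X) S)" "j < dim_col (msum n k (\<lambda>s. f s * X) S)"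
  then have ij: "i < n" "j < k"
    by auto
  have "(msum n m f S * X) $$ (i, j) = (\<Sum>l<m. (\<Sum>s\<in>S. f s $$ (i, l)) * X $$ (l, j))"
    using ij assms(2) by (simp add: scalar_prod_def msum_def atLeast0LessThan)
  also have "\<dots> = (\<Sum>s\<in>S. \<Sum>l<m. f s $$ (i, l) * X $$ (l, j))"
    unfolding sum_distrib_right by (rule sum.swap)
  also have "\<dots> = (\<Sum>s\<in>S. (f s * X) $$ (i, j))"
  proof (rule sum.cong[OF refl])
    fix s assume "s \<in> S"
    then show "(\<Sum>l<m. f s $$ (i, l) * X $$ (l, j)) = (f s * X) $$ (i, j)"
      using assms(1)[of s] ij assms(2) by (auto simp: scalar_prod_def atLeast0LessThan)
  qed
  finally show "(msum n m f S * X) $$ (i, j) = msum n k (\<lambda>s. f s * X) S $$ (i, j)"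
    using ij by (simp add: msum_def)
qed (use assms in auto)

lemma mult_msum:
  assumes "\<And>s. s \<in> S \<Longrightarrow> f s \<in> carrier_mat m k" "X \<in> carrier_mat n m"
  shows "X * msum m k f S = msum n k (\<lambda>s. X * f s) S"
proof (rule eq_matI)
  fix i j assume "i < dim_row (msum n k (\<lambda>s. X * f s) S)" "j < dim_col (msum n k (\<lambda>s. X * f s) S)"
  then have ij: "i < n" "j < k"
    by auto
  have "(X * msum m k f S) $$ (i, j) = (\<Sum>l<m. X $$ (i, l) * (\<Sum>s\<in>S. f s $$ (l, j)))"
    using ij assms(2) by (simp add: scalar_prod_def msum_def atLeast0LessThan)
  also have "\<dots> = (\<Sum>s\<in>S. \<Sum>l<m. X $$ (i, l) * f s $$ (l, j))"
    unfolding sum_distrib_left by (rule sum.swap)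
  also have "\<dots> = (\<Sum>s\<in>S. (X * f s) $$ (i, j))"
  proof (rule sum.cong[OF refl])
    fix s assume "s \<in> S"
    then show "(\<Sum>l<m. X $$ (i, l) * f s $$ (l, j)) = (X * f s) $$ (i, j)"
      using assms(1)[of s] ij assms(2) by (auto simp: scalar_prod_def atLeast0LessThan)
  qed
  finally show "(X * msum m k f S) $$ (i, j) = msum n k (\<lambda>s. X * f s) S $$ (i, j)"
    using ij by (simp add: msum_def)
qed (use assms in auto)

lemma msum_reindex:
  assumes "bij_betw p S S"
  shows "msum n m (\<lambda>s. f (p s)) S = msum n m f S"
  unfolding msum_def using sum.reindex_bij_betw[OF assms, of "\<lambda>s. f s $$ _"] by (auto intro!: eq_matI)

text \<open>Pad both matrices with zeros to size r. A one-sided inverse of a square matrix is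
  two-sided, but the product in the other order has a zero row at index N.\<close>

lemma left_inverse_dim_le:
  assumes A: "(A :: complex mat) \<in> carrier_mat N r" and B: "B \<in> carrier_mat r N" and BA: "B * A = 1\<^sub>m r"
  shows "r \<le> N"
proof (rule ccontr)
  assume "\<not> r \<le> N"
  define A' where "A' = Matrix.mat r r (\<lambda>(i, j). if i < N then A $$ (i, j) else (0 :: complex))"
  define B' where "B' = Matrix.mat r r (\<lambda>(i, j). if j < N then B $$ (i, j) else 0)"
  have "B' * A' = 1\<^sub>m r"
  proof (rule eq_matI)
    fix i j assume "i < dim_row (1\<^sub>m r :: complex mat)" "j < dim_col (1\<^sub>m r :: complex mat)"
    then have ij: "i < r" "j < r"
      by auto
    have "(B' * A') $$ (i, j) = (\<Sum>l<r. if l < N then B $$ (i, l) * A $$ (l, j) else 0)"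
      using ij by (auto simp: scalar_prod_def A'_def B'_def atLeast0LessThan intro!: sum.cong)
    also have "\<dots> = (\<Sum>l<N. B $$ (i, l) * A $$ (l, j))"
      using \<open>\<not> r \<le> N\<close> by (intro sum.mono_neutral_cong_right) auto
    also have "\<dots> = (B * A) $$ (i, j)"
      using ij A B by (auto simp: scalar_prod_def atLeast0LessThan)
    finally show "(B' * A') $$ (i, j) = 1\<^sub>m r $$ (i, j)"
      using BA by simp
  qed (auto simp: A'_def B'_def)
  then have "A' * B' = 1\<^sub>m r"
    by (intro mat_mult_left_right_inverse[of B']) (auto simp: A'_def B'_def)
  moreover have "(A' * B') $$ (N, N) = 0"
    using \<open>\<not> r \<le> N\<close> by (auto simp: scalar_prod_def A'_def B'_def)
  ultimately show False
    using \<open>\<not> r \<le> N\<close> by simp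
qed

lemma smult_mat_vec:
  fixes M :: "complex mat"
  assumes "M \<in> carrier_mat n m" "x \<in> carrier_vec m"
  shows "(c \<cdot>\<^sub>m M) *\<^sub>v x = c \<cdot>\<^sub>v (M *\<^sub>v x)"
  using assms by (intro eq_vecI) (auto simp: scalar_prod_def sum_distrib_left mult.assoc)

text \<open>A basis in matrix form: the columns of A lie in W and B reads off coordinates. Take r
  maximal; a vector of W not reproduced by A B would allow one more column and row.\<close>

lemma subspace_factor:
  fixes W :: "complex Matrix.vec set"
  assumes W: "W \<subseteq> carrier_vec N" and W0: "0\<^sub>v N \<in> W"
    and add: "\<And>v w. v \<in> W \<Longrightarrow> w \<in> W \<Longrightarrow> v + w \<in> W"
    and smult: "\<And>a v. v \<in> W \<Longrightarrow> a \<cdot>\<^sub>v v \<in> W"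
  obtains r A B where "A \<in> carrier_mat N r" "B \<in> carrier_mat r N" "B * A = 1\<^sub>m r"
    "\<And>x. x \<in> carrier_vec r \<Longrightarrow> A *\<^sub>v x \<in> W" "\<And>w. w \<in> W \<Longrightarrow> A *\<^sub>v (B *\<^sub>v w) = w"
proof -
  define P where "P r \<longleftrightarrow> (\<exists>A B. A \<in> carrier_mat N r \<and> B \<in> carrier_mat r N \<and> B * A = 1\<^sub>m r \<and>
    (\<forall>x\<in>carrier_vec r. A *\<^sub>v x \<in> W))" for r
  have bound: "r \<le> N" if "P r" for r
    using that left_inverse_dim_le unfolding P_def by blast
  have "P 0"
    unfolding P_def
  proof (intro exI conjI ballI)
    show "0\<^sub>m N 0 \<in> carrier_mat N 0" "0\<^sub>m 0 N \<in> carrier_mat 0 N"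
      by auto
    show "0\<^sub>m 0 N * 0\<^sub>m N 0 = (1\<^sub>m 0 :: complex mat)"
      by (intro eq_matI) auto
    fix x :: "complex Matrix.vec" assume "x \<in> carrier_vec 0"
    then have "0\<^sub>m N 0 *\<^sub>v x = 0\<^sub>v N"
      by (intro eq_vecI) (auto simp: scalar_prod_def)
    then show "0\<^sub>m N 0 *\<^sub>v x \<in> W"
      using W0 by simp
  qed
  define r where "r = (GREATEST r. P r)"
  have "P r"
    unfolding r_def by (rule GreatestI_nat[of P 0 N]) (use \<open>P 0\<close> bound in auto)
  have max: "r' \<le> r" if "P r'" for r'
    unfolding r_def using that bound by (intro Greatest_le_nat) auto
  obtain A B where A: "A \<in> carrier_mat N r" and B: "B \<in> carrier_mat r N" and BA: "B * A = 1\<^sub>m r"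
    and AW: "\<And>x. x \<in> carrier_vec r \<Longrightarrow> A *\<^sub>v x \<in> W"
    using \<open>P r\<close> unfolding P_def by blast
  have "A *\<^sub>v (B *\<^sub>v w) = w" if w: "w \<in> W" for w
  proof (rule ccontr)
    assume ne: "A *\<^sub>v (B *\<^sub>v w) \<noteq> w"
    have wc: "w \<in> carrier_vec N"
      using w W by blast
    define u where "u = w + (-1) \<cdot>\<^sub>v (A *\<^sub>v (B *\<^sub>v w))"
    have ABw: "A *\<^sub>v (B *\<^sub>v w) \<in> carrier_vec N"
      using A B wc by (intro mult_mat_vec_carrier)
    have uW: "u \<in> W"
      unfolding u_def using w B wc by (intro add smult AW mult_mat_vec_carrier)
    have uc: "u \<in> carrier_vec N"
      using uW W by blast
    obtain k where k: "k < N" "u $ k \<noteq> 0"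
    proof -
      have "\<exists>k<N. (A *\<^sub>v (B *\<^sub>v w)) $ k \<noteq> w $ k"
        using ne ABw wc by (metis carrier_vecD eq_vecI)
      then obtain k where k: "k < N" "(A *\<^sub>v (B *\<^sub>v w)) $ k \<noteq> w $ k"
        by blast
      have "u $ k = w $ k - (A *\<^sub>v (B *\<^sub>v w)) $ k"
        unfolding u_def using A k(1) by simp
      then show thesis
        using that k by simp
    qed
    have Bu: "B *\<^sub>v u = 0\<^sub>v r"
    proof -
      have "B *\<^sub>v (A *\<^sub>v (B *\<^sub>v w)) = (B * A) *\<^sub>v (B *\<^sub>v w)"
        using A B wc by (subst assoc_mult_mat_vec[of B r N A r]) auto
      then have "B *\<^sub>v (A *\<^sub>v (B *\<^sub>v w)) = B *\<^sub>v w"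
        using B wc by (simp add: BA)
      then show ?thesis
        unfolding u_def using B wc ABw
        by (subst mult_add_distrib_mat_vec[of B r N]) (auto simp: mult_mat_vec intro!: eq_vecI)
    qed
    define D where "D = 1\<^sub>m N + (-1) \<cdot>\<^sub>m (A * B)"
    have D: "D \<in> carrier_mat N N"
      using A B by (simp add: D_def)
    have DA: "D * A = 0\<^sub>m N r"
    proof -
      have "D * A = A + (-1) \<cdot>\<^sub>m (A * B * A)"
        unfolding D_def using A B by (subst add_mult_distrib_mat[of _ N N])
          (auto simp: mult_smult_assoc_mat[of "A * B" N N A r])
      also have "A * B * A = A"
        using A B BA by simp
      finally show ?thesis
        using A by (auto intro!: eq_matI)
    qed
    have Du: "D *\<^sub>v u = u"
    proof -
      have "D *\<^sub>v u = u + (-1) \<cdot>\<^sub>v (A *\<^sub>v (B *\<^sub>v u))"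
        unfolding D_def using A B uc
        by (subst add_mult_distrib_mat_vec[of _ N N]) (auto simp: smult_mat_vec[of "A * B" N N u])
      then show ?thesis
        using A uc by (auto simp: Bu scalar_prod_def intro!: eq_vecI)
    qed
    define A' where "A' = Matrix.mat N (Suc r) (\<lambda>(i, j). if j < r then A $$ (i, j) else u $ i)"
    \<comment> \<open>D annihilates the columns of A and fixes u, so its row k divided by entry k of
      u is the coordinate functional for the new column.\<close>
    define B' where "B' = Matrix.mat (Suc r) N (\<lambda>(i, j). if i < r then B $$ (i, j) else D $$ (k, j) / u $ k)"
    have "B' * A' = 1\<^sub>m (Suc r)"
    proof (rule eq_matI)
      fix i j assume "i < dim_row (1\<^sub>m (Suc r) :: complex mat)" "j < dim_col (1\<^sub>m (Suc r) :: complex mat)"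
      then have ij: "i < Suc r" "j < Suc r"
        by auto
      have e: "(B' * A') $$ (i, j) = (\<Sum>l<N. (if i < r then B $$ (i, l) else D $$ (k, l) / u $ k) *
          (if j < r then A $$ (l, j) else u $ l))"
        using ij by (simp add: scalar_prod_def A'_def B'_def atLeast0LessThan)
      have BAij: "(\<Sum>l<N. B $$ (i, l) * A $$ (l, j)) = (B * A) $$ (i, j)" if "i < r" "j < r"
        using that A B by (simp add: scalar_prod_def atLeast0LessThan)
      have Bui: "(\<Sum>l<N. B $$ (i, l) * u $ l) = (B *\<^sub>v u) $ i" if "i < r"
        using that B uc by (simp add: scalar_prod_def atLeast0LessThan)
      have DAj: "(\<Sum>l<N. D $$ (k, l) * A $$ (l, j)) = (D * A) $$ (k, j)" if "j < r"
        using that A D k by (simp add: scalar_prod_def atLeast0LessThan)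
      have Duk: "(\<Sum>l<N. D $$ (k, l) * u $ l) = (D *\<^sub>v u) $ k"
        using D uc k by (simp add: scalar_prod_def atLeast0LessThan)
      show "(B' * A') $$ (i, j) = 1\<^sub>m (Suc r) $$ (i, j)"
        using ij k BAij Bui DAj Duk unfolding e
        by (cases "i < r"; cases "j < r")
          (auto simp: BA Bu DA Du sum_divide_distrib[symmetric] less_Suc_eq)
    qed (auto simp: A'_def B'_def)
    moreover have "A' *\<^sub>v x \<in> W" if x: "x \<in> carrier_vec (Suc r)" for x
    proof -
      define y where "y = Matrix.vec r (\<lambda>j. x $ j)"
      have "A' *\<^sub>v x = A *\<^sub>v y + x $ r \<cdot>\<^sub>v u"
        using A uc x by (intro eq_vecI) (auto simp: A'_def y_def scalar_prod_def)
      then show ?thesis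
        using add[OF AW[of y] smult[OF uW]] by (simp add: y_def)
    qed
    ultimately have "P (Suc r)"
      unfolding P_def by (intro exI[of _ A'] exI[of _ B']) (auto simp: A'_def B'_def)
    then show False
      using max by fastforce
  qed
  then show thesis
    using that A B BA AW by blast
qed

lemma mat_eqI_vec:
  assumes A: "A \<in> carrier_mat n m" and B: "B \<in> carrier_mat n m"
    and eq: "\<And>x. x \<in> carrier_vec m \<Longrightarrow> A *\<^sub>v x = B *\<^sub>v (x :: complex Matrix.vec)"
  shows "A = B"
proof (rule eq_matI)
  fix i j assume ij: "i < dim_row B" "j < dim_col B"
  have "(A *\<^sub>v unit_vec m j) $ i = (B *\<^sub>v unit_vec m j) $ i"
    by (simp add: eq)
  then show "A $$ (i, j) = B $$ (i, j)"
    using ij A B by (auto simp: scalar_prod_right_unit)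
qed (use A B in auto)

text \<open>A form of \<open>representation\<close> without the unit group: for a group,
  invertibility of the values follows from multiplicativity.\<close>

definition rep :: "('g, 'b) monoid_scheme \<Rightarrow> nat \<Rightarrow> ('g \<Rightarrow> complex mat) \<Rightarrow> bool" where
  "rep G d \<rho> \<longleftrightarrow> (\<forall>g\<in>carrier G. \<rho> g \<in> carrier_mat d d) \<and>
     (\<forall>g\<in>carrier G. \<forall>h\<in>carrier G. \<rho> (g \<otimes>\<^bsub>G\<^esub> h) = \<rho> g * \<rho> h) \<and> \<rho> \<one>\<^bsub>G\<^esub> = 1\<^sub>m d"

lemma repD:
  assumes "rep G d \<rho>"
  shows "g \<in> carrier G \<Longrightarrow> \<rho> g \<in> carrier_mat d d"
    "g \<in> carrier G \<Longrightarrow> h \<in> carrier G \<Longrightarrow> \<rho> (g \<otimes>\<^bsub>G\<^esub> h) = \<rho> g * \<rho> h" "\<rho> \<one>\<^bsub>G\<^esub> = 1\<^sub>m d"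
  using assms by (auto simp: rep_def)

lemma (in group) representation_iff_rep: "representation G d \<rho> \<longleftrightarrow> rep G d \<rho>"
proof -
  let ?R = "ring_mat TYPE(complex) d ()"
  have R: "monoid ?R"
    using ring_mat by (rule ring.is_monoid)
  have carr: "carrier (GL d) = Units ?R" and mult: "x \<otimes>\<^bsub>GL d\<^esub> y = x * y" and one: "\<one>\<^bsub>GL d\<^esub> = 1\<^sub>m d" for x y
    by (simp_all add: GL_def units_of_def ring_mat_def)
  have grp: "group (GL d)"
    unfolding GL_def by (rule monoid.units_group[OF R])
  show ?thesis
  proof
    assume "representation G d \<rho>"
    then have hom: "\<rho> \<in> hom G (GL d)"
      by (simp add: representation_def)
    interpret group_hom G "GL d" \<rho>
      by (intro group_hom.intro group_hom_axioms.intro hom grp group_axioms)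
    show "rep G d \<rho>"
      unfolding rep_def
    proof (intro conjI ballI)
      show "\<rho> g \<in> carrier_mat d d" if "g \<in> carrier G" for g
        using hom_in_carrier[OF hom that] by (simp add: carr Units_def ring_mat_def)
      show "\<rho> (g \<otimes> h) = \<rho> g * \<rho> h" if "g \<in> carrier G" "h \<in> carrier G" for g h
        using hom_mult[OF that] by (simp add: mult)
      show "\<rho> \<one> = 1\<^sub>m d"
        using hom_one by (simp add: one)
    qed
  next
    assume r: "rep G d \<rho>"
    have "\<rho> g \<in> Units ?R" if g: "g \<in> carrier G" for g
    proof -
      have "\<rho> g * \<rho> (inv g) = 1\<^sub>m d" "\<rho> (inv g) * \<rho> g = 1\<^sub>m d"
        using repD(2)[OF r, of g "inv g"] repD(2)[OF r, of "inv g" g] repD(3)[OF r] g by simp_all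
      then show ?thesis
        using repD(1)[OF r, of g] repD(1)[OF r, of "inv g"] g
        by (auto simp: Units_def ring_mat_def)
    qed
    then show "representation G d \<rho>"
      using repD(2)[OF r] by (auto simp: representation_def hom_def carr mult)
  qed
qed

lemma subspace_iff:
  "VectorSpace.subspace class_ring W (module_vec TYPE(complex) d) \<longleftrightarrow>
   W \<subseteq> carrier_vec d \<and> 0\<^sub>v d \<in> W \<and> (\<forall>v\<in>W. \<forall>w\<in>W. v + w \<in> W) \<and> (\<forall>a. \<forall>v\<in>W. a \<cdot>\<^sub>v v \<in> W)"
proof -
  interpret V: vec_space "TYPE(complex)" d .
  show ?thesis
  proof
    assume "VectorSpace.subspace class_ring W (module_vec TYPE(complex) d)"
    then have "submodule class_ring W (module_vec TYPE(complex) d)"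
      by (simp add: subspace_def)
    then show "W \<subseteq> carrier_vec d \<and> 0\<^sub>v d \<in> W \<and> (\<forall>v\<in>W. \<forall>w\<in>W. v + w \<in> W) \<and> (\<forall>a. \<forall>v\<in>W. a \<cdot>\<^sub>v v \<in> W)"
      unfolding submodule_def by (auto simp: module_vec_simps class_field_def)
  next
    assume W: "W \<subseteq> carrier_vec d \<and> 0\<^sub>v d \<in> W \<and> (\<forall>v\<in>W. \<forall>w\<in>W. v + w \<in> W) \<and> (\<forall>a. \<forall>v\<in>W. a \<cdot>\<^sub>v v \<in> W)"
    then have "submodule class_ring W (module_vec TYPE(complex) d)"
      using V.module_axioms unfolding submodule_def by (auto simp: module_vec_simps class_field_def)
    then show "VectorSpace.subspace class_ring W (module_vec TYPE(complex) d)"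
      using V.vectorspace_axioms by (simp add: subspace_def)
  qed
qed

lemma mult_vec_assoc:
  fixes A :: "complex mat"
  shows "A \<in> carrier_mat n k \<Longrightarrow> B \<in> carrier_mat k m \<Longrightarrow> x \<in> carrier_vec m \<Longrightarrow> A *\<^sub>v (B *\<^sub>v x) = (A * B) *\<^sub>v x"
  by (simp add: assoc_mult_mat_vec)

context group
begin

text \<open>The two alternatives say that the kernel of B is invariant, which gives the quotient
  representation, or that the image of A is, which gives the subrepresentation.\<close>

lemma rep_compress:
  assumes r: "rep G d \<rho>" and A: "A \<in> carrier_mat d r" and B: "B \<in> carrier_mat r d" and BA: "B * A = 1\<^sub>m r"
    and int: "(\<forall>g\<in>carrier G. B * \<rho> g = B * \<rho> g * A * B) \<or> (\<forall>g\<in>carrier G. \<rho> g * A = A * (B * (\<rho> g * A)))"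
  shows "rep G r (\<lambda>g. B * \<rho> g * A)"
  unfolding rep_def
proof (intro conjI ballI)
  fix g assume g: "g \<in> carrier G"
  show "B * \<rho> g * A \<in> carrier_mat r r"
    using A B repD(1)[OF r g] by auto
  fix h assume h: "h \<in> carrier G"
  note gc = repD(1)[OF r g] and hc = repD(1)[OF r h]
  have Bg: "B * \<rho> g \<in> carrier_mat r d" and hA: "\<rho> h * A \<in> carrier_mat d r" and X: "B * \<rho> g * A \<in> carrier_mat r r"
    and BhA: "B * (\<rho> h * A) \<in> carrier_mat r r"
    using A B gc hc by auto
  have "B * \<rho> (g \<otimes> h) * A = (B * \<rho> g) * (\<rho> h * A)"
    unfolding repD(2)[OF r g h] assoc_mult_mat[OF B gc hc, symmetric] by (rule assoc_mult_mat[OF Bg hc A])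
  also have "\<dots> = (B * \<rho> g * A) * (B * (\<rho> h * A))"
    using int
  proof
    assume "\<forall>g\<in>carrier G. B * \<rho> g = B * \<rho> g * A * B"
    then have "(B * \<rho> g) * (\<rho> h * A) = (B * \<rho> g * A * B) * (\<rho> h * A)"
      using g by simp
    then show ?thesis
      unfolding assoc_mult_mat[OF X B hA] .
  next
    assume "\<forall>g\<in>carrier G. \<rho> g * A = A * (B * (\<rho> g * A))"
    then have "(B * \<rho> g) * (\<rho> h * A) = (B * \<rho> g) * (A * (B * (\<rho> h * A)))"
      using h by simp
    then show ?thesis
      unfolding assoc_mult_mat[OF Bg A BhA, symmetric] .
  qed
  also have "B * (\<rho> h * A) = B * \<rho> h * A"
    by (rule assoc_mult_mat[OF B hc A, symmetric])
  finally show "B * \<rho> (g \<otimes> h) * A = B * \<rho> g * A * (B * \<rho> h * A)" .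
next
  show "B * \<rho> \<one> * A = 1\<^sub>m r"
    unfolding repD(3)[OF r] using B BA by simp
qed

lemma rep_inv_mult:
  assumes "rep G d \<rho>" "g \<in> carrier G"
  shows "\<rho> g * \<rho> (inv g) = 1\<^sub>m d" "\<rho> (inv g) * \<rho> g = 1\<^sub>m d"
  using repD(2)[OF assms(1), of g "inv g"] repD(2)[OF assms(1), of "inv g" g] repD(3)[OF assms(1)] assms(2)
  by simp_all

text \<open>Maschke: the average of a projection onto an invariant subspace.\<close>

lemma invariant_projection:
  assumes fin: "finite (carrier G)" and r: "rep G d \<rho>"
    and E: "E \<in> carrier_mat d d" and Wd: "W \<subseteq> carrier_vec d"
    and W: "\<And>g w. g \<in> carrier G \<Longrightarrow> w \<in> W \<Longrightarrow> \<rho> g *\<^sub>v w \<in> W"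
    and EW: "\<And>x. x \<in> carrier_vec d \<Longrightarrow> E *\<^sub>v x \<in> W" and EE: "\<And>w. w \<in> W \<Longrightarrow> E *\<^sub>v w = w"
  shows "\<exists>Q\<in>carrier_mat d d. (\<forall>g\<in>carrier G. Q * \<rho> g = \<rho> g * Q) \<and> E * Q = Q \<and> (\<forall>w\<in>W. Q *\<^sub>v w = w)"
proof -
  define n where "n = card (carrier G)"
  have n0: "n \<noteq> 0"
    unfolding n_def using fin one_closed by auto
  define F where "F g = (1 / of_nat n) \<cdot>\<^sub>m (\<rho> g * E * \<rho> (inv g))" for g
  have Fc: "F g \<in> carrier_mat d d" if "g \<in> carrier G" for g
    using that repD(1)[OF r, of g] repD(1)[OF r, of "inv g"] E by (auto simp: F_def)
  have rc: "\<rho> g \<in> carrier_mat d d" if "g \<in> carrier G" for g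
    using repD(1)[OF r that] .
  define Q where "Q = msum d d F (carrier G)"
  have Q: "Q \<in> carrier_mat d d"
    by (simp add: Q_def)
  have comm: "Q * \<rho> h = \<rho> h * Q" if h: "h \<in> carrier G" for h
  proof -
    have "F (h \<otimes> g) * \<rho> h = \<rho> h * F g" if g: "g \<in> carrier G" for g
    proof -
      have e: "inv (h \<otimes> g) \<otimes> h = inv g"
        using g h by (simp add: inv_mult_group m_assoc)
      have "\<rho> (h \<otimes> g) * E * \<rho> (inv (h \<otimes> g)) * \<rho> h = \<rho> (h \<otimes> g) * E * (\<rho> (inv (h \<otimes> g)) * \<rho> h)"
        using rc[of "h \<otimes> g"] rc[of "inv (h \<otimes> g)"] rc[OF h] g h E by (intro assoc_mult_mat[of _ d d _ d _ d]) auto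
      also have "\<rho> (inv (h \<otimes> g)) * \<rho> h = \<rho> (inv g)"
        using repD(2)[OF r, of "inv (h \<otimes> g)" h] g h e by simp
      also have "\<rho> (h \<otimes> g) * E * \<rho> (inv g) = \<rho> h * (\<rho> g * E * \<rho> (inv g))"
        unfolding repD(2)[OF r h g] using rc[OF g] rc[OF h] rc[of "inv g"] g E
        by (simp add: assoc_mult_mat[of _ d d _ d _ d])
      finally have eq: "\<rho> (h \<otimes> g) * E * \<rho> (inv (h \<otimes> g)) * \<rho> h = \<rho> h * (\<rho> g * E * \<rho> (inv g))" .
      have c1: "\<rho> (h \<otimes> g) * E * \<rho> (inv (h \<otimes> g)) \<in> carrier_mat d d" "\<rho> g * E * \<rho> (inv g) \<in> carrier_mat d d"
        using rc[of "h \<otimes> g"] rc[of "inv (h \<otimes> g)"] rc[OF g] rc[of "inv g"] g h E by auto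
      show ?thesis
        unfolding F_def using eq c1 rc[OF h]
        by (simp add: mult_smult_assoc_mat[OF c1(1) rc[OF h]] mult_smult_distrib[OF rc[OF h] c1(2)])
    qed
    then have "msum d d (\<lambda>g. F (h \<otimes> g) * \<rho> h) (carrier G) = msum d d (\<lambda>g. \<rho> h * F g) (carrier G)"
      by (intro msum_cong)
    moreover have "msum d d (\<lambda>g. F (h \<otimes> g) * \<rho> h) (carrier G) = msum d d (\<lambda>g. F g * \<rho> h) (carrier G)"
    proof (rule msum_reindex[of "\<lambda>g. h \<otimes> g" _ _ _ "\<lambda>g. F g * \<rho> h"])
      show "bij_betw (\<lambda>g. h \<otimes> g) (carrier G) (carrier G)"
        using h by (intro bij_betw_byWitness[of _ "\<lambda>g. inv h \<otimes> g"]) (auto simp: m_assoc[symmetric])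
    qed
    ultimately show ?thesis
      unfolding Q_def using Fc rc[OF h] by (simp add: msum_mult[of _ _ d d] mult_msum[of _ _ d d])
  qed
  have FW: "F g *\<^sub>v x \<in> carrier_vec d \<and> E *\<^sub>v (F g *\<^sub>v x) = F g *\<^sub>v x" if g: "g \<in> carrier G" and x: "x \<in> carrier_vec d" for g x
  proof -
    have e: "F g *\<^sub>v x = (1 / of_nat n) \<cdot>\<^sub>v (\<rho> g *\<^sub>v (E *\<^sub>v (\<rho> (inv g) *\<^sub>v x)))"
      unfolding F_def using rc[OF g] rc[of "inv g"] g x E
      by (simp add: smult_mat_vec[of _ d d] assoc_mult_mat_vec[of _ d d _ d])
    have w: "\<rho> g *\<^sub>v (E *\<^sub>v (\<rho> (inv g) *\<^sub>v x)) \<in> W"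
      using g x rc[of "inv g"] by (intro W EW) auto
    have wc: "\<rho> g *\<^sub>v (E *\<^sub>v (\<rho> (inv g) *\<^sub>v x)) \<in> carrier_vec d"
      using w Wd by blast
    have "E *\<^sub>v (F g *\<^sub>v x) = (1 / of_nat n) \<cdot>\<^sub>v (E *\<^sub>v (\<rho> g *\<^sub>v (E *\<^sub>v (\<rho> (inv g) *\<^sub>v x))))"
      unfolding e using E wc by (simp add: mult_mat_vec)
    then show ?thesis
      using EE[OF w] e wc by simp
  qed
  have EF: "E * F g = F g" if g: "g \<in> carrier G" for g
    using FW[OF g] Fc[OF g] E by (intro mat_eqI_vec[of _ d d]) (auto simp: assoc_mult_mat_vec[of E d d "F g" d])
  have "E * Q = Q"
    unfolding Q_def using Fc EF E by (simp add: mult_msum[of _ _ d d] cong: msum_cong)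
  moreover have "Q *\<^sub>v w = w" if w: "w \<in> W" for w
  proof -
    have wc: "w \<in> carrier_vec d"
      using w Wd by blast
    have Fw: "F g *\<^sub>v w = (1 / of_nat n) \<cdot>\<^sub>v w" if g: "g \<in> carrier G" for g
    proof -
      have "F g *\<^sub>v w = (1 / of_nat n) \<cdot>\<^sub>v (\<rho> g *\<^sub>v (E *\<^sub>v (\<rho> (inv g) *\<^sub>v w)))"
        unfolding F_def using rc[OF g] rc[of "inv g"] g wc E
        by (simp add: smult_mat_vec[of _ d d] assoc_mult_mat_vec[of _ d d _ d])
      also have "E *\<^sub>v (\<rho> (inv g) *\<^sub>v w) = \<rho> (inv g) *\<^sub>v w"
        using g w by (intro EE W) auto
      also have "\<rho> g *\<^sub>v (\<rho> (inv g) *\<^sub>v w) = (\<rho> g * \<rho> (inv g)) *\<^sub>v w"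
        using rc[OF g] rc[of "inv g"] g wc by (intro mult_vec_assoc) auto
      also have "\<dots> = w"
        using rep_inv_mult[OF r g] wc by simp
      finally show ?thesis .
    qed
    show ?thesis
    proof (rule eq_vecI)
      fix i assume "i < dim_vec w"
      then have i: "i < d"
        using wc by auto
      have "(Q *\<^sub>v w) $ i = (\<Sum>j<d. (\<Sum>g\<in>carrier G. F g $$ (i, j)) * w $ j)"
        using i wc by (simp add: Q_def msum_def scalar_prod_def atLeast0LessThan)
      also have "\<dots> = (\<Sum>g\<in>carrier G. \<Sum>j<d. F g $$ (i, j) * w $ j)"
        unfolding sum_distrib_right by (rule sum.swap)
      also have "\<dots> = (\<Sum>g\<in>carrier G. (F g *\<^sub>v w) $ i)"
      proof (rule sum.cong[OF refl])
        fix g assume "g \<in> carrier G"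
        then show "(\<Sum>j<d. F g $$ (i, j) * w $ j) = (F g *\<^sub>v w) $ i"
          using Fc[of g] i wc by (auto simp: scalar_prod_def atLeast0LessThan)
      qed
      also have "\<dots> = (\<Sum>g\<in>carrier G. w $ i / of_nat n)"
        using Fw i wc by (intro sum.cong) auto
      also have "\<dots> = w $ i"
        using n0 by (simp add: n_def)
      finally show "(Q *\<^sub>v w) $ i = w $ i" .
    qed (use wc in \<open>auto simp: Q_def\<close>)
  qed
  ultimately show ?thesis
    using Q comm by blast
qed

text \<open>Induction on the degree, with a proper nonzero invariant subspace W. A vector in W
  survives the invariant projection onto W, a vector outside W survives in the quotient by W;
  intertwiners compose.\<close>

theorem separating_irreducible:
  assumes fin: "finite (carrier G)" and "rep G d \<rho>" "v \<in> carrier_vec d" "v \<noteq> 0\<^sub>v d"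
  shows "\<exists>e \<sigma> P. irreducible_representation G e \<sigma> \<and> P \<in> carrier_mat e d \<and>
    (\<forall>g\<in>carrier G. P * \<rho> g = \<sigma> g * P) \<and> P *\<^sub>v v \<noteq> 0\<^sub>v e"
  using assms(2-)
proof (induction d arbitrary: \<rho> v rule: less_induct)
  case (less d)
  note r = less.prems(1) and v = less.prems(2,3)
  have rc: "\<rho> g \<in> carrier_mat d d" if "g \<in> carrier G" for g
    using repD(1)[OF r that] .
  have "d > 0"
    using v by (cases d) (auto intro: eq_vecI)
  have lift: ?case
    if e: "e < d" and P: "P \<in> carrier_mat e d" and \<sigma>: "rep G e \<sigma>"
      and int: "\<And>g. g \<in> carrier G \<Longrightarrow> P * \<rho> g = \<sigma> g * P" and Pv: "P *\<^sub>v v \<noteq> 0\<^sub>v e" for e P \<sigma>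
  proof -
    have "P *\<^sub>v v \<in> carrier_vec e"
      using P v by auto
    from less.IH[OF e \<sigma> this Pv] obtain e' \<tau> P' where t: "irreducible_representation G e' \<tau>"
      and P': "P' \<in> carrier_mat e' e" and int': "\<And>g. g \<in> carrier G \<Longrightarrow> P' * \<sigma> g = \<tau> g * P'"
      and ne: "P' *\<^sub>v (P *\<^sub>v v) \<noteq> 0\<^sub>v e'"
      by blast
    have tr: "rep G e' \<tau>"
      using t representation_iff_rep by (simp add: irreducible_representation_def)
    have "P' * P * \<rho> g = \<tau> g * (P' * P)" if g: "g \<in> carrier G" for g
    proof -
      have "P' * P * \<rho> g = P' * (\<sigma> g * P)"
        using P P' rc[OF g] int[OF g] by simp
      also have "\<dots> = P' * \<sigma> g * P"
        using P P' repD(1)[OF \<sigma> g] by simp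
      also have "\<dots> = \<tau> g * (P' * P)"
        using P P' repD(1)[OF tr g] int'[OF g] by simp
      finally show ?thesis .
    qed
    moreover have "P' * P *\<^sub>v v \<noteq> 0\<^sub>v e'"
      using ne P P' v by simp
    ultimately show ?thesis
      using t P P' by (intro exI[of _ e'] exI[of _ \<tau>] exI[of _ "P' * P"]) auto
  qed
  show ?case
  proof (cases "irreducible_representation G d \<rho>")
    case True
    then show ?thesis
      using v left_mult_one_mat[OF rc] right_mult_one_mat[OF rc]
      by (intro exI[of _ d] exI[of _ \<rho>] exI[of _ "1\<^sub>m d"]) auto
  next
    case False
    then obtain W where inv: "invariant_subspace G d \<rho> W" and W01: "W \<noteq> {0\<^sub>v d}" "W \<noteq> carrier_vec d"
      using r \<open>d > 0\<close> representation_iff_rep by (auto simp: irreducible_representation_def)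
    have W: "W \<subseteq> carrier_vec d" "0\<^sub>v d \<in> W" "\<And>v w. v \<in> W \<Longrightarrow> w \<in> W \<Longrightarrow> v + w \<in> W"
      "\<And>a v. v \<in> W \<Longrightarrow> a \<cdot>\<^sub>v v \<in> W" and Winv: "\<And>g w. g \<in> carrier G \<Longrightarrow> w \<in> W \<Longrightarrow> \<rho> g *\<^sub>v w \<in> W"
      using inv unfolding invariant_subspace_def subspace_iff by blast+
    obtain r1 A B where A: "A \<in> carrier_mat d r1" and B: "B \<in> carrier_mat r1 d" and BA: "B * A = 1\<^sub>m r1"
      and AW: "\<And>x. x \<in> carrier_vec r1 \<Longrightarrow> A *\<^sub>v x \<in> W" and AB: "\<And>w. w \<in> W \<Longrightarrow> A *\<^sub>v (B *\<^sub>v w) = w"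
      using subspace_factor[OF W] by metis
    have inW: "w \<in> W \<longleftrightarrow> (A * B) *\<^sub>v w = w" if "w \<in> carrier_vec d" for w
    proof -
      have "(A * B) *\<^sub>v w = A *\<^sub>v (B *\<^sub>v w)"
        using A B that by simp
      then show ?thesis
        using AB[of w] AW[of "B *\<^sub>v w"] B that by auto
    qed
    show ?thesis
    proof (cases "v \<in> W")
      case True
      have ABc: "A * B \<in> carrier_mat d d"
        using A B by auto
      have "\<exists>Q\<in>carrier_mat d d. (\<forall>g\<in>carrier G. Q * \<rho> g = \<rho> g * Q) \<and> A * B * Q = Q \<and> (\<forall>w\<in>W. Q *\<^sub>v w = w)"
      proof (rule invariant_projection[OF fin r ABc W(1) Winv])
        show "A * B *\<^sub>v x \<in> W" if "x \<in> carrier_vec d" for x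
          using that A B by (simp add: AW)
        show "A * B *\<^sub>v w = w" if "w \<in> W" for w
          using that W(1) inW by blast
      qed
      then obtain Q where Q: "Q \<in> carrier_mat d d" "\<And>g. g \<in> carrier G \<Longrightarrow> Q * \<rho> g = \<rho> g * Q" "A * B * Q = Q"
        "\<And>w. w \<in> W \<Longrightarrow> Q *\<^sub>v w = w"
        by blast
      have rA: "\<rho> g * A = A * (B * (\<rho> g * A))" if g: "g \<in> carrier G" for g
      proof (rule mat_eqI_vec[of _ d r1])
        fix x :: "complex Matrix.vec" assume x: "x \<in> carrier_vec r1"
        have "A *\<^sub>v (B *\<^sub>v (\<rho> g *\<^sub>v (A *\<^sub>v x))) = \<rho> g *\<^sub>v (A *\<^sub>v x)"
          by (intro AB Winv AW g x)
        moreover have "A *\<^sub>v (B *\<^sub>v (\<rho> g *\<^sub>v (A *\<^sub>v x))) = (A * (B * (\<rho> g * A))) *\<^sub>v x"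
          using A B rc[OF g] x assoc_mult_mat_vec[of A d r1 "B * (\<rho> g * A)" r1 x]
            assoc_mult_mat_vec[of B r1 d "\<rho> g * A" r1 x] assoc_mult_mat_vec[of "\<rho> g" d d A r1 x] by simp
        ultimately show "(\<rho> g * A) *\<^sub>v x = (A * (B * (\<rho> g * A))) *\<^sub>v x"
          using A rc[OF g] x by simp
      qed (use A B rc[OF g] in auto)
      show ?thesis
      proof (rule lift[of r1 "B * Q" "\<lambda>g. B * \<rho> g * A"])
        show "rep G r1 (\<lambda>g. B * \<rho> g * A)"
          using rA by (intro rep_compress[OF r A B BA]) blast
        show "B * Q \<in> carrier_mat r1 d"
          using B Q by auto
        show "B * Q * \<rho> g = B * \<rho> g * A * (B * Q)" if g: "g \<in> carrier G" for g
        proof -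
          have "B * \<rho> g * A * (B * Q) = B * \<rho> g * (A * B * Q)"
            using A B Q(1) rc[OF g] assoc_mult_mat[of "B * \<rho> g" r1 d A r1 "B * Q" d] by simp
          also have "\<dots> = B * (\<rho> g * Q)"
            using B Q rc[OF g] by simp
          also have "\<dots> = B * (Q * \<rho> g)"
            using Q(2)[OF g] by simp
          finally show ?thesis
            using B Q(1) rc[OF g] by simp
        qed
        have "B *\<^sub>v v \<noteq> 0\<^sub>v r1"
        proof
          assume "B *\<^sub>v v = 0\<^sub>v r1"
          then have "v = A *\<^sub>v 0\<^sub>v r1"
            using AB[OF True] by simp
          also have "\<dots> = 0\<^sub>v d"
            using A by (auto simp: scalar_prod_def intro!: eq_vecI)
          finally show False
            using v by simp
        qed
        then show "B * Q *\<^sub>v v \<noteq> 0\<^sub>v r1"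
          using Q(1) Q(4)[OF True] B v by simp
        have "r1 \<le> d"
          by (rule left_inverse_dim_le[OF A B BA])
        moreover have "r1 \<noteq> d"
        proof
          assume "r1 = d"
          then have "A * B = 1\<^sub>m d"
            using mat_mult_left_right_inverse[of B d A] A B BA by simp
          then have "carrier_vec d \<subseteq> W"
            using inW by auto
          then show False
            using W W01 by blast
        qed
        ultimately show "r1 < d"
          by simp
      qed
    next
      case False
      \<comment> \<open>The kernel of B is a linear complement of W, perhaps not invariant. It
        carries the quotient representation: \<open>B1\<close> below projects onto it in coordinates
        and annihilates W.\<close>
      define W1 where "W1 = {w \<in> carrier_vec d. B *\<^sub>v w = 0\<^sub>v r1}"
      have W1: "W1 \<subseteq> carrier_vec d" "0\<^sub>v d \<in> W1" "\<And>v w. v \<in> W1 \<Longrightarrow> w \<in> W1 \<Longrightarrow> v + w \<in> W1"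
        "\<And>a v. v \<in> W1 \<Longrightarrow> a \<cdot>\<^sub>v v \<in> W1"
        using B by (auto simp: W1_def mult_add_distrib_mat_vec[OF B] mult_mat_vec[OF B] scalar_prod_def intro!: eq_vecI)
      obtain s A1 B1' where A1: "A1 \<in> carrier_mat d s" and B1': "B1' \<in> carrier_mat s d" and BA1: "B1' * A1 = 1\<^sub>m s"
        and AW1: "\<And>x. x \<in> carrier_vec s \<Longrightarrow> A1 *\<^sub>v x \<in> W1" and AB1: "\<And>w. w \<in> W1 \<Longrightarrow> A1 *\<^sub>v (B1' *\<^sub>v w) = w"
        using subspace_factor[OF W1] by metis
      define D where "D = 1\<^sub>m d - A * B"
      have Dc: "D \<in> carrier_mat d d"
        unfolding D_def using A B by (intro minus_carrier_mat mult_carrier_mat)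
      have Dx: "D *\<^sub>v x = x - (A * B) *\<^sub>v x" if "x \<in> carrier_vec d" for x
        unfolding D_def using that A B by (subst minus_mult_distrib_mat_vec[of _ d d]) auto
      have DW: "D *\<^sub>v w = 0\<^sub>v d" if "w \<in> W" for w
        using that Dx[of w] inW[of w] W(1) by auto
      have DW1: "D *\<^sub>v x \<in> W1" if x: "x \<in> carrier_vec d" for x
      proof -
        have "B *\<^sub>v (D *\<^sub>v x) = B *\<^sub>v x - B *\<^sub>v ((A * B) *\<^sub>v x)"
          unfolding Dx[OF x] using x A B by (intro mult_minus_distrib_mat_vec[of _ r1 d]) auto
        also have "B *\<^sub>v ((A * B) *\<^sub>v x) = (B * A) *\<^sub>v (B *\<^sub>v x)"
          using A B x assoc_mult_mat_vec[of A d r1 B d x] assoc_mult_mat_vec[of B r1 d A r1 "B *\<^sub>v x"] by simp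
        also have "\<dots> = B *\<^sub>v x"
          unfolding BA using B x by (intro one_mult_mat_vec mult_mat_vec_carrier)
        finally show ?thesis
          using x B Dc by (auto simp: W1_def)
      qed
      define B1 where "B1 = B1' * D"
      have B1: "B1 \<in> carrier_mat s d"
        using B1' Dc by (simp add: B1_def)
      have DA1: "D * A1 = A1"
      proof (rule mat_eqI_vec[of _ d s])
        fix x :: "complex Matrix.vec" assume x: "x \<in> carrier_vec s"
        have a: "A1 *\<^sub>v x \<in> carrier_vec d" "B *\<^sub>v (A1 *\<^sub>v x) = 0\<^sub>v r1"
          using AW1[OF x] by (auto simp: W1_def)
        have "A *\<^sub>v 0\<^sub>v r1 = 0\<^sub>v d"
          using A by (auto simp: scalar_prod_def intro!: eq_vecI)
        then have "(A * B) *\<^sub>v (A1 *\<^sub>v x) = 0\<^sub>v d"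
          using a A B by simp
        then show "D * A1 *\<^sub>v x = A1 *\<^sub>v x"
          using Dx[OF a(1)] a Dc A1 x by simp
      qed (use A1 Dc in auto)
      have B1A1: "B1 * A1 = 1\<^sub>m s"
        unfolding B1_def using B1' Dc A1 DA1 BA1 by simp
      have A1B1: "A1 * B1 = D"
      proof (rule mat_eqI_vec[of _ d d])
        fix x :: "complex Matrix.vec" assume x: "x \<in> carrier_vec d"
        have "A1 *\<^sub>v (B1' *\<^sub>v (D *\<^sub>v x)) = D *\<^sub>v x"
          by (rule AB1[OF DW1[OF x]])
        then show "A1 * B1 *\<^sub>v x = D *\<^sub>v x"
          unfolding B1_def using A1 B1' Dc x assoc_mult_mat_vec[of A1 d s "B1' * D" d x]
            assoc_mult_mat_vec[of B1' s d D d x] by simp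
      qed (use A1 B1 Dc in auto)
      have B1W: "B1 *\<^sub>v w = 0\<^sub>v s" if "w \<in> W" for w
      proof -
        have "B1 *\<^sub>v w = B1' *\<^sub>v (D *\<^sub>v w)"
          unfolding B1_def using B1' Dc W(1) that by (intro assoc_mult_mat_vec) auto
        then show ?thesis
          unfolding DW[OF that] using B1' by (auto simp: scalar_prod_def intro!: eq_vecI)
      qed
      have B1r: "B1 * \<rho> g = B1 * \<rho> g * A1 * B1" if g: "g \<in> carrier G" for g
      proof (rule mat_eqI_vec[of _ s d])
        fix x :: "complex Matrix.vec" assume x: "x \<in> carrier_vec d"
        define y where "y = (A * B) *\<^sub>v x"
        have y: "y \<in> W"
          unfolding y_def using A B x by (simp add: AW)
        have yc: "y \<in> carrier_vec d"
          using y W(1) by blast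
        have xy: "x = D *\<^sub>v x + y"
          unfolding Dx[OF x] y_def[symmetric] using x yc by (auto intro!: eq_vecI)
        have "B1 *\<^sub>v (\<rho> g *\<^sub>v y) = 0\<^sub>v s"
          by (intro B1W Winv g y)
        moreover have "B1 *\<^sub>v (\<rho> g *\<^sub>v (D *\<^sub>v x + y)) = B1 *\<^sub>v (\<rho> g *\<^sub>v (D *\<^sub>v x)) + B1 *\<^sub>v (\<rho> g *\<^sub>v y)"
          using Dc x yc rc[OF g] B1
          by (simp add: mult_add_distrib_mat_vec[of _ d d] mult_add_distrib_mat_vec[of _ s d])
        ultimately have "B1 *\<^sub>v (\<rho> g *\<^sub>v x) = B1 *\<^sub>v (\<rho> g *\<^sub>v (D *\<^sub>v x))"
          using xy B1 rc[OF g] Dc x by (metis mult_mat_vec_carrier right_zero_vec)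
        then show "B1 * \<rho> g *\<^sub>v x = B1 * \<rho> g * A1 * B1 *\<^sub>v x"
          using B1 rc[OF g] A1 Dc x A1B1 assoc_mult_mat[of "B1 * \<rho> g" s d A1 s B1 d]
            assoc_mult_mat_vec[of B1 s d "\<rho> g" d x] assoc_mult_mat_vec[of "B1 * \<rho> g" s d D d x]
            assoc_mult_mat_vec[of B1 s d "\<rho> g" d "D *\<^sub>v x"] by simp
      qed (use B1 A1 rc[OF g] in auto)
      show ?thesis
      proof (rule lift[of s B1 "\<lambda>g. B1 * \<rho> g * A1"])
        show "rep G s (\<lambda>g. B1 * \<rho> g * A1)"
          using B1r by (intro rep_compress[OF r A1 B1 B1A1]) blast
        show "B1 *\<^sub>v v \<noteq> 0\<^sub>v s"
        proof
          assume 0: "B1 *\<^sub>v v = 0\<^sub>v s"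
          have "D *\<^sub>v v = A1 *\<^sub>v (B1 *\<^sub>v v)"
            unfolding A1B1[symmetric] using A1 B1 v by simp
          also have "\<dots> = 0\<^sub>v d"
            unfolding 0 using A1 by (auto simp: scalar_prod_def intro!: eq_vecI)
          finally have z: "v - (A * B) *\<^sub>v v = 0\<^sub>v d"
            using Dx v by simp
          have "(A * B) *\<^sub>v v = v"
          proof (rule eq_vecI)
            fix i assume "i < dim_vec v"
            then have "(v - (A * B) *\<^sub>v v) $ i = 0" "i < d"
              using z v by auto
            then show "((A * B) *\<^sub>v v) $ i = v $ i"
              using A v by simp
          qed (use A v in auto)
          then show False
            using False inW v by blast
        qed
        have "s \<le> d"
          by (rule left_inverse_dim_le[OF A1 B1 B1A1])
        moreover have "s \<noteq> d"
        proof
          assume "s = d"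
          then have one: "A1 * B1 = 1\<^sub>m d"
            using mat_mult_left_right_inverse[of B1 d A1] A1 B1 B1A1 by simp
          have "w = 0\<^sub>v d" if "w \<in> W" for w
          proof -
            have "w \<in> carrier_vec d"
              using that W(1) by blast
            then show ?thesis
              using DW[OF that] one unfolding A1B1 by simp
          qed
          then show False
            using W W01 by blast
        qed
        ultimately show "s < d"
          by simp
      qed (use B1 B1r in auto)
    qed
  qed
qed

end

section \<open>Traces and intertwiners\<close>

lemma mat_trace_carrier: "A \<in> carrier_mat n m \<Longrightarrow> mat_trace A = (\<Sum>i<n. A $$ (i, i))"
  by (simp add: mat_trace_def)

lemma mat_trace_mult_commute:
  assumes A: "A \<in> carrier_mat n m" and B: "B \<in> carrier_mat m n"
  shows "mat_trace (A * B) = mat_trace (B * A)"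
proof -
  have "mat_trace (A * B) = (\<Sum>i<n. \<Sum>j<m. A $$ (i, j) * B $$ (j, i))"
    using A B by (simp add: mat_trace_def scalar_prod_def atLeast0LessThan)
  also have "\<dots> = (\<Sum>j<m. \<Sum>i<n. B $$ (j, i) * A $$ (i, j))"
    by (subst sum.swap) (simp add: mult.commute)
  also have "\<dots> = mat_trace (B * A)"
    using A B by (simp add: mat_trace_def scalar_prod_def atLeast0LessThan)
  finally show ?thesis .
qed

lemma mat_trace_msum:
  assumes "\<And>s. s \<in> S \<Longrightarrow> f s \<in> carrier_mat n n"
  shows "mat_trace (msum n n f S) = (\<Sum>s\<in>S. mat_trace (f s))"
proof -
  have "mat_trace (msum n n f S) = (\<Sum>s\<in>S. \<Sum>i<n. f s $$ (i, i))"
    by (simp add: mat_trace_def msum_def) (rule sum.swap)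
  also have "\<dots> = (\<Sum>s\<in>S. mat_trace (f s))"
    by (intro sum.cong refl) (rule mat_trace_carrier[symmetric, OF assms])
  finally show ?thesis .
qed

lemma msum_mult_vec:
  assumes "\<And>s. s \<in> S \<Longrightarrow> f s \<in> carrier_mat n m" "x \<in> carrier_vec m" "i < n"
  shows "(msum n m f S *\<^sub>v x) $ i = (\<Sum>s\<in>S. (f s *\<^sub>v x) $ i)"
proof -
  have "(msum n m f S *\<^sub>v x) $ i = (\<Sum>j<m. (\<Sum>s\<in>S. f s $$ (i, j)) * x $ j)"
    using assms by (simp add: msum_def scalar_prod_def atLeast0LessThan)
  also have "\<dots> = (\<Sum>s\<in>S. \<Sum>j<m. f s $$ (i, j) * x $ j)"
    unfolding sum_distrib_right by (rule sum.swap)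
  also have "\<dots> = (\<Sum>s\<in>S. (f s *\<^sub>v x) $ i)"
  proof (rule sum.cong[OF refl])
    fix s assume "s \<in> S"
    then show "(\<Sum>j<m. f s $$ (i, j) * x $ j) = (f s *\<^sub>v x) $ i"
      using assms(1)[of s] assms(2,3) by (auto simp: scalar_prod_def atLeast0LessThan)
  qed
  finally show ?thesis .
qed

text \<open>The average of a representation is the projection onto the fixed vectors, so its trace counts
  them.\<close>

lemma (in group) average_trace_ge_2:
  assumes fin: "finite (carrier G)" and t: "rep G N \<tau>"
    and v: "v \<in> carrier_vec N" "v \<noteq> 0\<^sub>v N" "\<And>g. g \<in> carrier G \<Longrightarrow> \<tau> g *\<^sub>v v = v"
    and w: "w \<in> carrier_vec N" "\<And>g. g \<in> carrier G \<Longrightarrow> \<tau> g *\<^sub>v w = w" "\<And>c. w \<noteq> c \<cdot>\<^sub>v v"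
  shows "\<exists>r\<ge>2. (\<Sum>g\<in>carrier G. mat_trace (\<tau> g)) / of_nat (Coset.order G) = of_nat r"
proof -
  define n where "n = Coset.order G"
  have n0: "n \<noteq> 0"
    unfolding n_def Coset.order_def using fin one_closed by auto
  have tc: "\<tau> g \<in> carrier_mat N N" if "g \<in> carrier G" for g
    using repD(1)[OF t that] .
  define W where "W = {x \<in> carrier_vec N. \<forall>g\<in>carrier G. \<tau> g *\<^sub>v x = x}"
  have W0: "0\<^sub>v N \<in> W"
    unfolding W_def
  proof (intro CollectI conjI ballI)
    fix g assume "g \<in> carrier G"
    then show "\<tau> g *\<^sub>v 0\<^sub>v N = 0\<^sub>v N"
      using tc[of g] by (auto simp: scalar_prod_def intro!: eq_vecI)
  qed simp
  have W_add: "x + y \<in> W" if "x \<in> W" "y \<in> W" for x y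
    using that mult_add_distrib_mat_vec[OF tc] by (auto simp: W_def)
  have W_smult: "a \<cdot>\<^sub>v x \<in> W" if "x \<in> W" for a x
    using that mult_mat_vec[OF tc] by (auto simp: W_def)
  have Wc: "W \<subseteq> carrier_vec N"
    by (auto simp: W_def)
  obtain r A B where A: "A \<in> carrier_mat N r" and B: "B \<in> carrier_mat r N" and BA: "B * A = 1\<^sub>m r"
    and AW: "\<And>x. x \<in> carrier_vec r \<Longrightarrow> A *\<^sub>v x \<in> W" and AB: "\<And>w. w \<in> W \<Longrightarrow> A *\<^sub>v (B *\<^sub>v w) = w"
    using subspace_factor[OF Wc W0 W_add W_smult] by metis
  define K where "K = (1 / of_nat n) \<cdot>\<^sub>m msum N N \<tau> (carrier G)"
  have Kc: "K \<in> carrier_mat N N"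
    by (simp add: K_def)
  have tK: "\<tau> h * K = K" if h: "h \<in> carrier G" for h
  proof -
    have "\<tau> h * msum N N \<tau> (carrier G) = msum N N (\<lambda>g. \<tau> h * \<tau> g) (carrier G)"
      by (rule mult_msum[OF tc tc[OF h]])
    also have "\<dots> = msum N N (\<lambda>g. \<tau> (h \<otimes> g)) (carrier G)"
      using repD(2)[OF t h] by (intro msum_cong) simp
    also have "\<dots> = msum N N \<tau> (carrier G)"
    proof (rule msum_reindex)
      show "bij_betw (\<lambda>g. h \<otimes> g) (carrier G) (carrier G)"
        using h by (intro bij_betw_byWitness[of _ "\<lambda>g. inv h \<otimes> g"]) (auto simp: m_assoc[symmetric])
    qed
    finally show ?thesis
      unfolding K_def using mult_smult_distrib[OF tc[OF h] msum_carrier, of "1 / of_nat n" N \<tau> "carrier G"] by simp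
  qed
  have KW: "K *\<^sub>v x \<in> W" if x: "x \<in> carrier_vec N" for x
    unfolding W_def
  proof (intro CollectI conjI ballI)
    show "K *\<^sub>v x \<in> carrier_vec N"
      using Kc x by (rule mult_mat_vec_carrier)
    fix g assume g: "g \<in> carrier G"
    have "\<tau> g *\<^sub>v (K *\<^sub>v x) = (\<tau> g * K) *\<^sub>v x"
      by (rule mult_vec_assoc[OF tc[OF g] Kc x])
    then show "\<tau> g *\<^sub>v (K *\<^sub>v x) = K *\<^sub>v x"
      using tK[OF g] by simp
  qed
  have Kfix: "K *\<^sub>v x = x" if x: "x \<in> W" for x
  proof (rule eq_vecI)
    have xc: "x \<in> carrier_vec N"
      using x Wc by blast
    fix i assume "i < dim_vec x"
    then have i: "i < N"
      using xc by auto
    have "K *\<^sub>v x = (1 / of_nat n) \<cdot>\<^sub>v (msum N N \<tau> (carrier G) *\<^sub>v x)"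
      unfolding K_def by (rule smult_mat_vec[OF msum_carrier xc])
    then have "(K *\<^sub>v x) $ i = (1 / of_nat n) * (msum N N \<tau> (carrier G) *\<^sub>v x) $ i"
      using i by simp
    also have "(msum N N \<tau> (carrier G) *\<^sub>v x) $ i = (\<Sum>g\<in>carrier G. (\<tau> g *\<^sub>v x) $ i)"
      by (rule msum_mult_vec[OF tc xc i])
    also have "\<dots> = of_nat n * x $ i"
      using x by (simp add: W_def n_def Coset.order_def)
    finally show "(K *\<^sub>v x) $ i = x $ i"
      using n0 by simp
  qed (use Kc x Wc in auto)
  have KA: "K * A = A"
  proof (rule mat_eqI_vec[of _ N r])
    fix x :: "complex Matrix.vec" assume x: "x \<in> carrier_vec r"
    show "K * A *\<^sub>v x = A *\<^sub>v x"
      using Kfix[OF AW[OF x]] mult_vec_assoc[OF Kc A x] by simp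
  qed (use Kc A in auto)
  have ABK: "A * (B * K) = K"
  proof (rule mat_eqI_vec[of _ N N])
    fix x :: "complex Matrix.vec" assume x: "x \<in> carrier_vec N"
    have "A * (B * K) *\<^sub>v x = A *\<^sub>v (B *\<^sub>v (K *\<^sub>v x))"
      using A B Kc x assoc_mult_mat_vec[of A N r "B * K" N x] assoc_mult_mat_vec[of B r N K N x] by simp
    then show "A * (B * K) *\<^sub>v x = K *\<^sub>v x"
      using AB[OF KW[OF x]] by simp
  qed (use Kc A B in auto)
  have "mat_trace K = mat_trace (A * (B * K))"
    by (simp only: ABK)
  also have "\<dots> = mat_trace (B * K * A)"
    using A B Kc by (intro mat_trace_mult_commute) auto
  also have "B * K * A = 1\<^sub>m r"
    using A B Kc KA BA assoc_mult_mat[of B r N K N A r] by simp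
  also have "mat_trace (1\<^sub>m r) = of_nat r"
    by (simp add: mat_trace_def)
  finally have "mat_trace K = of_nat r" .
  moreover have "mat_trace K = (1 / of_nat n) * mat_trace (msum N N \<tau> (carrier G))"
    by (simp add: K_def mat_trace_def sum_distrib_left)
  ultimately have "(\<Sum>g\<in>carrier G. mat_trace (\<tau> g)) / of_nat n = of_nat r"
    using mat_trace_msum[of "carrier G" \<tau> N] tc by simp
  moreover have "r \<ge> 2"
  proof (rule ccontr)
    assume "\<not> r \<ge> 2"
    have vW: "v \<in> W" and wW: "w \<in> W"
      using v w by (auto simp: W_def)
    have Bc: "B *\<^sub>v v \<in> carrier_vec r" "B *\<^sub>v w \<in> carrier_vec r"
      using B v w by auto
    show False
    proof (cases "B *\<^sub>v v = 0\<^sub>v r")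
      case True
      then have "v = A *\<^sub>v 0\<^sub>v r"
        using AB[OF vW] by simp
      also have "\<dots> = 0\<^sub>v N"
        using A by (auto simp: scalar_prod_def intro!: eq_vecI)
      finally show False
        using v by simp
    next
      case False
      have r1: "r = 1"
      proof (rule ccontr)
        assume "r \<noteq> 1"
        then have "r = 0"
          using \<open>\<not> r \<ge> 2\<close> by simp
        then have "B *\<^sub>v v = 0\<^sub>v r"
          using B Bc(1) by (intro eq_vecI) auto
        then show False
          using False by contradiction
      qed
      have ne: "(B *\<^sub>v v) $ 0 \<noteq> 0"
      proof
        assume "(B *\<^sub>v v) $ 0 = 0"
        then have "B *\<^sub>v v = 0\<^sub>v r"
          using B Bc r1 by (intro eq_vecI) auto
        then show False
          using False by simp
      qed
      define c where "c = (B *\<^sub>v w) $ 0 / (B *\<^sub>v v) $ 0"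
      have "B *\<^sub>v w = c \<cdot>\<^sub>v (B *\<^sub>v v)"
        using B Bc r1 ne by (intro eq_vecI) (auto simp: c_def)
      then have "w = A *\<^sub>v (c \<cdot>\<^sub>v (B *\<^sub>v v))"
        using AB[OF wW] by simp
      also have "\<dots> = c \<cdot>\<^sub>v (A *\<^sub>v (B *\<^sub>v v))"
        by (rule mult_mat_vec[OF A Bc(1)])
      finally show False
        using w(3) AB[OF vW] by simp
    qed
  qed
  ultimately show ?thesis
    unfolding n_def by blast
qed

section \<open>Kronecker products, with index i encoding the pair of i div d and i mod d\<close>

lemma sum_div_mod:
  fixes F :: "nat \<Rightarrow> nat \<Rightarrow> complex"
  shows "(\<Sum>i<e * d. F (i div d) (i mod d)) = (\<Sum>a<e. \<Sum>b<d. F a b)"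
proof -
  have "a * d + b < e * d" if "a < e" "b < d" for a b
  proof -
    have "a * d + b < Suc a * d"
      using that by simp
    also have "\<dots> \<le> e * d"
      using that by (intro mult_right_mono) auto
    finally show ?thesis .
  qed
  moreover have "d > 0" if "i < e * d" for i
    using that by (cases d) auto
  ultimately have "(\<Sum>(a, b)\<in>{..<e} \<times> {..<d}. F a b) = (\<Sum>i<e * d. F (i div d) (i mod d))"
    by (intro sum.reindex_bij_witness[of _ "\<lambda>i. (i div d, i mod d)" "\<lambda>(a, b). a * d + b"])
      (auto simp: less_mult_imp_div_less)
  then show ?thesis
    by (simp add: sum.cartesian_product)
qed

definition kron :: "nat \<Rightarrow> nat \<Rightarrow> complex mat \<Rightarrow> complex mat \<Rightarrow> complex mat" where
  "kron e d A B = Matrix.mat (e * d) (e * d) (\<lambda>(i, j). A $$ (i div d, j div d) * B $$ (i mod d, j mod d))"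

lemma div_mod_less:
  assumes "i < e * (d :: nat)"
  shows "i div d < e" "i mod d < d"
  using assms by (auto simp: less_mult_imp_div_less) (cases d; simp)

lemma kron_mult:
  assumes "A \<in> carrier_mat e e" "C \<in> carrier_mat e e" "B \<in> carrier_mat d d" "D \<in> carrier_mat d d"
  shows "kron e d A B * kron e d C D = kron e d (A * C) (B * D)"
proof (rule eq_matI)
  fix i j assume "i < dim_row (kron e d (A * C) (B * D))" "j < dim_col (kron e d (A * C) (B * D))"
  then have i: "i < e * d" and j: "j < e * d"
    by (auto simp: kron_def)
  note ij = div_mod_less[OF i] div_mod_less[OF j]
  have "(kron e d A B * kron e d C D) $$ (i, j) = (\<Sum>l<e * d. (A $$ (i div d, l div d) * B $$ (i mod d, l mod d)) *
      (C $$ (l div d, j div d) * D $$ (l mod d, j mod d)))"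
    using i j by (simp add: kron_def scalar_prod_def atLeast0LessThan)
  also have "\<dots> = (\<Sum>a<e. \<Sum>b<d. (A $$ (i div d, a) * B $$ (i mod d, b)) * (C $$ (a, j div d) * D $$ (b, j mod d)))"
    by (rule sum_div_mod[of "\<lambda>a b. (A $$ (i div d, a) * B $$ (i mod d, b)) * (C $$ (a, j div d) * D $$ (b, j mod d))"])
  also have "\<dots> = (\<Sum>a<e. A $$ (i div d, a) * C $$ (a, j div d)) * (\<Sum>b<d. B $$ (i mod d, b) * D $$ (b, j mod d))"
    by (simp add: sum_product mult_ac)
  also have "\<dots> = (A * C) $$ (i div d, j div d) * (B * D) $$ (i mod d, j mod d)"
    using assms ij by (simp add: scalar_prod_def atLeast0LessThan)
  finally show "(kron e d A B * kron e d C D) $$ (i, j) = kron e d (A * C) (B * D) $$ (i, j)"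
    using i j by (simp add: kron_def)
qed (auto simp: kron_def)

lemma mat_trace_kron:
  assumes "A \<in> carrier_mat e e" "B \<in> carrier_mat d d"
  shows "mat_trace (kron e d A B) = mat_trace A * mat_trace B"
proof -
  have "mat_trace (kron e d A B) = (\<Sum>i<e * d. A $$ (i div d, i div d) * B $$ (i mod d, i mod d))"
    by (simp add: mat_trace_def kron_def)
  also have "\<dots> = (\<Sum>a<e. \<Sum>b<d. A $$ (a, a) * B $$ (b, b))"
    by (rule sum_div_mod[of "\<lambda>a b. A $$ (a, a) * B $$ (b, b)"])
  finally show ?thesis
    using assms by (simp add: mat_trace_carrier sum_product)
qed

definition vectorize :: "nat \<Rightarrow> nat \<Rightarrow> complex mat \<Rightarrow> complex Matrix.vec" where
  "vectorize e d Z = Matrix.vec (e * d) (\<lambda>i. Z $$ (i div d, i mod d))"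

text \<open>Makes matrices fixed under a two-sided action into fixed vectors of a Kronecker product.
  For B the entrywise conjugate of \<open>\<rho> g\<close>, its transpose is the adjoint of
  \<open>\<rho> g\<close>.\<close>

lemma kron_vectorize:
  assumes "A \<in> carrier_mat e e" "B \<in> carrier_mat d d" "Z \<in> carrier_mat e d"
  shows "kron e d A B *\<^sub>v vectorize e d Z = vectorize e d (A * (Z * transpose_mat B))"
proof (rule eq_vecI)
  fix i assume "i < dim_vec (vectorize e d (A * (Z * transpose_mat B)))"
  then have i: "i < e * d"
    by (simp add: vectorize_def)
  note ij = div_mod_less[OF i]
  have "(kron e d A B *\<^sub>v vectorize e d Z) $ i =
      (\<Sum>l<e * d. (A $$ (i div d, l div d) * B $$ (i mod d, l mod d)) * Z $$ (l div d, l mod d))"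
    using i by (simp add: kron_def vectorize_def scalar_prod_def atLeast0LessThan)
  also have "\<dots> = (\<Sum>a<e. \<Sum>b<d. (A $$ (i div d, a) * B $$ (i mod d, b)) * Z $$ (a, b))"
    by (rule sum_div_mod[of "\<lambda>a b. (A $$ (i div d, a) * B $$ (i mod d, b)) * Z $$ (a, b)"])
  also have "\<dots> = (A * (Z * transpose_mat B)) $$ (i div d, i mod d)"
    using assms ij by (simp add: scalar_prod_def atLeast0LessThan sum_distrib_left mult_ac)
  finally show "(kron e d A B *\<^sub>v vectorize e d Z) $ i = vectorize e d (A * (Z * transpose_mat B)) $ i"
    using i by (simp add: vectorize_def)
qed (simp add: kron_def vectorize_def)

lemma vectorize_inject:
  assumes "Z \<in> carrier_mat e d" "Y \<in> carrier_mat e d" "vectorize e d Z = vectorize e d Y"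
  shows "Z = Y"
proof (rule eq_matI)
  fix i j assume "i < dim_row Y" "j < dim_col Y"
  then have ij: "i < e" "j < d"
    using assms by auto
  have "i * d + j < Suc i * d"
    using ij by simp
  also have "\<dots> \<le> e * d"
    using ij by (intro mult_right_mono) auto
  finally have l: "i * d + j < e * d" .
  have "vectorize e d Z $ (i * d + j) = vectorize e d Y $ (i * d + j)"
    using assms(3) by simp
  then show "Z $$ (i, j) = Y $$ (i, j)"
    using l ij by (simp add: vectorize_def)
qed (use assms in auto)

abbreviation adj :: "complex mat \<Rightarrow> complex mat" where
  "adj A \<equiv> transpose_mat (map_mat cnj A)"

lemma cnj_mat_mult:
  assumes "A \<in> carrier_mat n m" "B \<in> carrier_mat m k"
  shows "map_mat cnj (A * B) = map_mat cnj A * map_mat cnj B"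
  using assms by (intro eq_matI) (auto simp: scalar_prod_def)

lemma adj_mult:
  assumes "A \<in> carrier_mat n m" "B \<in> carrier_mat m k"
  shows "adj (A * B) = adj B * adj A"
  unfolding cnj_mat_mult[OF assms] using assms by (intro transpose_mult[of _ n m]) auto

lemma mult_adj_diag:
  assumes "A \<in> carrier_mat n m" "i < n"
  shows "(A * adj A) $$ (i, i) = (\<Sum>l<m. A $$ (i, l) * cnj (A $$ (i, l)))"
  using assms by (simp add: scalar_prod_def atLeast0LessThan)

lemma cnj_mat_trace: "mat_trace (map_mat cnj A) = cnj (mat_trace A)" if "A \<in> carrier_mat n n"
  using that by (simp add: mat_trace_def)

context group
begin

text \<open>The sum of \<open>\<rho> g (\<rho> g)\<^sup>*\<close> turns an intertwiner \<open>P\<close> into a matrix \<open>Z\<close> with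
  \<open>\<sigma> g Z (\<rho> g)\<^sup>* = Z\<close>; this avoids a unitary form of \<open>\<rho>\<close>.\<close>

definition gram :: "nat \<Rightarrow> ('a \<Rightarrow> complex mat) \<Rightarrow> complex mat" where
  "gram d \<rho> = msum d d (\<lambda>g. \<rho> g * adj (\<rho> g)) (carrier G)"

lemma gram_invariant:
  assumes r: "rep G d \<rho>" and h: "h \<in> carrier G"
  shows "\<rho> h * (gram d \<rho> * adj (\<rho> h)) = gram d \<rho>"
proof -
  have rc: "\<rho> g \<in> carrier_mat d d" if "g \<in> carrier G" for g
    using repD(1)[OF r that] .
  have "\<rho> h * (gram d \<rho> * adj (\<rho> h)) = msum d d (\<lambda>g. \<rho> h * (\<rho> g * adj (\<rho> g) * adj (\<rho> h))) (carrier G)"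
  proof -
    have a: "adj (\<rho> g) \<in> carrier_mat d d" and c: "\<rho> g * adj (\<rho> g) \<in> carrier_mat d d" if "g \<in> carrier G" for g
      using rc[OF that] by auto
    have "gram d \<rho> * adj (\<rho> h) = msum d d (\<lambda>g. \<rho> g * adj (\<rho> g) * adj (\<rho> h)) (carrier G)"
      unfolding gram_def by (rule msum_mult[OF c a[OF h]])
    moreover have "\<rho> g * adj (\<rho> g) * adj (\<rho> h) \<in> carrier_mat d d" if "g \<in> carrier G" for g
      by (rule mult_carrier_mat[OF c[OF that] a[OF h]])
    ultimately show ?thesis
      using mult_msum[of "carrier G" "\<lambda>g. \<rho> g * adj (\<rho> g) * adj (\<rho> h)" d d "\<rho> h" d] rc[OF h] by simp
  qed
  also have "\<dots> = msum d d (\<lambda>g. \<rho> (h \<otimes> g) * adj (\<rho> (h \<otimes> g))) (carrier G)"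
  proof (rule msum_cong)
    fix g assume g: "g \<in> carrier G"
    note c = rc[OF g] rc[OF h]
    have ac: "adj (\<rho> g) \<in> carrier_mat d d" "adj (\<rho> h) \<in> carrier_mat d d"
      using c by auto
    have "\<rho> h * (\<rho> g * adj (\<rho> g) * adj (\<rho> h)) = \<rho> h * (\<rho> g * (adj (\<rho> g) * adj (\<rho> h)))"
      unfolding assoc_mult_mat[OF c(1) ac] ..
    also have "\<dots> = \<rho> h * \<rho> g * (adj (\<rho> g) * adj (\<rho> h))"
      by (rule assoc_mult_mat[symmetric, OF c(2,1)]) (use ac in auto)
    also have "\<dots> = \<rho> (h \<otimes> g) * adj (\<rho> (h \<otimes> g))"
      unfolding repD(2)[OF r h g] adj_mult[OF c(2,1)] ..
    finally show "\<rho> h * (\<rho> g * adj (\<rho> g) * adj (\<rho> h)) = \<rho> (h \<otimes> g) * adj (\<rho> (h \<otimes> g))" .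
  qed
  also have "\<dots> = gram d \<rho>"
    unfolding gram_def
  proof (rule msum_reindex[where f = "\<lambda>g. \<rho> g * adj (\<rho> g)"])
    show "bij_betw (\<lambda>g. h \<otimes> g) (carrier G) (carrier G)"
      using h by (intro bij_betw_byWitness[of _ "\<lambda>g. inv h \<otimes> g"]) (auto simp: m_assoc[symmetric])
  qed
  finally show ?thesis .
qed

text \<open>Multiplying by the adjoint of M as well, the diagonal entries become sums of squared
  absolute values of the entries of \<open>M * \<rho> g\<close>. All of these vanish, and the unit
  element gives M.\<close>

lemma gram_injective:
  assumes fin: "finite (carrier G)" and r: "rep G d \<rho>" and M: "M \<in> carrier_mat e d"
    and 0: "M * gram d \<rho> = 0\<^sub>m e d"
  shows "M = 0\<^sub>m e d"
proof (rule eq_matI)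
  have rc: "\<rho> g \<in> carrier_mat d d" if "g \<in> carrier G" for g
    using repD(1)[OF r that] .
  fix i j assume "i < dim_row (0\<^sub>m e d :: complex mat)" "j < dim_col (0\<^sub>m e d :: complex mat)"
  then have ij: "i < e" "j < d"
    by auto
  have aM: "adj M \<in> carrier_mat d e"
    using M by auto
  have "M * gram d \<rho> * adj M = msum e e (\<lambda>g. M * (\<rho> g * adj (\<rho> g)) * adj M) (carrier G)"
  proof -
    have c: "\<rho> g * adj (\<rho> g) \<in> carrier_mat d d" if "g \<in> carrier G" for g
      using rc[OF that] by auto
    have "M * gram d \<rho> = msum e d (\<lambda>g. M * (\<rho> g * adj (\<rho> g))) (carrier G)"
      unfolding gram_def by (rule mult_msum[OF c M])
    then show ?thesis
      using msum_mult[of "carrier G" "\<lambda>g. M * (\<rho> g * adj (\<rho> g))" e d "adj M" e] c M aM by simp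
  qed
  also have "\<dots> = msum e e (\<lambda>g. (M * \<rho> g) * adj (M * \<rho> g)) (carrier G)"
  proof (rule msum_cong)
    fix g assume g: "g \<in> carrier G"
    have ac: "adj (\<rho> g) \<in> carrier_mat d d"
      using rc[OF g] by auto
    have "M * (\<rho> g * adj (\<rho> g)) = M * \<rho> g * adj (\<rho> g)"
      by (rule assoc_mult_mat[symmetric, OF M rc[OF g] ac])
    then have "M * (\<rho> g * adj (\<rho> g)) * adj M = M * \<rho> g * (adj (\<rho> g) * adj M)"
      using assoc_mult_mat[of "M * \<rho> g" e d "adj (\<rho> g)" d "adj M" e] M rc[OF g] ac aM by simp
    then show "M * (\<rho> g * adj (\<rho> g)) * adj M = (M * \<rho> g) * adj (M * \<rho> g)"
      unfolding adj_mult[OF M rc[OF g]] .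
  qed
  finally have "msum e e (\<lambda>g. (M * \<rho> g) * adj (M * \<rho> g)) (carrier G) = 0\<^sub>m e e"
    unfolding 0 using aM by simp
  then have "msum e e (\<lambda>g. (M * \<rho> g) * adj (M * \<rho> g)) (carrier G) $$ (i, i) = 0\<^sub>m e e $$ (i, i)"
    by (rule arg_cong)
  then have z: "(\<Sum>g\<in>carrier G. ((M * \<rho> g) * adj (M * \<rho> g)) $$ (i, i)) = 0"
    unfolding msum_def index_mat(1)[OF ij(1) ij(1)] index_zero_mat(1)[OF ij(1) ij(1)] by (simp only: prod.case)
  have n: "((M * \<rho> g) * adj (M * \<rho> g)) $$ (i, i) = of_real (\<Sum>l<d. (cmod ((M * \<rho> g) $$ (i, l)))\<^sup>2)" if g: "g \<in> carrier G" for g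
  proof -
    have c: "M * \<rho> g \<in> carrier_mat e d"
      using M rc[OF g] by auto
    have "((M * \<rho> g) * adj (M * \<rho> g)) $$ (i, i) = (\<Sum>l<d. (M * \<rho> g) $$ (i, l) * cnj ((M * \<rho> g) $$ (i, l)))"
      by (rule mult_adj_diag[OF c ij(1)])
    also have "\<dots> = (\<Sum>l<d. of_real ((cmod ((M * \<rho> g) $$ (i, l)))\<^sup>2))"
      by (intro sum.cong refl) (rule complex_norm_square[symmetric])
    finally show ?thesis
      by simp
  qed
  have "complex_of_real (\<Sum>g\<in>carrier G. \<Sum>l<d. (cmod ((M * \<rho> g) $$ (i, l)))\<^sup>2)
      = (\<Sum>g\<in>carrier G. of_real (\<Sum>l<d. (cmod ((M * \<rho> g) $$ (i, l)))\<^sup>2))"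
    by (rule of_real_sum)
  also have "\<dots> = (\<Sum>g\<in>carrier G. ((M * \<rho> g) * adj (M * \<rho> g)) $$ (i, i))"
    by (rule sum.cong[OF refl]) (rule n[symmetric])
  finally have "complex_of_real (\<Sum>g\<in>carrier G. \<Sum>l<d. (cmod ((M * \<rho> g) $$ (i, l)))\<^sup>2) = 0"
    unfolding z .
  then have "(\<Sum>g\<in>carrier G. \<Sum>l<d. (cmod ((M * \<rho> g) $$ (i, l)))\<^sup>2) = 0"
    using of_real_eq_0_iff by blast
  then have "(\<Sum>l<d. (cmod ((M * \<rho> \<one>) $$ (i, l)))\<^sup>2) = 0"
    using fin by (subst (asm) sum_nonneg_eq_0_iff) (auto intro: sum_nonneg)
  then have "(cmod ((M * \<rho> \<one>) $$ (i, j)))\<^sup>2 = 0"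
    using ij by (subst (asm) sum_nonneg_eq_0_iff) auto
  then show "M $$ (i, j) = 0\<^sub>m e d $$ (i, j)"
    using M ij by (simp add: repD(3)[OF r])
qed (use M in auto)

text \<open>The inner product is the average trace of the Kronecker product of
  \<open>\<sigma>\<close> with the conjugate of \<open>\<rho>\<close>, hence the dimension of its
  fixed space. Intertwiners times \<open>gram d \<rho>\<close> are fixed vectors, and by
  \<open>gram_injective\<close> independent intertwiners stay independent.\<close>

lemma intertwiners_dependent:
  assumes fin: "finite (carrier G)" and s: "rep G e \<sigma>" and r: "rep G d \<rho>"
    and le: "character_inner G (\<lambda>g\<in>carrier G. mat_trace (\<sigma> g)) \<theta> \<le> 1"
    and \<theta>: "\<And>g. g \<in> carrier G \<Longrightarrow> \<theta> g = mat_trace (\<rho> g)"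
    and P: "P \<in> carrier_mat e d" "P \<noteq> 0\<^sub>m e d" "\<And>g. g \<in> carrier G \<Longrightarrow> P * \<rho> g = \<sigma> g * P"
    and Q: "Q \<in> carrier_mat e d" "\<And>g. g \<in> carrier G \<Longrightarrow> Q * \<rho> g = \<sigma> g * Q"
  shows "\<exists>c. Q = c \<cdot>\<^sub>m P"
proof (rule ccontr)
  assume no: "\<not> ?thesis"
  have rc: "\<rho> g \<in> carrier_mat d d" and sc: "\<sigma> g \<in> carrier_mat e e" if "g \<in> carrier G" for g
    using repD(1)[OF r that] repD(1)[OF s that] by auto
  define \<tau> where "\<tau> g = kron e d (\<sigma> g) (map_mat cnj (\<rho> g))" for g
  have cc: "map_mat cnj (\<rho> g) \<in> carrier_mat d d" if "g \<in> carrier G" for g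
    using rc[OF that] by auto
  have t: "rep G (e * d) \<tau>"
    unfolding rep_def
  proof (intro conjI ballI)
    show "\<tau> g \<in> carrier_mat (e * d) (e * d)" for g
      by (simp add: \<tau>_def kron_def)
    show "\<tau> (g \<otimes> h) = \<tau> g * \<tau> h" if g: "g \<in> carrier G" and h: "h \<in> carrier G" for g h
      unfolding \<tau>_def repD(2)[OF s g h] repD(2)[OF r g h] cnj_mat_mult[OF rc[OF g] rc[OF h]]
      by (rule kron_mult[symmetric, OF sc[OF g] sc[OF h] cc[OF g] cc[OF h]])
    show "\<tau> \<one> = 1\<^sub>m (e * d)"
      unfolding \<tau>_def repD(3)[OF s] repD(3)[OF r]
    proof (rule eq_matI)
      fix i j assume "i < dim_row (1\<^sub>m (e * d) :: complex mat)" "j < dim_col (1\<^sub>m (e * d) :: complex mat)"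
      then have i: "i < e * d" and j: "j < e * d"
        by auto
      have "i = j \<longleftrightarrow> i div d = j div d \<and> i mod d = j mod d"
        by (metis div_mult_mod_eq)
      then show "kron e d (1\<^sub>m e) (map_mat cnj (1\<^sub>m d)) $$ (i, j) = 1\<^sub>m (e * d) $$ (i, j)"
        using i j div_mod_less[OF i] div_mod_less[OF j] by (auto simp: kron_def)
    qed (auto simp: kron_def)
  qed
  let ?S = "gram d \<rho>"
  have Sc: "?S \<in> carrier_mat d d"
    by (simp add: gram_def)
  have fixed: "\<tau> g *\<^sub>v vectorize e d (M * ?S) = vectorize e d (M * ?S)"
    if M: "M \<in> carrier_mat e d" and int: "M * \<rho> g = \<sigma> g * M" and g: "g \<in> carrier G" for M g
  proof -
    have ac: "adj (\<rho> g) \<in> carrier_mat d d"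
      using rc[OF g] by auto
    have "\<sigma> g * (M * ?S * adj (\<rho> g)) = \<sigma> g * (M * (?S * adj (\<rho> g)))"
      unfolding assoc_mult_mat[OF M Sc ac] ..
    also have "\<dots> = \<sigma> g * M * (?S * adj (\<rho> g))"
      by (rule assoc_mult_mat[symmetric, OF sc[OF g] M]) (use Sc ac in auto)
    also have "\<dots> = M * (\<rho> g * (?S * adj (\<rho> g)))"
      unfolding int[symmetric] by (rule assoc_mult_mat[OF M rc[OF g]]) (use Sc ac in auto)
    also have "\<dots> = M * ?S"
      unfolding gram_invariant[OF r g] ..
    finally show ?thesis
      unfolding \<tau>_def using kron_vectorize[OF sc[OF g] cc[OF g], of "M * ?S"] M Sc by simp
  qed
  have PS: "P * ?S \<in> carrier_mat e d" and QS: "Q * ?S \<in> carrier_mat e d"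
    using P Q Sc by auto
  have v0: "vectorize e d (0\<^sub>m e d) = 0\<^sub>v (e * d)"
    using div_mod_less by (intro eq_vecI) (auto simp: vectorize_def)
  have "\<exists>n\<ge>2. (\<Sum>g\<in>carrier G. mat_trace (\<tau> g)) / of_nat (Coset.order G) = of_nat n"
  proof (rule average_trace_ge_2[OF fin t])
    show "vectorize e d (P * ?S) \<in> carrier_vec (e * d)" "vectorize e d (Q * ?S) \<in> carrier_vec (e * d)"
      by (auto simp: vectorize_def)
    show "vectorize e d (P * ?S) \<noteq> 0\<^sub>v (e * d)"
    proof
      assume "vectorize e d (P * ?S) = 0\<^sub>v (e * d)"
      then have "P * ?S = 0\<^sub>m e d"
        by (intro vectorize_inject[OF PS zero_carrier_mat]) (simp only: v0)
      then show False
        using gram_injective[OF fin r P(1)] P(2) by blast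
    qed
    show "\<tau> g *\<^sub>v vectorize e d (P * ?S) = vectorize e d (P * ?S)"
      "\<tau> g *\<^sub>v vectorize e d (Q * ?S) = vectorize e d (Q * ?S)" if "g \<in> carrier G" for g
      using fixed[OF P(1,3)] fixed[OF Q] that by auto
    fix c
    show "vectorize e d (Q * ?S) \<noteq> c \<cdot>\<^sub>v vectorize e d (P * ?S)"
    proof
      assume "vectorize e d (Q * ?S) = c \<cdot>\<^sub>v vectorize e d (P * ?S)"
      also have "\<dots> = vectorize e d (c \<cdot>\<^sub>m (P * ?S))"
      proof (rule eq_vecI)
        fix i assume "i < dim_vec (vectorize e d (c \<cdot>\<^sub>m (P * ?S)))"
        then have i: "i < e * d"
          by (simp add: vectorize_def)
        show "(c \<cdot>\<^sub>v vectorize e d (P * ?S)) $ i = vectorize e d (c \<cdot>\<^sub>m (P * ?S)) $ i"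
          using i index_smult_mat(1)[of "i div d" "P * ?S" "i mod d" c] carrier_matD[OF PS] div_mod_less[OF i]
          by (simp add: vectorize_def del: index_smult_mat index_mult_mat)
      qed (simp add: vectorize_def)
      finally have "Q * ?S = c \<cdot>\<^sub>m (P * ?S)"
        by (intro vectorize_inject[OF QS] smult_carrier_mat PS)
      then have eq: "Q * ?S = (c \<cdot>\<^sub>m P) * ?S"
        unfolding mult_smult_assoc_mat[OF P(1) Sc] .
      have cP: "c \<cdot>\<^sub>m P \<in> carrier_mat e d"
        using P by auto
      have "(Q - c \<cdot>\<^sub>m P) * ?S = Q * ?S - (c \<cdot>\<^sub>m P) * ?S"
        by (rule minus_mult_distrib_mat[OF Q(1) cP Sc])
      also have "\<dots> = 0\<^sub>m e d"
        unfolding eq using cP Sc by (intro minus_r_inv_mat) auto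
      finally have "Q - c \<cdot>\<^sub>m P = 0\<^sub>m e d"
        by (rule gram_injective[OF fin r minus_carrier_mat[OF cP]])
      have "Q = c \<cdot>\<^sub>m P"
      proof (rule eq_matI)
        fix i j assume "i < dim_row (c \<cdot>\<^sub>m P)" "j < dim_col (c \<cdot>\<^sub>m P)"
        then have ij: "i < e" "j < d"
          using P by auto
        have "(Q - c \<cdot>\<^sub>m P) $$ (i, j) = 0\<^sub>m e d $$ (i, j)"
          unfolding \<open>Q - c \<cdot>\<^sub>m P = 0\<^sub>m e d\<close> ..
        then show "Q $$ (i, j) = (c \<cdot>\<^sub>m P) $$ (i, j)"
          using ij P(1) by simp
      qed (use P Q in auto)
      then show False
        using no by blast
    qed
  qed
  then obtain n where n: "n \<ge> 2" "(\<Sum>g\<in>carrier G. mat_trace (\<tau> g)) / of_nat (Coset.order G) = of_nat n"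
    by blast
  have "character_inner G (\<lambda>g\<in>carrier G. mat_trace (\<sigma> g)) \<theta> = (\<Sum>g\<in>carrier G. mat_trace (\<tau> g)) / of_nat (Coset.order G)"
    unfolding character_inner_def
  proof (intro arg_cong2[where f = "(/)"] sum.cong refl)
    fix g assume g: "g \<in> carrier G"
    show "(\<lambda>g\<in>carrier G. mat_trace (\<sigma> g)) g * cnj (\<theta> g) = mat_trace (\<tau> g)"
      unfolding \<tau>_def mat_trace_kron[OF sc[OF g] cc[OF g]] cnj_mat_trace[OF rc[OF g]] \<theta>[OF g] using g by simp
  qed
  then have "(of_nat n :: complex) \<le> 1"
    using le n by simp
  then have "real n \<le> 1"
    by (simp add: less_eq_complex_def)
  then show False
    using n(1) by simp
qed

end

section \<open>Convolution and strong Gelfand pairs\<close>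

context group
begin

definition fourier :: "nat \<Rightarrow> ('a \<Rightarrow> complex mat) \<Rightarrow> ('a \<Rightarrow> complex) \<Rightarrow> complex mat" where
  "fourier d \<rho> c = msum d d (\<lambda>g. c g \<cdot>\<^sub>m \<rho> g) (carrier G)"

lemma fourier_carrier [simp]: "fourier d \<rho> c \<in> carrier_mat d d"
  by (simp add: fourier_def)

lemma fourier_convolution:
  assumes r: "rep G d \<rho>"
  shows "fourier d \<rho> \<phi> * fourier d \<rho> \<psi> = fourier d \<rho> (\<lambda>g. \<Sum>x\<in>carrier G. \<phi> x * \<psi> (inv x \<otimes> g))"
proof -
  have rc: "\<rho> g \<in> carrier_mat d d" if "g \<in> carrier G" for g
    using repD(1)[OF r that] .
  have "fourier d \<rho> \<phi> * fourier d \<rho> \<psi> = msum d d (\<lambda>x. (\<phi> x \<cdot>\<^sub>m \<rho> x) * fourier d \<rho> \<psi>) (carrier G)"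
    unfolding fourier_def[of d \<rho> \<phi>] by (rule msum_mult) (use rc in auto)
  also have "\<dots> = msum d d (\<lambda>x. msum d d (\<lambda>y. (\<phi> x * \<psi> y) \<cdot>\<^sub>m \<rho> (x \<otimes> y)) (carrier G)) (carrier G)"
  proof (rule msum_cong)
    fix x assume x: "x \<in> carrier G"
    have "(\<phi> x \<cdot>\<^sub>m \<rho> x) * fourier d \<rho> \<psi> = msum d d (\<lambda>y. (\<phi> x \<cdot>\<^sub>m \<rho> x) * (\<psi> y \<cdot>\<^sub>m \<rho> y)) (carrier G)"
      unfolding fourier_def by (rule mult_msum) (use rc x in auto)
    also have "\<dots> = msum d d (\<lambda>y. (\<phi> x * \<psi> y) \<cdot>\<^sub>m \<rho> (x \<otimes> y)) (carrier G)"
    proof (rule msum_cong)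
      fix y assume y: "y \<in> carrier G"
      have "(\<phi> x \<cdot>\<^sub>m \<rho> x) * (\<psi> y \<cdot>\<^sub>m \<rho> y) = \<phi> x \<cdot>\<^sub>m (\<rho> x * (\<psi> y \<cdot>\<^sub>m \<rho> y))"
        by (rule mult_smult_assoc_mat[OF rc[OF x] smult_carrier_mat[OF rc[OF y]]])
      also have "\<dots> = \<phi> x \<cdot>\<^sub>m (\<psi> y \<cdot>\<^sub>m (\<rho> x * \<rho> y))"
        unfolding mult_smult_distrib[OF rc[OF x] rc[OF y]] ..
      also have "\<dots> = (\<phi> x * \<psi> y) \<cdot>\<^sub>m \<rho> (x \<otimes> y)"
        unfolding repD(2)[OF r x y] by (intro eq_matI) auto
      finally show "(\<phi> x \<cdot>\<^sub>m \<rho> x) * (\<psi> y \<cdot>\<^sub>m \<rho> y) = (\<phi> x * \<psi> y) \<cdot>\<^sub>m \<rho> (x \<otimes> y)" .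
    qed
    finally show "(\<phi> x \<cdot>\<^sub>m \<rho> x) * fourier d \<rho> \<psi> = msum d d (\<lambda>y. (\<phi> x * \<psi> y) \<cdot>\<^sub>m \<rho> (x \<otimes> y)) (carrier G)" .
  qed
  also have "\<dots> = fourier d \<rho> (\<lambda>g. \<Sum>x\<in>carrier G. \<phi> x * \<psi> (inv x \<otimes> g))" (is "?L = ?R")
  proof (rule eq_matI)
    fix i j assume "i < dim_row ?R" "j < dim_col ?R"
    then have ij: "i < d" "j < d"
      by (simp_all add: fourier_def)
    have e: "(c \<cdot>\<^sub>m \<rho> g) $$ (i, j) = c * \<rho> g $$ (i, j)" if "g \<in> carrier G" for c g
      using rc[OF that] ij by simp
    have "?L $$ (i, j) = (\<Sum>x\<in>carrier G. \<Sum>y\<in>carrier G. \<phi> x * \<psi> y * \<rho> (x \<otimes> y) $$ (i, j))"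
      unfolding msum_def using ij by (simp add: e)
    also have "\<dots> = (\<Sum>x\<in>carrier G. \<Sum>g\<in>carrier G. \<phi> x * \<psi> (inv x \<otimes> g) * \<rho> g $$ (i, j))"
    proof (rule sum.cong[OF refl])
      fix x assume x: "x \<in> carrier G"
      have b: "bij_betw (\<lambda>y. x \<otimes> y) (carrier G) (carrier G)"
        using x by (intro bij_betw_byWitness[of _ "\<lambda>y. inv x \<otimes> y"]) (auto simp: m_assoc[symmetric])
      have "(\<Sum>y\<in>carrier G. \<phi> x * \<psi> (inv x \<otimes> (x \<otimes> y)) * \<rho> (x \<otimes> y) $$ (i, j))
          = (\<Sum>g\<in>carrier G. \<phi> x * \<psi> (inv x \<otimes> g) * \<rho> g $$ (i, j))"
        by (rule sum.reindex_bij_betw[OF b])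
      then show "(\<Sum>y\<in>carrier G. \<phi> x * \<psi> y * \<rho> (x \<otimes> y) $$ (i, j))
          = (\<Sum>g\<in>carrier G. \<phi> x * \<psi> (inv x \<otimes> g) * \<rho> g $$ (i, j))"
        using x by (simp add: m_assoc[symmetric])
    qed
    also have "\<dots> = (\<Sum>g\<in>carrier G. \<Sum>x\<in>carrier G. \<phi> x * \<psi> (inv x \<otimes> g) * \<rho> g $$ (i, j))"
      by (rule sum.swap)
    also have "\<dots> = ?R $$ (i, j)"
      unfolding fourier_def msum_def using ij by (simp add: e sum_distrib_right)
    finally show "?L $$ (i, j) = ?R $$ (i, j)" .
  qed (simp_all add: fourier_def)
  finally show ?thesis .
qed

lemma fourier_commute:
  assumes r: "rep G d \<rho>" and h: "h \<in> carrier G"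
    and inv: "\<And>g. g \<in> carrier G \<Longrightarrow> c (h \<otimes> g \<otimes> inv h) = c g"
  shows "\<rho> h * fourier d \<rho> c = fourier d \<rho> c * \<rho> h"
proof -
  have rc: "\<rho> g \<in> carrier_mat d d" if "g \<in> carrier G" for g
    using repD(1)[OF r that] .
  have "\<rho> h * fourier d \<rho> c = msum d d (\<lambda>g. \<rho> h * (c g \<cdot>\<^sub>m \<rho> g)) (carrier G)"
    unfolding fourier_def by (rule mult_msum) (use rc h in auto)
  also have "\<dots> = msum d d (\<lambda>g. (c (h \<otimes> g \<otimes> inv h) \<cdot>\<^sub>m \<rho> (h \<otimes> g \<otimes> inv h)) * \<rho> h) (carrier G)"
  proof (rule msum_cong)
    fix g assume g: "g \<in> carrier G"
    have k: "h \<otimes> g \<otimes> inv h \<in> carrier G" "h \<otimes> g = h \<otimes> g \<otimes> inv h \<otimes> h"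
      using g h by (auto simp: m_assoc)
    have "\<rho> h * (c g \<cdot>\<^sub>m \<rho> g) = c g \<cdot>\<^sub>m (\<rho> h * \<rho> g)"
      by (rule mult_smult_distrib[OF rc[OF h] rc[OF g]])
    also have "\<dots> = c g \<cdot>\<^sub>m (\<rho> (h \<otimes> g \<otimes> inv h) * \<rho> h)"
      unfolding repD(2)[OF r h g, symmetric] repD(2)[OF r k(1) h, symmetric] k(2)[symmetric] ..
    also have "\<dots> = (c g \<cdot>\<^sub>m \<rho> (h \<otimes> g \<otimes> inv h)) * \<rho> h"
      by (rule mult_smult_assoc_mat[symmetric, OF rc[OF k(1)] rc[OF h]])
    finally show "\<rho> h * (c g \<cdot>\<^sub>m \<rho> g) = (c (h \<otimes> g \<otimes> inv h) \<cdot>\<^sub>m \<rho> (h \<otimes> g \<otimes> inv h)) * \<rho> h"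
      unfolding inv[OF g] .
  qed
  also have "\<dots> = msum d d (\<lambda>g. (c g \<cdot>\<^sub>m \<rho> g) * \<rho> h) (carrier G)"
  proof (rule msum_reindex[where f = "\<lambda>g. (c g \<cdot>\<^sub>m \<rho> g) * \<rho> h"])
    show "bij_betw (\<lambda>g. h \<otimes> g \<otimes> inv h) (carrier G) (carrier G)"
    proof (rule bij_betw_byWitness[of _ "\<lambda>g. inv h \<otimes> g \<otimes> h"])
      show "\<forall>a\<in>carrier G. inv h \<otimes> (h \<otimes> a \<otimes> inv h) \<otimes> h = a" "\<forall>a\<in>carrier G. h \<otimes> (inv h \<otimes> a \<otimes> h) \<otimes> inv h = a"
        using h by (simp_all add: m_assoc inv_solve_left')
          (simp_all add: m_assoc[symmetric])
    qed (use h in auto)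
  qed
  also have "\<dots> = fourier d \<rho> c * \<rho> h"
    unfolding fourier_def by (rule msum_mult[symmetric]) (use rc h in auto)
  finally show ?thesis .
qed

lemma regular_representation:
  assumes e: "bij_betw e {..<n} (carrier G)"
  shows "rep G n (\<lambda>g. Matrix.mat n n (\<lambda>(i, j). if e i = g \<otimes> e j then 1 else 0))" (is "rep G n ?r")
  unfolding rep_def
proof (intro conjI ballI)
  have ec: "e i \<in> carrier G" if "i < n" for i
    using bij_betwE[OF e] that by auto
  have ei: "e i = e j \<longleftrightarrow> i = j" if "i < n" "j < n" for i j
    using bij_betw_imp_inj_on[OF e] that by (auto simp: inj_on_eq_iff)
  show "?r g \<in> carrier_mat n n" for g
    by simp
  show "?r (g \<otimes> h) = ?r g * ?r h" if gh: "g \<in> carrier G" "h \<in> carrier G" for g h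
  proof (rule eq_matI)
    fix i j assume "i < dim_row (?r g * ?r h)" "j < dim_col (?r g * ?r h)"
    then have ij: "i < n" "j < n"
      by auto
    obtain k where k: "k < n" "e k = h \<otimes> e j"
      using bij_betw_imp_surj_on[OF e] ec[OF ij(2)] gh m_closed[of h "e j"] by (metis imageE lessThan_iff)
    have "(?r g * ?r h) $$ (i, j) = (\<Sum>l<n. (if e i = g \<otimes> e l then 1 else 0) * (if e l = h \<otimes> e j then 1 else 0))"
      using ij by (simp add: scalar_prod_def atLeast0LessThan)
    also have "\<dots> = (\<Sum>l<n. if l = k then (if e i = g \<otimes> e l then 1 else 0) else 0)"
      by (rule sum.cong[OF refl]) (use k ei in \<open>auto simp flip: k(2)\<close>)
    also have "\<dots> = (if e i = g \<otimes> e k then 1 else 0)"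
      using k(1) by simp
    finally show "?r (g \<otimes> h) $$ (i, j) = (?r g * ?r h) $$ (i, j)"
      using ij gh ec by (simp add: k(2) m_assoc)
  qed auto
  show "?r \<one> = 1\<^sub>m n"
    using ec ei by (intro eq_matI) auto
qed

text \<open>In the regular representation the transform of c maps the basis vector of the unit
  element to the vector of values of c. If that is nonzero, some intertwiner to an irreducible
  representation does not kill it, and the transform there is nonzero too.\<close>

lemma fourier_injective:
  assumes fin: "finite (carrier G)"
    and 0: "\<And>d \<rho>. irreducible_representation G d \<rho> \<Longrightarrow> fourier d \<rho> c = 0\<^sub>m d d"
    and g: "g \<in> carrier G"
  shows "c g = 0"
proof (rule ccontr)
  assume ne: "c g \<noteq> 0"
  obtain e where e: "bij_betw e {..<card (carrier G)} (carrier G)"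
    using ex_bij_betw_nat_finite[OF fin] by (auto simp: atLeast0LessThan)
  define n where "n = card (carrier G)"
  define r where "r = (\<lambda>g. Matrix.mat n n (\<lambda>(i, j). if e i = g \<otimes> e j then 1 else (0 :: complex)))"
  have r: "rep G n r"
    unfolding r_def n_def by (rule regular_representation[OF e])
  have rc: "r g \<in> carrier_mat n n" for g
    by (simp add: r_def)
  have surj: "\<exists>i<n. e i = g" if "g \<in> carrier G" for g
    using bij_betw_imp_surj_on[OF e] that unfolding n_def by (metis imageE lessThan_iff)
  have ec: "e i \<in> carrier G" if "i < n" for i
    using bij_betwE[OF e] that by (auto simp: n_def)
  obtain k where k: "k < n" "e k = \<one>"
    using surj by blast
  define v where "v = Matrix.vec n (\<lambda>i. c (e i))"
  have v: "v \<in> carrier_vec n"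
    by (simp add: v_def)
  have "v \<noteq> 0\<^sub>v n"
  proof
    assume "v = 0\<^sub>v n"
    then have "v $ i = 0" if "i < n" for i
      using that by simp
    then show False
      using surj[OF g] ne by (auto simp: v_def)
  qed
  then obtain m \<sigma> P where \<sigma>: "irreducible_representation G m \<sigma>" and P: "P \<in> carrier_mat m n"
    and int: "\<And>g. g \<in> carrier G \<Longrightarrow> P * r g = \<sigma> g * P" and Pv: "P *\<^sub>v v \<noteq> 0\<^sub>v m"
    using separating_irreducible[OF fin r v] by blast
  have s: "rep G m \<sigma>"
    using \<sigma> by (simp add: irreducible_representation_def representation_iff_rep)
  have sc: "\<sigma> g \<in> carrier_mat m m" if "g \<in> carrier G" for g
    using repD(1)[OF s that] .
  have "P * fourier n r c = msum m n (\<lambda>g. P * (c g \<cdot>\<^sub>m r g)) (carrier G)"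
    unfolding fourier_def by (rule mult_msum) (use rc P in auto)
  also have "\<dots> = msum m n (\<lambda>g. (c g \<cdot>\<^sub>m \<sigma> g) * P) (carrier G)"
  proof (rule msum_cong)
    fix g assume g: "g \<in> carrier G"
    show "P * (c g \<cdot>\<^sub>m r g) = (c g \<cdot>\<^sub>m \<sigma> g) * P"
      unfolding mult_smult_distrib[OF P rc] mult_smult_assoc_mat[OF sc[OF g] P] int[OF g] ..
  qed
  also have "\<dots> = fourier m \<sigma> c * P"
    unfolding fourier_def by (rule msum_mult[symmetric]) (use sc P in auto)
  also have "\<dots> = 0\<^sub>m m n"
    unfolding 0[OF \<sigma>] using P by simp
  finally have "P * fourier n r c = 0\<^sub>m m n" .
  moreover have "fourier n r c *\<^sub>v unit_vec n k = v"
  proof (rule eq_vecI)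
    fix i assume "i < dim_vec v"
    then have i: "i < n"
      by (simp add: v_def)
    have "(fourier n r c *\<^sub>v unit_vec n k) $ i = fourier n r c $$ (i, k)"
      using i k(1) carrier_matD[OF fourier_carrier[of n r c]] by (simp add: scalar_prod_right_unit)
    also have "\<dots> = (\<Sum>g\<in>carrier G. c g * (if e i = g \<otimes> e k then 1 else 0))"
      unfolding fourier_def msum_def using i k(1) by (simp add: r_def)
    also have "\<dots> = (\<Sum>g\<in>carrier G. if g = e i then c g else 0)"
      by (rule sum.cong[OF refl]) (auto simp: k(2))
    also have "\<dots> = c (e i)"
      using fin ec[OF i] by simp
    finally show "(fourier n r c *\<^sub>v unit_vec n k) $ i = v $ i"
      using i by (simp add: v_def)
  qed (simp add: v_def fourier_def)
  ultimately have "P *\<^sub>v v = 0\<^sub>m m n *\<^sub>v unit_vec n k"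
    using assoc_mult_mat_vec[OF P fourier_carrier, of "unit_vec n k" r c] by simp
  also have "\<dots> = 0\<^sub>v m"
    by (intro eq_vecI) auto
  finally show False
    using Pv by blast
qed

text \<open>Let P intertwine the restriction to \<open>H\<close> with an irreducible representation.
  Then P X and P Y are intertwiners as well, so multiplicity at most one makes them scalar multiples
  of P, and P kills X Y - Y X. Such P separate vectors.\<close>

lemma commutant_commutative:
  assumes fin: "finite (carrier G)" and sg: "strong_gelfand_subgroup H G"
    and ir: "irreducible_representation G d \<rho>"
    and X: "X \<in> carrier_mat d d" "\<And>h. h \<in> H \<Longrightarrow> \<rho> h * X = X * \<rho> h"
    and Y: "Y \<in> carrier_mat d d" "\<And>h. h \<in> H \<Longrightarrow> \<rho> h * Y = Y * \<rho> h"
  shows "X * Y = Y * X"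
proof (rule ccontr)
  assume ne: "X * Y \<noteq> Y * X"
  let ?K = "G\<lparr>carrier := H\<rparr>"
  have H: "subgroup H G"
    using sg by (simp add: strong_gelfand_subgroup_def)
  then interpret K: group ?K
    by (rule subgroup.subgroup_is_group) (rule is_group)
  have finK: "finite (carrier ?K)"
    using finite_subset[OF subgroup.subset[OF H] fin] by simp
  have r: "rep G d \<rho>"
    using ir by (simp add: irreducible_representation_def representation_iff_rep)
  have rK: "rep ?K d \<rho>"
    using r subgroup.subset[OF H] by (auto simp: rep_def)
  have rc: "\<rho> h \<in> carrier_mat d d" if "h \<in> H" for h
    using repD(1)[OF rK] that by simp
  have XY: "X * Y \<in> carrier_mat d d" and YX: "Y * X \<in> carrier_mat d d"
    using X Y by auto
  obtain w where w: "w \<in> carrier_vec d" "(X * Y) *\<^sub>v w \<noteq> (Y * X) *\<^sub>v w"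
    using mat_eqI_vec[OF XY YX] ne by blast
  define v where "v = (X * Y - Y * X) *\<^sub>v w"
  have v: "v \<in> carrier_vec d"
    unfolding v_def by (rule mult_mat_vec_carrier[OF minus_carrier_mat[OF YX] w(1)])
  have v_eq: "v = (X * Y) *\<^sub>v w - (Y * X) *\<^sub>v w"
    unfolding v_def by (rule minus_mult_distrib_mat_vec[OF XY YX w(1)])
  have v0: "v \<noteq> 0\<^sub>v d"
  proof
    assume v0: "v = 0\<^sub>v d"
    have "(X * Y) *\<^sub>v w = (Y * X) *\<^sub>v w"
    proof (rule eq_vecI)
      fix i assume "i < dim_vec ((Y * X) *\<^sub>v w)"
      then have i: "i < d"
        using Y by simp
      have "((X * Y) *\<^sub>v w - (Y * X) *\<^sub>v w) $ i = 0"
        using i v0 unfolding v_eq by simp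
      moreover have "i < dim_vec ((Y * X) *\<^sub>v w)"
        using i Y by simp
      ultimately show "((X * Y) *\<^sub>v w) $ i = ((Y * X) *\<^sub>v w) $ i"
        by (simp only: index_minus_vec(1) right_minus_eq)
    qed (use X Y in simp)
    then show False
      using w(2) by blast
  qed
  obtain m \<sigma> P where \<sigma>: "irreducible_representation ?K m \<sigma>" and P: "P \<in> carrier_mat m d"
    and int: "\<And>h. h \<in> H \<Longrightarrow> P * \<rho> h = \<sigma> h * P" and Pv: "P *\<^sub>v v \<noteq> 0\<^sub>v m"
    using K.separating_irreducible[OF finK rK v v0] by auto
  have s: "rep ?K m \<sigma>"
    using \<sigma> by (simp add: irreducible_representation_def K.representation_iff_rep)
  have sc: "\<sigma> h \<in> carrier_mat m m" if "h \<in> H" for h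
    using repD(1)[OF s] that by simp
  have P0: "P \<noteq> 0\<^sub>m m d"
    using Pv v by auto
  let ?\<theta> = "restrict (\<lambda>g\<in>carrier G. mat_trace (\<rho> g)) H"
  have "(\<lambda>g\<in>carrier G. mat_trace (\<rho> g)) \<in> irreducible_characters G"
    "(\<lambda>h\<in>carrier ?K. mat_trace (\<sigma> h)) \<in> irreducible_characters ?K"
    using ir \<sigma> by (auto simp: irreducible_characters_def)
  then have le: "character_inner ?K (\<lambda>h\<in>carrier ?K. mat_trace (\<sigma> h)) ?\<theta> \<le> 1"
    using sg unfolding strong_gelfand_subgroup_def by blast
  have dep: "\<exists>c. P * Z = c \<cdot>\<^sub>m P" if Z: "Z \<in> carrier_mat d d" "\<And>h. h \<in> H \<Longrightarrow> \<rho> h * Z = Z * \<rho> h" for Z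
  proof (rule K.intertwiners_dependent[OF finK s rK le _ P P0])
    show "?\<theta> g = mat_trace (\<rho> g)" if "g \<in> carrier ?K" for g
      using that subgroup.subset[OF H] by auto
    show "P * \<rho> g = \<sigma> g * P" if "g \<in> carrier ?K" for g
      using int that by simp
    show "P * Z \<in> carrier_mat m d"
      using P Z by auto
    fix h assume "h \<in> carrier ?K"
    then have h: "h \<in> H"
      by simp
    have "P * Z * \<rho> h = P * (\<rho> h * Z)"
      unfolding Z(2)[OF h] by (rule assoc_mult_mat[OF P Z(1) rc[OF h]])
    also have "\<dots> = P * \<rho> h * Z"
      by (rule assoc_mult_mat[symmetric, OF P rc[OF h] Z(1)])
    also have "\<dots> = \<sigma> h * (P * Z)"
      unfolding int[OF h] by (rule assoc_mult_mat[OF sc[OF h] P Z(1)])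
    finally show "P * Z * \<rho> h = \<sigma> h * (P * Z)" .
  qed
  obtain a b where a: "P * X = a \<cdot>\<^sub>m P" and b: "P * Y = b \<cdot>\<^sub>m P"
    using dep[OF X] dep[OF Y] by blast
  have "P * (X * Y) = (a * b) \<cdot>\<^sub>m P"
  proof -
    have "P * (X * Y) = P * X * Y"
      by (rule assoc_mult_mat[symmetric, OF P X(1) Y(1)])
    also have "\<dots> = a \<cdot>\<^sub>m (b \<cdot>\<^sub>m P)"
      unfolding a mult_smult_assoc_mat[OF P Y(1)] b ..
    finally show ?thesis
      by (intro eq_matI) auto
  qed
  moreover have "P * (Y * X) = (a * b) \<cdot>\<^sub>m P"
  proof -
    have "P * (Y * X) = P * Y * X"
      by (rule assoc_mult_mat[symmetric, OF P Y(1) X(1)])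
    also have "\<dots> = b \<cdot>\<^sub>m (a \<cdot>\<^sub>m P)"
      unfolding b mult_smult_assoc_mat[OF P X(1)] a ..
    finally show ?thesis
      by (intro eq_matI) (auto simp: ac_simps)
  qed
  ultimately have eq: "P * (X * Y) = P * (Y * X)"
    by simp
  have "P *\<^sub>v v = P *\<^sub>v ((X * Y) *\<^sub>v w) - P *\<^sub>v ((Y * X) *\<^sub>v w)"
    unfolding v_eq by (rule mult_minus_distrib_mat_vec[OF P]) (use XY YX w in auto)
  also have "\<dots> = (P * (X * Y)) *\<^sub>v w - (P * (Y * X)) *\<^sub>v w"
    unfolding assoc_mult_mat_vec[OF P XY w(1)] assoc_mult_mat_vec[OF P YX w(1)] ..
  also have "\<dots> = 0\<^sub>v m"
    unfolding eq using P YX w(1) by (intro minus_cancel_vec) auto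
  finally show False
    using Pv by blast
qed

theorem strong_gelfand_convolution_commute:
  assumes fin: "finite (carrier G)" and sg: "strong_gelfand_subgroup H G"
    and \<phi>: "\<And>h g. h \<in> H \<Longrightarrow> g \<in> carrier G \<Longrightarrow> \<phi> (h \<otimes> g \<otimes> inv h) = (\<phi> g :: complex)"
    and \<psi>: "\<And>h g. h \<in> H \<Longrightarrow> g \<in> carrier G \<Longrightarrow> \<psi> (h \<otimes> g \<otimes> inv h) = \<psi> g"
    and g: "g \<in> carrier G"
  shows "(\<Sum>x\<in>carrier G. \<phi> x * \<psi> (inv x \<otimes> g)) = (\<Sum>x\<in>carrier G. \<psi> x * \<phi> (inv x \<otimes> g))"
proof -
  let ?c = "\<lambda>\<phi> \<psi> g. \<Sum>x\<in>carrier G. \<phi> x * \<psi> (inv x \<otimes> g) :: complex"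
  have H: "H \<subseteq> carrier G"
    using sg by (simp add: strong_gelfand_subgroup_def subgroup.subset)
  have "?c \<phi> \<psi> g - ?c \<psi> \<phi> g = 0"
  proof (rule fourier_injective[OF fin _ g])
    fix d \<rho> assume ir: "irreducible_representation G d \<rho>"
    then have r: "rep G d \<rho>"
      by (simp add: irreducible_representation_def representation_iff_rep)
    have "fourier d \<rho> (?c \<phi> \<psi>) = fourier d \<rho> (?c \<psi> \<phi>)"
      unfolding fourier_convolution[OF r, symmetric]
    proof (rule commutant_commutative[OF fin sg ir])
      show "\<rho> h * fourier d \<rho> \<phi> = fourier d \<rho> \<phi> * \<rho> h" "\<rho> h * fourier d \<rho> \<psi> = fourier d \<rho> \<psi> * \<rho> h"
        if "h \<in> H" for h
        using that \<phi> \<psi> H by (auto intro!: fourier_commute[OF r])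
    qed (rule fourier_carrier)+
    moreover have "fourier d \<rho> (\<lambda>g. a g - b g) = fourier d \<rho> a - fourier d \<rho> b" (is "?L = ?R")
      for a b :: "'a \<Rightarrow> complex"
    proof (rule eq_matI)
      fix i j assume "i < dim_row ?R" "j < dim_col ?R"
      then have ij: "i < d" "j < d"
        by (simp_all add: fourier_def)
      have e: "(c \<cdot>\<^sub>m \<rho> g) $$ (i, j) = c * \<rho> g $$ (i, j)" if "g \<in> carrier G" for c g
        using repD(1)[OF r that] ij by simp
      have "?L $$ (i, j) = (\<Sum>g\<in>carrier G. a g * \<rho> g $$ (i, j) - b g * \<rho> g $$ (i, j))"
        unfolding fourier_def msum_def using ij by (simp add: e left_diff_distrib)
      then show "?L $$ (i, j) = ?R $$ (i, j)"
        unfolding fourier_def msum_def using ij by (simp add: e sum_subtractf)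
    qed (simp_all add: fourier_def)
    ultimately show "fourier d \<rho> (\<lambda>g. ?c \<phi> \<psi> g - ?c \<psi> \<phi> g) = 0\<^sub>m d d"
      using minus_r_inv_mat[OF fourier_carrier] by simp
  qed
  then show ?thesis
    by simp
qed

end

section \<open>The symplectic group\<close>

context
  fixes B :: "bit^'n \<Rightarrow> bit^'n \<Rightarrow> bit"
  assumes form: "symplectic_form B"
begin

lemma form_add: "B (u + v) w = B u w + B v w" "B w (u + v) = B w u + B w v"
proof -
  interpret L: Vector_Spaces.linear "(*s)" "(*)" "\<lambda>u. B u w"
    using form by (simp add: symplectic_form_def)
  interpret R: Vector_Spaces.linear "(*s)" "(*)" "\<lambda>u. B w u"
    using form by (simp add: symplectic_form_def)
  show "B (u + v) w = B u w + B v w" "B w (u + v) = B w u + B w v"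
    by (rule L.add, rule R.add)
qed

lemma form_alt: "B v v = 0"
  using form by (simp add: symplectic_form_def)

lemma bit_add_eq_1: "a + b = 1 \<longleftrightarrow> (a = 1) \<noteq> (b = (1 :: bit))"
  by (cases a; cases b) auto

lemma bit_vec_add_self: "v + v = (0 :: bit^'n)"
proof -
  have "a + a = 0" for a :: bit
    by (metis diff_self minus_bit_def)
  then have "0 + (v + v) = 0"
    by (simp only: Finite_Cartesian_Product.vec_eq_iff vector_add_component add_0_right simp_thms)
  then show ?thesis
    by (simp only: add_0_left)
qed

lemma form_sym: "B u v = 1 \<longleftrightarrow> B v u = 1"
proof -
  have "B (u + v) (u + v) = B u v + B v u"
    unfolding form_add unfolding form_alt add_0_left add_0_right by (rule add.commute)
  then have "B u v + B v u = 0"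
    unfolding form_alt ..
  moreover have "a + b = 0 \<Longrightarrow> a = 1 \<longleftrightarrow> b = 1" for a b :: bit
    by (cases a; cases b) simp_all
  ultimately show ?thesis
    by blast
qed

lemma symplectic_of_form: "symplectic (\<lambda>u v. B u v = 1)"
proof
  show "\<exists>w. B v w = 1" if "v \<noteq> 0" for v
    using form that unfolding symplectic_form_def by (metis bit_not_one_iff)
qed (auto simp: form_alt form_add bit_add_eq_1 form_sym bit_vec_add_self)

interpretation symplectic "\<lambda>u v. B u v = 1"
  by (rule symplectic_of_form)

text \<open>Linearity is additivity, the only scalars being 0 and 1, and a \<open>bit\<close> is
  determined by whether it equals 1.\<close>

lemma carrier_Sp_eq: "carrier (Sp B) = isom"
proof -
  have "Vector_Spaces.linear (*s) (*s) f" if f: "\<And>u v. f (u + v) = f u + f v" for f :: "bit^'n \<Rightarrow> bit^'n"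
  proof
    have "f 0 = 0"
      using f[of 0 0] by simp
    then show "f (r *s x) = r *s f x" for r x
      by (cases r) auto
  qed (rule f)
  moreover have "f (u + v) = f u + f v" if "Vector_Spaces.linear (*s) (*s) f" for f :: "bit^'n \<Rightarrow> bit^'n" and u v
  proof -
    interpret Vector_Spaces.linear "(*s)" "(*s)" f
      by (rule that)
    show ?thesis
      by (rule add)
  qed
  moreover have "B u v = B u' v' \<longleftrightarrow> (B u v = 1) = (B u' v' = 1)" for u v u' v'
    by (metis bit_not_one_iff)
  ultimately show ?thesis
    unfolding Sp_def isom_def by auto
qed

lemma mult_Sp: "f \<otimes>\<^bsub>Sp B\<^esub> g = f \<circ> g"
  by (simp add: Sp_def)

lemma one_Sp: "\<one>\<^bsub>Sp B\<^esub> = id"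
  by (simp add: Sp_def)

lemma inv_Sp:
  assumes "f \<in> carrier (Sp B)"
  shows "inv\<^bsub>Sp B\<^esub> f = inv_into UNIV f"
proof -
  interpret group "Sp B"
    by (rule group_Sp)
  show ?thesis
    using assms isom_inv by (intro inv_equality) (auto simp: carrier_Sp_eq mult_Sp one_Sp fun_eq_iff)
qed

lemma transvection_eq_tv: "transvection B v = tv v"
  by (auto simp: transvection_def tv_def fun_eq_iff)

lemma commutative_pair_of_strong_gelfand:
  assumes n: "CARD('n) \<ge> 8" and sg: "strong_gelfand_subgroup H (Sp B)"
  shows "commutative_pair (\<lambda>u v. B u v = 1) H"
proof unfold_locales
  have sub: "subgroup H (Sp B)"
    using sg by (simp add: strong_gelfand_subgroup_def)
  show H: "H \<subseteq> isom"
    using subgroup.subset[OF sub] by (simp add: carrier_Sp_eq)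
  show "id \<in> H"
    using subgroup.one_closed[OF sub] by (simp add: one_Sp)
  show "h \<circ> k \<in> H" if "h \<in> H" "k \<in> H" for h k
    using subgroup.m_closed[OF sub that] by (simp add: mult_Sp)
  show "inv_into UNIV h \<in> H" if "h \<in> H" for h
    using subgroup.m_inv_closed[OF sub that] inv_Sp[of h] H that by (auto simp: carrier_Sp_eq)
  fix \<phi> \<psi> :: "(bit^'n \<Rightarrow> bit^'n) \<Rightarrow> int" and g
  assume \<phi>: "\<And>h g. h \<in> H \<Longrightarrow> g \<in> isom \<Longrightarrow> \<phi> (h \<circ> g \<circ> inv_into UNIV h) = \<phi> g"
    and \<psi>: "\<And>h g. h \<in> H \<Longrightarrow> g \<in> isom \<Longrightarrow> \<psi> (h \<circ> g \<circ> inv_into UNIV h) = \<psi> g" and g: "g \<in> isom"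
  have "(\<Sum>x\<in>carrier (Sp B). of_int (\<phi> x) * of_int (\<psi> (inv\<^bsub>Sp B\<^esub> x \<otimes>\<^bsub>Sp B\<^esub> g)))
      = (\<Sum>x\<in>carrier (Sp B). of_int (\<psi> x) * complex_of_int (\<phi> (inv\<^bsub>Sp B\<^esub> x \<otimes>\<^bsub>Sp B\<^esub> g)))"
    using H \<phi> \<psi> g
    by (intro group.strong_gelfand_convolution_commute[OF group_Sp finite_Sp sg])
      (auto simp: mult_Sp inv_Sp carrier_Sp_eq subset_iff)
  also have "(\<Sum>x\<in>carrier (Sp B). of_int (\<phi> x) * of_int (\<psi> (inv\<^bsub>Sp B\<^esub> x \<otimes>\<^bsub>Sp B\<^esub> g)))
      = complex_of_int (\<Sum>x\<in>isom. \<phi> x * \<psi> (inv_into UNIV x \<circ> g))"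
    by (simp add: carrier_Sp_eq[symmetric] mult_Sp inv_Sp)
  also have "(\<Sum>x\<in>carrier (Sp B). of_int (\<psi> x) * of_int (\<phi> (inv\<^bsub>Sp B\<^esub> x \<otimes>\<^bsub>Sp B\<^esub> g)))
      = complex_of_int (\<Sum>x\<in>isom. \<psi> x * \<phi> (inv_into UNIV x \<circ> g))"
    by (simp add: carrier_Sp_eq[symmetric] mult_Sp inv_Sp)
  finally show "(\<Sum>x\<in>isom. \<phi> x * \<psi> (inv_into UNIV x \<circ> g)) = (\<Sum>x\<in>isom. \<psi> x * \<phi> (inv_into UNIV x \<circ> g))"
    by (simp only: of_int_eq_iff)
next
  have "bij (vec_nth :: bit^'n \<Rightarrow> 'n \<Rightarrow> bit)"
    by (intro o_bij[of vec_lambda]) (auto simp: fun_eq_iff)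
  then have "CARD(bit^'n) = CARD('n \<Rightarrow> bit)"
    by (rule bij_betw_same_card)
  moreover have "(UNIV :: bit set) = {0, 1}"
    by auto
  then have "CARD(bit) = card {0, 1 :: bit}"
    by (rule arg_cong)
  ultimately have eq: "CARD(bit^'n) = 2 ^ CARD('n)"
    by (simp add: card_fun numeral_2_eq_2)
  show "2 ^ 8 \<le> CARD(bit^'n)"
    unfolding eq by (rule power_increasing[OF n]) simp
qed

end

theorem corollary1p5:
  fixes B :: "bit^'n \<Rightarrow> bit^'n \<Rightarrow> bit"
    and H :: "(bit^'n \<Rightarrow> bit^'n) set"
  assumes "even CARD('n)" and "CARD('n) \<ge> 8"
    and "symplectic_form B"
    and "strong_gelfand_subgroup H (Sp B)"
    and "H \<noteq> carrier (Sp B)"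
  shows "transitive_action ((Sp B)\<lparr>carrier := H\<rparr>) (transvections B)
           (conjugation (Sp B) (transvections B))
         \<and> H \<inter> transvections B = {}"
proof
  interpret commutative_pair "\<lambda>u v. B u v = 1" H
    by (rule commutative_pair_of_strong_gelfand[OF assms(3,2,4)])
  let ?T = "transvections B" and ?\<phi> = "conjugation (Sp B) (transvections B)"
  have sub: "subgroup H (Sp B)"
    using assms(4) by (simp add: strong_gelfand_subgroup_def)
  have conj: "?\<phi> h (tv v) = tv (h v)" if h: "h \<in> H" and v: "v \<noteq> 0" for h v
  proof -
    have hi: "h \<in> isom"
      using H_isom h by blast
    have "tv v \<in> ?T"
      using v by (auto simp: transvections_def transvection_eq_tv[OF assms(3)])
    then show ?thesis
      using hi inv_Sp[OF assms(3), of h]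
      by (simp add: conjugation_def mult_Sp[OF assms(3)] carrier_Sp_eq[OF assms(3)] isom_conj_tv)
  qed
  have T: "?T = tv ` (- {0})"
    by (auto simp: transvections_def transvection_eq_tv[OF assms(3)])
  have nz: "h v \<noteq> 0" if "h \<in> H" "v \<noteq> 0" for h v
    using isom_inj[of h v 0] H_isom that by auto
  have ext: "?\<phi> h \<in> extensional ?T" for h
    by (simp add: conjugation_def)
  have maps: "?\<phi> h x \<in> ?T" if "h \<in> H" "x \<in> ?T" for h x
    using that conj nz by (auto simp: T)
  have comp: "?\<phi> (h \<circ> k) x = ?\<phi> h (?\<phi> k x)" if "h \<in> H" "k \<in> H" "x \<in> ?T" for h k x
    using that conj nz H_comp by (auto simp: T)
  have one: "?\<phi> id x = x" if "x \<in> ?T" for x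
    using that conj H_id by (auto simp: T)
  have bij: "?\<phi> h \<in> Bij ?T" if h: "h \<in> H" for h
  proof -
    have "h \<in> isom"
      using H_isom h by blast
    then have "inv_into UNIV h \<circ> h = id" "h \<circ> inv_into UNIV h = id"
      by (simp_all add: fun_eq_iff)
    then have "bij_betw (?\<phi> h) ?T ?T"
      using comp[OF h H_inv[OF h]] comp[OF H_inv[OF h] h] one maps h H_inv[OF h]
      by (intro bij_betw_byWitness[of _ "?\<phi> (inv_into UNIV h)"]) auto
    then show ?thesis
      using ext by (simp add: Bij_def)
  qed
  show trans: "transitive_action ((Sp B)\<lparr>carrier := H\<rparr>) ?T ?\<phi>"
  proof (intro transitive_action.intro group_action.intro group_hom.intro group_hom_axioms.intro
      transitive_action_axioms.intro)
    show "group ((Sp B)\<lparr>carrier := H\<rparr>)"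
      using sub group_Sp by (rule subgroup.subgroup_is_group)
    show "group (BijGroup ?T)"
      by (rule group_BijGroup)
    show "?\<phi> \<in> hom ((Sp B)\<lparr>carrier := H\<rparr>) (BijGroup ?T)"
    proof (rule homI)
      fix h k assume "h \<in> carrier ((Sp B)\<lparr>carrier := H\<rparr>)" "k \<in> carrier ((Sp B)\<lparr>carrier := H\<rparr>)"
      then have hk: "h \<in> H" "k \<in> H"
        by auto
      have "?\<phi> (h \<circ> k) = compose ?T (?\<phi> h) (?\<phi> k)"
        using ext comp[OF hk] by (intro extensionalityI[of _ ?T]) (auto simp: compose_def)
      then show "?\<phi> (h \<otimes>\<^bsub>(Sp B)\<lparr>carrier := H\<rparr>\<^esub> k) = ?\<phi> h \<otimes>\<^bsub>BijGroup ?T\<^esub> ?\<phi> k"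
        using bij hk by (simp add: BijGroup_def mult_Sp[OF assms(3)])
    qed (use bij in \<open>simp add: BijGroup_def\<close>)
    show "\<exists>h\<in>carrier ((Sp B)\<lparr>carrier := H\<rparr>). ?\<phi> h x = y" if xy: "x \<in> ?T" "y \<in> ?T" for x y
    proof -
      obtain u v where uv: "x = tv u" "u \<noteq> 0" "y = tv v" "v \<noteq> 0"
        using xy by (auto simp: T)
      then show ?thesis
        using transitive_on_nonzero[of u v] conj by auto
    qed
  qed
  show "H \<inter> ?T = {}"
  proof (rule ccontr)
    assume "H \<inter> ?T \<noteq> {}"
    then obtain u where u: "tv u \<in> H" "u \<noteq> 0"
      by (auto simp: T)
    have tvH: "tv v \<in> H" for v
    proof (cases "v = 0")
      case True
      then have "tv v = id"
        by (auto simp: tv_def fun_eq_iff)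
      then show ?thesis
        using H_id by simp
    next
      case False
      then obtain h where h: "h \<in> H" "h u = v"
        using transitive_on_nonzero u(2) by blast
      have "h \<circ> tv u \<circ> inv_into UNIV h = tv v"
        using isom_conj_tv[of h u] H_isom h by auto
      then show ?thesis
        using H_comp[OF H_comp[OF h(1) u(1)] H_inv[OF h(1)]] by simp
    qed
    have "tvs cs \<in> H" for cs
      using H_id tvH H_comp by (induction cs) auto
    then have "isom \<subseteq> H"
      using transvections_generate by blast
    then show False
      using assms(5) H_isom carrier_Sp_eq[OF assms(3)] by blast
  qed
qed

end
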